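(* For any integer $d\geq 1$ and any $\varepsilon >0$, there exist an integer $n$ and a real symmetric positive semidefinite matrix $C\in\mathbb{R}^{dn\times dn}$ with $d\times d$ blocks $C_{ij}$ such that \[ \frac{\displaystyle{\max_{O_1,\dots,O_n \in \mathcal{O}_d} \sum_{i=1}^n\sum_{j=1}^n\operatorname{tr}\left(C_{ij}^TO_iO_j^T\right)}}{\displaystyle{\max_{\substack{ X_iX_i^T=I_{d\times d} \\ X_i\in\mathbb{R}^{d\times dn} }} \sum_{i=1}^n\sum_{j=1}^n\operatorname{tr}\left(C_{ij}^TX_iX_j^T\right)}}\leq \alpha_{\mathbb{R}}(d)^2 + \varepsilon. \]
   Context: $\mathcal{O}_d$ is the group of real $d\times d$ orthogonal matrices. For $G\in\mathbb{R}^{d\times d}$ with i.i.d. real $\mathcal{N}(0,d^{-1})$ entries, $\alpha_{\mathbb{R}}(d)=\mathbb{E}\left[\frac1d\sum_{j=1}^d\sigma_j(G)\right]$, where $\sigma_j$ is the $j$-th singular value. *)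

theory Defs
  imports "Jordan_Normal_Form.Char_Poly" "HOL-Probability.Probability"
begin

definition mtrace :: "real Matrix.mat \<Rightarrow> real" where
  "mtrace A = (\<Sum>i<dim_row A. A $$ (i, i))"

definition orth_group :: "nat \<Rightarrow> real Matrix.mat set" where
  "orth_group d = {Q. Q \<in> carrier_mat d d \<and> Q * transpose_mat Q = 1\<^sub>m d}"

definition blk :: "real Matrix.mat \<Rightarrow> nat \<Rightarrow> nat \<Rightarrow> nat \<Rightarrow> real Matrix.mat" where
  "blk C d i j = Matrix.mat d d (\<lambda>(a, b). C $$ (i * d + a, j * d + b))"

definition objective :: "real Matrix.mat \<Rightarrow> nat \<Rightarrow> nat \<Rightarrow> (nat \<Rightarrow> real Matrix.mat) \<Rightarrow> real" where
  "objective C d n X = (\<Sum>i<n. \<Sum>j<n. mtrace (transpose_mat (blk C d i j) * (X i * transpose_mat (X j))))"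

definition orth_val :: "real Matrix.mat \<Rightarrow> nat \<Rightarrow> nat \<Rightarrow> real" where
  "orth_val C d n = (SUP Q \<in> {Q. \<forall>i<n. Q i \<in> orth_group d}. objective C d n Q)"

definition relax_val :: "real Matrix.mat \<Rightarrow> nat \<Rightarrow> nat \<Rightarrow> real" where
  "relax_val C d n = (SUP X \<in> {X. \<forall>i<n. X i \<in> carrier_mat d (d * n) \<and> X i * transpose_mat (X i) = 1\<^sub>m d}.
      objective C d n X)"

(* Sum of the singular values of G: the singular values are the square roots of the
   eigenvalues of G^T G, counted with algebraic multiplicity. *)
definition sum_singular_values :: "real Matrix.mat \<Rightarrow> real" where
  "sum_singular_values G =
     (let p = char_poly (transpose_mat G * G) in
      \<Sum>e \<in> {e. poly p e = 0}. real (order e p) * sqrt e)"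

definition alpha_R :: "nat \<Rightarrow> real" where
  "alpha_R d = (\<integral>g. (1 / real d) * sum_singular_values (Matrix.mat d d g)
      \<partial>(PiM ({..<d} \<times> {..<d}) (\<lambda>_. density lborel (normal_density 0 (sqrt (1 / real d))))))"

end

theory Submission
  imports Defs "Jordan_Normal_Form.Schur_Decomposition"
begin

text \<open>
  Let \<open>V\<close> be a \<open>d \<times> p\<close> matrix of independent \<open>N(0, 1/d)\<close> entries. Cut the space of such matrices into
  finitely many cells, cell \<open>k\<close> consisting of those \<open>V\<close> whose best match in a fine finite net of
  matrices \<open>Y\<^sub>k\<close> with orthonormal rows is \<open>Y\<^sub>k\<close>, and let \<open>A\<^sub>k\<close> be the integral of \<open>V\<close> over cell \<open>k\<close>. The cost
  matrix has blocks \<open>A\<^sub>i A\<^sub>j\<^sup>T\<close>, so that the objective is \<open>\<parallel>\<Sum>\<^sub>i A\<^sub>i\<^sup>T X\<^sub>i\<parallel>\<^sup>2\<close> in the Frobenius norm.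

  For orthogonal \<open>O\<^sub>i\<close> put \<open>M = \<Sum>\<^sub>i A\<^sub>i\<^sup>T O\<^sub>i\<close>. Then \<open>\<parallel>M\<parallel>\<^sup>2\<close> is the expectation of the pairing of \<open>V M\<close> with
  the \<open>O\<^sub>i\<close> of the cell of \<open>V\<close>, hence at most the mean nuclear norm of \<open>V M\<close>, without any discretisation
  error. By rotation invariance \<open>M\<close> may be taken to live on the first \<open>d\<close> rows, and averaging over signed
  cyclic permutations of these rows bounds that mean by \<open>\<parallel>M\<parallel> \<surd>d \<alpha>\<close>. So the orthogonal value is at most
  \<open>d \<alpha>\<^sup>2\<close>. Conversely \<open>X\<^sub>k = Y\<^sub>k\<close> shows that the relaxed value is at least \<open>(E max\<^sub>k \<langle>V, Y\<^sub>k\<rangle>)\<^sup>2 / p\<close>, nearly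
  \<open>(E \<parallel>V\<parallel>\<^sub>*)\<^sup>2 / p\<close>, which tends to \<open>d\<close> because for large \<open>p\<close> all singular values of \<open>V\<close> concentrate at
  \<open>\<surd>(p/d)\<close>.
\<close>

section \<open>Spectral theorem and singular values\<close>

text \<open>Pairing \<open>M\<close> with itself while one copy is held fixed makes
  \<open>\<parallel>M\<parallel>\<^sup>2\<close> linear in the \<open>A\<^sub>i\<close>, hence a
  single expectation over \<open>V\<close>; the resulting bound is a multiple of
  \<open>\<parallel>M\<parallel>\<close>, and one factor cancels. This uses only that the cells form
  a partition, so the net may be tuned to the relaxation alone. There the price is a Cauchy-Schwarz
  step between a trace and a Frobenius norm. It is nearly free because the mean of
  \<open>V\<^sup>T Y(V)\<close>, for an exact polar factor \<open>Y(V)\<close>, commutes with all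
  orthogonal matrices and so is a multiple of the identity. \<open>alpha_R\<close> is defined
  through roots of a characteristic polynomial; the spectral theorem translates this into duality,
  the nuclear norm being the largest pairing with a contraction, and nearly everything afterwards
  rests on that. No Haar measure occurs: reflections in coordinate planes suffice for elimination,
  sign changes and transpositions. No concentration inequality occurs either: a quartic minorant of
  the singular values leaves only second and fourth moments to compute.\<close>

lemma mtrace_mult_commute:
  assumes "A \<in> carrier_mat n m" "B \<in> carrier_mat m n"
  shows "mtrace (A * B) = mtrace (B * A)"
proof -
  have "mtrace (A * B) = (\<Sum>i<n. \<Sum>j<m. A $$ (i, j) * B $$ (j, i))"
    using assms by (simp add: mtrace_def scalar_prod_def atLeast0LessThan)
  also have "\<dots> = (\<Sum>j<m. \<Sum>i<n. B $$ (j, i) * A $$ (i, j))"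
    by (subst sum.swap) (simp add: mult.commute)
  also have "\<dots> = mtrace (B * A)"
    using assms by (simp add: mtrace_def scalar_prod_def atLeast0LessThan)
  finally show ?thesis .
qed

text \<open>The number \<open>s\<close>, the Hermitian form of \<open>A\<close> at \<open>v\<close>,
  is its own conjugate by symmetry, and it is \<open>a\<close> times a positive real.\<close>

lemma symmetric_complex_eigenvalue_real:
  fixes A :: "real Matrix.mat" and a :: complex
  assumes A: "A \<in> carrier_mat n n" and sym: "transpose_mat A = A"
    and ev: "eigenvalue (map_mat complex_of_real A) a"
  shows "Im a = 0"
proof -
  let ?B = "map_mat complex_of_real A"
  from ev obtain v where v: "v \<in> carrier_vec n" "v \<noteq> 0\<^sub>v n" "?B *\<^sub>v v = a \<cdot>\<^sub>v v"
    using A unfolding eigenvalue_def eigenvector_def by auto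
  have row: "(\<Sum>j<n. of_real (A $$ (i, j)) * vec_index v j) = a * vec_index v i" if "i < n" for i
  proof -
    have "vec_index (?B *\<^sub>v v) i = vec_index (a \<cdot>\<^sub>v v) i" using v(3) by simp
    then show ?thesis using A v(1) that by (simp add: scalar_prod_def atLeast0LessThan)
  qed
  have symA: "A $$ (i, j) = A $$ (j, i)" if "i < n" "j < n" for i j
    using arg_cong[OF sym, of "\<lambda>M. M $$ (i, j)"] A that by simp
  define s where "s = (\<Sum>i<n. \<Sum>j<n. cnj (vec_index v i) * (of_real (A $$ (i, j)) * vec_index v j))"
  have s1: "s = (\<Sum>i<n. cnj (vec_index v i) * (a * vec_index v i))"
    unfolding s_def sum_distrib_left[symmetric] by (rule sum.cong) (simp_all add: row)
  have s2: "s = a * of_real (\<Sum>i<n. (cmod (vec_index v i))\<^sup>2)"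
    unfolding s1 of_real_sum sum_distrib_left
    by (rule sum.cong) (simp_all only: complex_norm_square mult_ac)
  have "cnj s = (\<Sum>i<n. \<Sum>j<n. cnj (vec_index v j) * (of_real (A $$ (j, i)) * vec_index v i))"
    unfolding s_def cnj_sum by (intro sum.cong refl) (simp add: symA algebra_simps)
  also have "\<dots> = s" unfolding s_def by (rule sum.swap)
  finally have "Im s = 0" using complex_cnj_cancel_iff by (simp add: complex_eq_iff)
  moreover have "(\<Sum>i<n. (cmod (vec_index v i))\<^sup>2) \<noteq> 0"
  proof
    assume "(\<Sum>i<n. (cmod (vec_index v i))\<^sup>2) = 0"
    then have "\<forall>i<n. vec_index v i = 0" by (subst (asm) sum_nonneg_eq_0_iff) auto
    then have "v = 0\<^sub>v n" using v(1) by (intro eq_vecI) auto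
    then show False using v(2) by simp
  qed
  ultimately show ?thesis unfolding s2 by simp
qed

text \<open>The complex factorisation has only real roots, and it descends to the reals because the
  embedding of real polynomials is injective.\<close>

lemma symmetric_char_poly_splits:
  fixes A :: "real Matrix.mat"
  assumes A: "A \<in> carrier_mat n n" and sym: "transpose_mat A = A"
  shows "\<exists>es. char_poly A = (\<Prod>e\<leftarrow>es. [:- e, 1:]) \<and> length es = n"
proof -
  interpret of_real_poly_hom: map_poly_inj_idom_hom complex_of_real ..
  let ?B = "map_mat complex_of_real A"
  have B: "?B \<in> carrier_mat n n" using A by simp
  obtain as where as: "char_poly ?B = (\<Prod>a\<leftarrow>as. [:- a, 1:])" "length as = n"
    using char_poly_factorized[OF B] by auto
  have real: "of_real (Re a) = a" if "a \<in> set as" for a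
  proof -
    have "poly (char_poly ?B) a = 0" unfolding as(1) using that
      by (auto simp: poly_prod_list prod_list_zero_iff)
    then have "eigenvalue ?B a" using eigenvalue_root_char_poly[OF B] by simp
    from symmetric_complex_eigenvalue_real[OF A sym this] show ?thesis
      by (simp add: complex_eq_iff)
  qed
  have "map_poly complex_of_real (char_poly A) = char_poly ?B"
    by (rule of_real_hom.char_poly_hom[OF A, symmetric])
  also have "\<dots> = (\<Prod>a\<leftarrow>as. map_poly of_real [:- Re a, 1:])"
    unfolding as(1) by (rule arg_cong[of _ _ prod_list], rule map_cong) (auto simp: real)
  also have "\<dots> = map_poly of_real (\<Prod>a\<leftarrow>as. [:- Re a, 1:])"
    by (simp add: of_real_poly_hom.hom_prod_list comp_def)
  finally have "char_poly A = (\<Prod>a\<leftarrow>as. [:- Re a, 1:])"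
    by (simp only: of_real_poly_hom.eq_iff)
  then have "char_poly A = (\<Prod>e\<leftarrow>map Re as. [:- e, 1:])" by (simp add: comp_def)
  then show ?thesis using as(2) by (metis length_map)
qed

text \<open>The trace is the sum of the roots, read off a Schur form, so it would equal
  \<open>n\<close> times \<open>c\<close> if \<open>c\<close> were the only root.\<close>

lemma symmetric_eigenvalue_avoiding:
  fixes A :: "real Matrix.mat"
  assumes A: "A \<in> carrier_mat n n" and sym: "transpose_mat A = A"
    and tr: "mtrace A \<noteq> real n * c"
  shows "\<exists>e. e \<noteq> c \<and> eigenvalue A e"
proof (rule ccontr)
  assume contra: "\<not> ?thesis"
  obtain es where es: "char_poly A = (\<Prod>e\<leftarrow>es. [:- e, 1:])" "length es = n"
    using symmetric_char_poly_splits[OF A sym] by blast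
  have all: "e = c" if "e \<in> set es" for e
  proof -
    have "poly (char_poly A) e = 0" unfolding es(1) using that
      by (auto simp: poly_prod_list prod_list_zero_iff)
    then have "eigenvalue A e" using eigenvalue_root_char_poly[OF A] by simp
    with contra show ?thesis by auto
  qed
  obtain B P Q where BPQ: "schur_decomposition A es = (B, P, Q)"
    by (cases "schur_decomposition A es") auto
  from schur_decomposition[OF A es(1) BPQ]
  have wit: "similar_mat_wit A B P Q" and diag: "diag_mat B = es" by auto
  from similar_mat_witD2[OF A wit] have c: "B \<in> carrier_mat n n" "P \<in> carrier_mat n n"
    "Q \<in> carrier_mat n n" and QP: "Q * P = 1\<^sub>m n" and AB: "A = P * B * Q" by auto
  have "mtrace A = mtrace (P * (B * Q))" using AB c by (simp add: assoc_mult_mat)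
  also have "\<dots> = mtrace ((B * Q) * P)" by (rule mtrace_mult_commute[of _ n n]) (use c in auto)
  also have "(B * Q) * P = B" using c QP by (simp add: assoc_mult_mat[of _ n n _ n _ n])
  finally have "mtrace A = mtrace B" .
  also have "\<dots> = sum_list (diag_mat B)"
    unfolding mtrace_def diag_mat_def by (simp add: interv_sum_list_conv_sum_set_nat atLeast0LessThan)
  also have "\<dots> = sum_list (map (\<lambda>_. c) es)" unfolding diag
    by (rule arg_cong[of _ _ sum_list]) (metis all map_idI)
  also have "\<dots> = real n * c" using es(2) by (simp add: sum_list_triv)
  finally show False using tr by simp
qed

text \<open>Deflation: the eigenvalues of the eigenvectors found so far are all moved to a value \<open>c\<close> for which
  the trace excludes \<open>c\<close> as the only eigenvalue. An eigenvector for another eigenvalue is orthogonal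
  to the previous ones.\<close>

lemma symmetric_orthonormal_eigenvectors:
  fixes A :: "real Matrix.mat"
  assumes A: "A \<in> carrier_mat n n" and sym: "transpose_mat A = A" and "m \<le> n"
  shows "\<exists>r ev. (\<forall>k<m. \<forall>l<m. (\<Sum>i<n. r k i * r l i) = (if k = l then 1 else 0))
    \<and> (\<forall>k<m. \<forall>i<n. (\<Sum>j<n. A $$ (i, j) * r k j) = ev k * r k i)"
  using \<open>m \<le> n\<close>
proof (induction m)
  case 0
  then show ?case by simp
next
  case (Suc m)
  then have mn': "m \<le> n" by simp
  obtain r ev where orth: "\<And>k l. k < m \<Longrightarrow> l < m \<Longrightarrow> (\<Sum>i<n. r k i * r l i) = (if k = l then 1 else 0)"
    and eig: "\<And>k i. k < m \<Longrightarrow> i < n \<Longrightarrow> (\<Sum>j<n. A $$ (i, j) * r k j) = ev k * r k i"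
    using Suc.IH[OF mn'] by blast
  have mn: "m < n" using Suc by simp
  have symA: "A $$ (i, j) = A $$ (j, i)" if "i < n" "j < n" for i j
    using arg_cong[OF sym, of "\<lambda>M. M $$ (i, j)"] A that by simp
  \<comment> \<open>The summand 1 makes \<open>n - m\<close> copies of \<open>c\<close> exceed the
    trace left over for the complement, so \<open>c\<close> cannot be the only eigenvalue of
    \<open>D\<close>.\<close>
  define c where "c = (mtrace A - (\<Sum>k<m. ev k)) / (real n - real m) + 1"
  \<comment> \<open>\<open>D\<close> agrees with \<open>A\<close> on the complement of the
    \<open>r k\<close> and has eigenvalue \<open>c\<close> on each of them.\<close>
  define D where "D = Matrix.mat n n (\<lambda>(i, j). A $$ (i, j) + (\<Sum>k<m. (c - ev k) * (r k i * r k j)))"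
  have D: "D \<in> carrier_mat n n" by (simp add: D_def)
  have Dentry: "D $$ (i, j) = A $$ (i, j) + (\<Sum>k<m. (c - ev k) * (r k i * r k j))" if "i < n" "j < n" for i j
    using that by (simp add: D_def)
  have symD: "transpose_mat D = D"
    by (intro eq_matI) (auto simp: D_def symA mult.commute)
  have "mtrace D = mtrace A + (\<Sum>i<n. \<Sum>k<m. (c - ev k) * (r k i * r k i))"
    using A D by (simp add: mtrace_def Dentry sum.distrib)
  also have "(\<Sum>i<n. \<Sum>k<m. (c - ev k) * (r k i * r k i)) = (\<Sum>k<m. c - ev k)"
    by (subst sum.swap) (simp add: sum_distrib_left[symmetric] orth)
  finally have "mtrace D = mtrace A - (\<Sum>k<m. ev k) + real m * c"
    by (simp add: sum_subtractf)
  moreover have "(real n - real m) * c = mtrace A - (\<Sum>k<m. ev k) + (real n - real m)"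
    using mn by (simp add: c_def field_simps)
  ultimately have "mtrace D \<noteq> real n * c"
    using mn by (simp add: algebra_simps)
  from symmetric_eigenvalue_avoiding[OF D symD this] obtain e where e: "e \<noteq> c" "eigenvalue D e"
    by blast
  then obtain v where v: "v \<in> carrier_vec n" "v \<noteq> 0\<^sub>v n" "D *\<^sub>v v = e \<cdot>\<^sub>v v"
    using D unfolding eigenvalue_def eigenvector_def by auto
  define w where "w i = vec_index v i" for i
  have row: "(\<Sum>j<n. D $$ (i, j) * w j) = e * w i" if "i < n" for i
  proof -
    have "vec_index (D *\<^sub>v v) i = vec_index (e \<cdot>\<^sub>v v) i" using v(3) by simp
    then show ?thesis using D v(1) that by (simp add: w_def scalar_prod_def atLeast0LessThan)
  qed
  have Dr: "(\<Sum>i<n. D $$ (i, j) * r k i) = c * r k j" if "k < m" "j < n" for k j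
  proof -
    have "(\<Sum>i<n. D $$ (i, j) * r k i)
        = (\<Sum>i<n. A $$ (j, i) * r k i + (\<Sum>l<m. (c - ev l) * (r l i * r l j)) * r k i)"
      using that by (intro sum.cong refl) (simp add: Dentry symA[of _ j] distrib_right)
    also have "\<dots> = (\<Sum>i<n. A $$ (j, i) * r k i)
        + (\<Sum>i<n. \<Sum>l<m. (c - ev l) * r l j * (r l i * r k i))"
      unfolding sum.distrib sum_distrib_right by (simp add: mult_ac)
    also have "(\<Sum>i<n. \<Sum>l<m. (c - ev l) * r l j * (r l i * r k i))
        = (\<Sum>l<m. (c - ev l) * r l j * (\<Sum>i<n. r l i * r k i))"
      by (subst sum.swap) (simp add: sum_distrib_left)
    also have "\<dots> = (\<Sum>l<m. if l = k then (c - ev l) * r l j else 0)"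
      by (rule sum.cong) (simp_all add: orth that)
    also have "\<dots> = (c - ev k) * r k j" using that by simp
    finally show ?thesis unfolding eig[OF that] by (simp add: left_diff_distrib)
  qed
  have perp: "(\<Sum>i<n. r k i * w i) = 0" if k: "k < m" for k
  proof -
    have "e * (\<Sum>i<n. r k i * w i) = (\<Sum>i<n. r k i * (\<Sum>j<n. D $$ (i, j) * w j))"
      unfolding sum_distrib_left[of e] by (rule sum.cong) (simp_all add: row)
    also have "\<dots> = (\<Sum>j<n. w j * (\<Sum>i<n. D $$ (i, j) * r k i))"
      unfolding sum_distrib_left by (subst sum.swap) (simp add: mult_ac)
    also have "\<dots> = c * (\<Sum>i<n. r k i * w i)"
      unfolding sum_distrib_left[of c] by (rule sum.cong) (simp_all add: Dr k)
    finally have "(e - c) * (\<Sum>i<n. r k i * w i) = 0" by (simp add: left_diff_distrib)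
    then show ?thesis using e(1) by simp
  qed
  have Aw: "(\<Sum>j<n. A $$ (i, j) * w j) = e * w i" if i: "i < n" for i
  proof -
    have "e * w i = (\<Sum>j<n. A $$ (i, j) * w j + (\<Sum>k<m. (c - ev k) * (r k i * r k j)) * w j)"
      unfolding row[OF i, symmetric] using i by (intro sum.cong refl) (simp add: Dentry distrib_right)
    also have "\<dots> = (\<Sum>j<n. A $$ (i, j) * w j) + (\<Sum>j<n. \<Sum>k<m. (c - ev k) * r k i * (r k j * w j))"
      unfolding sum.distrib sum_distrib_right by (simp add: mult_ac)
    also have "(\<Sum>j<n. \<Sum>k<m. (c - ev k) * r k i * (r k j * w j)) = 0"
      by (subst sum.swap) (simp add: sum_distrib_left[symmetric] perp)
    finally show ?thesis by simp
  qed
  define N where "N = (\<Sum>i<n. w i * w i)"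
  have "N \<noteq> 0"
  proof
    assume "N = 0"
    then have "\<forall>i<n. w i = 0" unfolding N_def by (subst (asm) sum_nonneg_eq_0_iff) auto
    then have "v = 0\<^sub>v n" using v(1) by (intro eq_vecI) (auto simp: w_def)
    then show False using v(2) by simp
  qed
  moreover have "N \<ge> 0" by (simp add: N_def sum_nonneg)
  ultimately have N: "N > 0" by simp
  define u where "u i = w i / sqrt N" for i
  have u1: "(\<Sum>i<n. u i * u i) = 1"
    using N by (simp add: u_def N_def[symmetric] sum_divide_distrib[symmetric])
  have u2: "(\<Sum>i<n. r k i * u i) = 0" "(\<Sum>i<n. u i * r k i) = 0" if "k < m" for k
    using perp[OF that] by (simp_all add: u_def sum_divide_distrib[symmetric] mult.commute)
  have u3: "(\<Sum>j<n. A $$ (i, j) * u j) = e * u i" if "i < n" for i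
    using Aw[OF that] by (simp add: u_def sum_divide_distrib[symmetric])
  show ?case
  proof (intro exI conjI allI impI)
    fix k l assume "k < Suc m" "l < Suc m"
    then show "(\<Sum>i<n. (r(m := u)) k i * (r(m := u)) l i) = (if k = l then 1 else 0)"
      by (cases "k = m"; cases "l = m") (auto simp: u1 u2 orth)
  next
    fix k i assume "k < Suc m" "i < n"
    then show "(\<Sum>j<n. A $$ (i, j) * (r(m := u)) k j) = (ev(m := e)) k * (r(m := u)) k i"
      by (cases "k = m") (auto simp: u3 eig)
  qed
qed

text \<open>Besides the eigenbasis, the factored characteristic polynomial is recorded: it ties the
  \<open>ev k\<close>, with multiplicity, to \<open>sum_singular_values\<close>.\<close>

lemma symmetric_spectral_theorem:
  fixes A :: "real Matrix.mat"
  assumes A: "A \<in> carrier_mat n n" and sym: "transpose_mat A = A"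
  obtains r ev where
    "\<And>k l. k < n \<Longrightarrow> l < n \<Longrightarrow> (\<Sum>i<n. r k i * r l i) = (if k = l then 1 else 0 :: real)"
    "\<And>i j. i < n \<Longrightarrow> j < n \<Longrightarrow> (\<Sum>k<n. r k i * r k j) = (if i = j then 1 else 0)"
    "\<And>k i. k < n \<Longrightarrow> i < n \<Longrightarrow> (\<Sum>j<n. A $$ (i, j) * r k j) = ev k * r k i"
    "char_poly A = (\<Prod>k<n. [:- ev k, 1:])"
proof -
  obtain r ev where orth: "\<And>k l. k < n \<Longrightarrow> l < n \<Longrightarrow> (\<Sum>i<n. r k i * r l i) = (if k = l then 1 else 0 :: real)"
    and eig: "\<And>k i. k < n \<Longrightarrow> i < n \<Longrightarrow> (\<Sum>j<n. A $$ (i, j) * r k j) = ev k * r k i"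
    using symmetric_orthonormal_eigenvectors[OF A sym order_refl] by blast
  define R where "R = Matrix.mat n n (\<lambda>(k, i). r k i)"
  define L where "L = Matrix.mat n n (\<lambda>(k, l). if k = l then ev k else 0)"
  have R: "R \<in> carrier_mat n n" and L: "L \<in> carrier_mat n n" by (simp_all add: R_def L_def)
  have RR: "R * transpose_mat R = 1\<^sub>m n"
    by (intro eq_matI) (auto simp: R_def scalar_prod_def atLeast0LessThan orth)
  \<comment> \<open>A one-sided inverse of a square matrix is two-sided; this turns orthonormality
    into completeness.\<close>
  then have RR': "transpose_mat R * R = 1\<^sub>m n"
    using mat_mult_left_right_inverse[OF R _ RR] R by simp
  have complete: "(\<Sum>k<n. r k i * r k j) = (if i = j then 1 else 0)" if "i < n" "j < n" for i j
  proof -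
    have "(transpose_mat R * R) $$ (i, j) = (1\<^sub>m n :: real Matrix.mat) $$ (i, j)" using RR' by simp
    then show ?thesis using that by (simp add: R_def scalar_prod_def atLeast0LessThan)
  qed
  have "A * transpose_mat R = transpose_mat R * L"
  proof (intro eq_matI)
    fix i k assume "i < dim_row (transpose_mat R * L)" "k < dim_col (transpose_mat R * L)"
    then have ik: "i < n" "k < n" using R L by auto
    have "(A * transpose_mat R) $$ (i, k) = ev k * r k i"
      using ik A by (simp add: R_def scalar_prod_def atLeast0LessThan eig)
    moreover have "(transpose_mat R * L) $$ (i, k) = (\<Sum>l<n. if l = k then r l i * ev l else 0)"
      using ik by (simp add: R_def L_def scalar_prod_def atLeast0LessThan if_distrib cong: if_cong)
    ultimately show "(A * transpose_mat R) $$ (i, k) = (transpose_mat R * L) $$ (i, k)"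
      using ik by simp
  qed (use A R L in auto)
  then have "transpose_mat R * L * R = A * (transpose_mat R * R)"
    using A R by (simp add: assoc_mult_mat[of _ n n _ n _ n, symmetric])
  then have "A = transpose_mat R * L * R" using A RR' by simp
  then have "similar_mat A L"
    unfolding similar_mat_def similar_mat_wit_def Let_def
    using A R L RR RR' by (intro exI[of _ "transpose_mat R"] exI[of _ R]) auto
  then have "char_poly A = char_poly L" by (rule char_poly_similar)
  also have "\<dots> = (\<Prod>a\<leftarrow>diag_mat L. [:- a, 1:])"
    by (rule char_poly_upper_triangular[OF L]) (auto simp: L_def upper_triangular_def)
  also have "diag_mat L = map ev [0..<n]" by (auto simp: diag_mat_def L_def)
  finally have "char_poly A = (\<Prod>k<n. [:- ev k, 1:])"
    by (simp add: comp_def prod.distinct_set_conv_list[symmetric] atLeast0LessThan)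
  with orth complete eig show thesis by (rule that)
qed


section \<open>Singular values from the characteristic polynomial\<close>

lemma order_prod_linear:
  fixes f :: "'i \<Rightarrow> 'a :: idom"
  assumes "finite S"
  shows "Polynomial.order e (\<Prod>k\<in>S. [:- f k, 1:]) = card {k \<in> S. f k = e}"
  using assms
proof (induction S rule: finite_induct)
  case empty
  then show ?case by (simp add: order_0I)
next
  case (insert x S)
  have nz: "[:- f x, 1:] * (\<Prod>k\<in>S. [:- f k, 1:]) \<noteq> 0"
    using insert.hyps by (intro no_zero_divisors) (simp_all add: prod_zero_iff)
  have "Polynomial.order e [:- f x, 1:] = (if f x = e then 1 else 0)"
    by (auto simp: order_linear' intro: order_0I)
  moreover have "{k \<in> insert x S. f k = e} = (if f x = e then insert x {k \<in> S. f k = e} else {k \<in> S. f k = e})"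
    by auto
  ultimately show ?case
    using insert order_mult[OF nz, of e] by auto
qed

text \<open>Converts a sum over distinct roots weighted by multiplicity, the form used in
  \<open>sum_singular_values\<close>, into a sum over the indices of an eigenbasis.\<close>

lemma sum_roots_prod_linear:
  fixes f :: "'i \<Rightarrow> real" and p :: "real poly"
  assumes fin: "finite S" and p: "p = (\<Prod>k\<in>S. [:- f k, 1:])"
  shows "(\<Sum>e \<in> {e. poly p e = 0}. real (Polynomial.order e p) * h e) = (\<Sum>k\<in>S. h (f k))"
proof -
  have roots: "{e. poly p e = 0} = f ` S"
    using fin by (auto simp: p poly_prod)
  have "(\<Sum>e\<in>f ` S. real (Polynomial.order e p) * h e) = (\<Sum>e\<in>f ` S. \<Sum>k\<in>{k \<in> S. f k = e}. h (f k))"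
    by (rule sum.cong) (simp_all add: p order_prod_linear[OF fin])
  also have "\<dots> = (\<Sum>k\<in>S. h (f k))"
    by (rule sum.image_gen[OF fin, symmetric])
  finally show ?thesis using roots by simp
qed

lemma orthonormal_expansion:
  fixes r :: "nat \<Rightarrow> nat \<Rightarrow> real"
  assumes complete: "\<And>i j. i < n \<Longrightarrow> j < n \<Longrightarrow> (\<Sum>k<n. r k i * r k j) = (if i = j then 1 else 0)"
    and i: "i < n"
  shows "(\<Sum>k<n. (\<Sum>j<n. x j * r k j) * r k i) = x i"
proof -
  have "(\<Sum>k<n. (\<Sum>j<n. x j * r k j) * r k i) = (\<Sum>k<n. \<Sum>j<n. x j * (r k j * r k i))"
    by (simp add: sum_distrib_left sum_distrib_right mult_ac)
  also have "\<dots> = (\<Sum>j<n. x j * (\<Sum>k<n. r k j * r k i))"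
    by (subst sum.swap) (simp add: sum_distrib_left)
  also have "\<dots> = (\<Sum>j<n. if j = i then x j else 0)"
    by (rule sum.cong) (simp_all add: complete i)
  finally show ?thesis using i by simp
qed

text \<open>A weighted Parseval identity. Weights \<open>q k = 0\<close> admit vanishing left
  singular vectors, so full and partial orthonormal systems are treated alike.\<close>

lemma sum_square_orthogonal_combination:
  fixes z :: "nat \<Rightarrow> nat \<Rightarrow> real"
  assumes z: "\<And>k l. k < n \<Longrightarrow> l < n \<Longrightarrow> (\<Sum>a<m. z k a * z l a) = (if k = l then q k else 0)"
  shows "(\<Sum>a<m. (\<Sum>k<n. x k * z k a) * (\<Sum>k<n. y k * z k a)) = (\<Sum>k<n. x k * y k * q k)"
proof -
  have "(\<Sum>a<m. (\<Sum>k<n. x k * z k a) * (\<Sum>k<n. y k * z k a))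
      = (\<Sum>a<m. \<Sum>k<n. \<Sum>l<n. x k * y l * (z k a * z l a))"
    by (simp add: sum_product mult_ac)
  also have "\<dots> = (\<Sum>k<n. \<Sum>l<n. x k * y l * (\<Sum>a<m. z k a * z l a))"
    by (subst sum.swap, rule sum.cong[OF refl], subst sum.swap) (simp add: sum_distrib_left)
  also have "\<dots> = (\<Sum>k<n. \<Sum>l<n. if l = k then x k * y l * q k else 0)"
    by (intro sum.cong refl) (simp add: z)
  finally show ?thesis by simp
qed

text \<open>The left singular vectors \<open>z k\<close> belonging to \<open>s k = 0\<close> are taken to be zero, which avoids
  completing them to an orthonormal system.\<close>

lemma singular_value_decomposition:
  fixes g :: "nat \<times> nat \<Rightarrow> real"
  obtains r s z where
    "\<And>k l. k < n \<Longrightarrow> l < n \<Longrightarrow> (\<Sum>i<n. r k i * r l i) = (if k = l then 1 else 0 :: real)"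
    "\<And>i j. i < n \<Longrightarrow> j < n \<Longrightarrow> (\<Sum>k<n. r k i * r k j) = (if i = j then 1 else 0)"
    "\<And>k. k < n \<Longrightarrow> s k \<ge> (0::real)"
    "\<And>k l. k < n \<Longrightarrow> l < n \<Longrightarrow> (\<Sum>a<m. z k a * z l a) = (if k = l then of_bool (s k \<noteq> 0) else 0 :: real)"
    "\<And>a b. a < m \<Longrightarrow> b < n \<Longrightarrow> g (a, b) = (\<Sum>k<n. s k * z k a * r k b)"
    "char_poly (Matrix.mat n n (\<lambda>(b, c). \<Sum>a<m. g (a, b) * g (a, c))) = (\<Prod>k<n. [:- (s k)\<^sup>2, 1:])"
proof -
  define A where "A = Matrix.mat n n (\<lambda>(b, c). \<Sum>a<m. g (a, b) * g (a, c))"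
  have A: "A \<in> carrier_mat n n" and sym: "transpose_mat A = A"
    by (auto simp: A_def mult.commute intro!: eq_matI)
  obtain r ev where
    orth: "\<And>k l. k < n \<Longrightarrow> l < n \<Longrightarrow> (\<Sum>i<n. r k i * r l i) = (if k = l then 1 else 0 :: real)" and
    complete: "\<And>i j. i < n \<Longrightarrow> j < n \<Longrightarrow> (\<Sum>k<n. r k i * r k j) = (if i = j then 1 else 0)" and
    eig: "\<And>k i. k < n \<Longrightarrow> i < n \<Longrightarrow> (\<Sum>j<n. A $$ (i, j) * r k j) = ev k * r k i" and
    cp: "char_poly A = (\<Prod>k<n. [:- ev k, 1:])"
    using symmetric_spectral_theorem[OF A sym] by blast
  \<comment> \<open>The images of the eigenvectors under \<open>g\<close> are orthogonal with
    squared lengths \<open>ev k\<close>; normalising them gives the left singular vectors.\<close>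
  define y where "y k a = (\<Sum>b<n. g (a, b) * r k b)" for k a
  have yy: "(\<Sum>a<m. y k a * y l a) = (if k = l then ev k else 0)" if "k < n" "l < n" for k l
  proof -
    have "(\<Sum>a<m. y k a * y l a) = (\<Sum>a<m. \<Sum>b<n. \<Sum>c<n. r k b * (g (a, b) * g (a, c) * r l c))"
      by (simp add: y_def sum_product mult_ac)
    also have "\<dots> = (\<Sum>b<n. \<Sum>c<n. \<Sum>a<m. r k b * (g (a, b) * g (a, c) * r l c))"
      by (subst sum.swap, rule sum.cong[OF refl], subst sum.swap) simp
    also have "\<dots> = (\<Sum>b<n. r k b * (\<Sum>c<n. A $$ (b, c) * r l c))"
      by (simp add: A_def sum_distrib_left sum_distrib_right)
    also have "\<dots> = ev l * (\<Sum>b<n. r k b * r l b)"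
      unfolding sum_distrib_left[of "ev l"] by (rule sum.cong) (simp_all add: eig that)
    finally show ?thesis using that by (simp add: orth)
  qed
  have ev: "ev k \<ge> 0" if "k < n" for k
  proof -
    have "(\<Sum>a<m. y k a * y k a) \<ge> 0" by (simp add: sum_nonneg)
    then show ?thesis using yy[OF that that] by simp
  qed
  define s where "s k = sqrt (ev k)" for k
  define z where "z k a = (if s k = 0 then 0 else y k a / s k)" for k a
  have s2: "(s k)\<^sup>2 = ev k" if "k < n" for k using ev[OF that] by (simp add: s_def)
  have zz: "(\<Sum>a<m. z k a * z l a) = (if k = l then of_bool (s k \<noteq> 0) else 0)" if "k < n" "l < n" for k l
  proof -
    have "(\<Sum>a<m. z k a * z l a) = (if s k = 0 \<or> s l = 0 then 0 else (\<Sum>a<m. y k a * y l a) / (s k * s l))"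
      by (auto simp: z_def sum_divide_distrib)
    then show ?thesis using yy[OF that] s2[OF that(1)] by (auto simp: power2_eq_square)
  qed
  have sz: "y k a = s k * z k a" if "k < n" "a < m" for k a
  proof (cases "s k = 0")
    case True
    then have "(\<Sum>a<m. y k a * y k a) = 0" using yy[OF that(1) that(1)] s2[OF that(1)] by simp
    then have "y k a = 0" using that(2) by (subst (asm) sum_nonneg_eq_0_iff) auto
    then show ?thesis using True by simp
  qed (simp add: z_def)
  show thesis
  proof (rule that[of r s z])
    show "g (a, b) = (\<Sum>k<n. s k * z k a * r k b)" if "a < m" "b < n" for a b
    proof -
      have "(\<Sum>k<n. s k * z k a * r k b) = (\<Sum>k<n. (\<Sum>j<n. g (a, j) * r k j) * r k b)"
        by (rule sum.cong) (simp_all add: sz[symmetric] that y_def)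
      also have "\<dots> = g (a, b)" using orthonormal_expansion[OF complete that(2), where x = "\<lambda>j. g (a, j)"] by simp
      finally show ?thesis by simp
    qed
    show "char_poly (Matrix.mat n n (\<lambda>(b, c). \<Sum>a<m. g (a, b) * g (a, c))) = (\<Prod>k<n. [:- (s k)\<^sup>2, 1:])"
      unfolding A_def[symmetric] cp by (rule prod.cong) (simp_all add: s2)
    show "s k \<ge> 0" if "k < n" for k using ev[OF that] by (simp add: s_def)
  qed (use orth complete zz in auto)
qed

section \<open>Duality between the nuclear norm and contractions\<close>

text \<open>The operator norm bound in squared form, free of suprema and roots. Since
  \<open>c\<close> enters only through its square, its sign is a separate hypothesis wherever it
  matters.\<close>

definition op_bound :: "nat \<Rightarrow> real \<Rightarrow> (nat \<times> nat \<Rightarrow> real) \<Rightarrow> bool" where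
  "op_bound d c T \<longleftrightarrow> (\<forall>x. (\<Sum>a<d. (\<Sum>b<d. T (a, b) * x b)\<^sup>2) \<le> c\<^sup>2 * (\<Sum>b<d. (x b)\<^sup>2))"

abbreviation sv_sum :: "nat \<Rightarrow> (nat \<times> nat \<Rightarrow> real) \<Rightarrow> real" where
  "sv_sum d g \<equiv> sum_singular_values (Matrix.mat d d g)"

lemma sum_mult_le_sqrt:
  fixes f g :: "'i \<Rightarrow> real"
  shows "(\<Sum>i\<in>S. f i * g i) \<le> sqrt (\<Sum>i\<in>S. (f i)\<^sup>2) * sqrt (\<Sum>i\<in>S. (g i)\<^sup>2)"
proof -
  have "(\<Sum>i\<in>S. f i * g i) \<le> (\<Sum>i\<in>S. \<bar>f i\<bar> * \<bar>g i\<bar>)"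
    by (rule sum_mono) (metis abs_ge_self abs_mult)
  also have "\<dots> \<le> L2_set f S * L2_set g S" by (rule L2_set_mult_ineq)
  finally show ?thesis by (simp add: L2_set_def)
qed

lemma sv_sum_svd:
  fixes g :: "nat \<times> nat \<Rightarrow> real"
  assumes "\<And>k. k < d \<Longrightarrow> s k \<ge> (0::real)"
    "char_poly (Matrix.mat d d (\<lambda>(b, c). \<Sum>a<d. g (a, b) * g (a, c))) = (\<Prod>k<d. [:- (s k)\<^sup>2, 1:])"
  shows "sv_sum d g = (\<Sum>k<d. s k)"
proof -
  have "transpose_mat (Matrix.mat d d g) * Matrix.mat d d g
      = Matrix.mat d d (\<lambda>(b, c). \<Sum>a<d. g (a, b) * g (a, c))"
    by (intro eq_matI) (auto simp: scalar_prod_def atLeast0LessThan)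
  then have "sv_sum d g = (\<Sum>k<d. sqrt ((s k)\<^sup>2))"
    unfolding sum_singular_values_def Let_def
    by (subst sum_roots_prod_linear[where S = "{..<d}" and f = "\<lambda>k. (s k)\<^sup>2" and h = sqrt])
      (simp_all add: assms(2))
  also have "\<dots> = (\<Sum>k<d. s k)" using assms(1) by (intro sum.cong) auto
  finally show ?thesis .
qed

text \<open>In singular vectors the pairing is the sum over \<open>k\<close> of \<open>s k\<close>
  times the product of \<open>z k\<close> with the image of \<open>r k\<close> under
  \<open>T\<close>; Cauchy-Schwarz bounds each product by \<open>c\<close>.\<close>

lemma pairing_le_sv_sum:
  assumes T: "op_bound d c T" and c: "c \<ge> 0"
  shows "(\<Sum>a<d. \<Sum>b<d. g (a, b) * T (a, b)) \<le> c * sv_sum d g"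
proof -
  obtain r s z where
    orth: "\<And>k l. k < d \<Longrightarrow> l < d \<Longrightarrow> (\<Sum>i<d. r k i * r l i) = (if k = l then 1 else 0 :: real)" and
    complete: "\<And>i j. i < d \<Longrightarrow> j < d \<Longrightarrow> (\<Sum>k<d. r k i * r k j) = (if i = j then 1 else 0)" and
    s: "\<And>k. k < d \<Longrightarrow> s k \<ge> (0::real)" and
    zz: "\<And>k l. k < d \<Longrightarrow> l < d \<Longrightarrow> (\<Sum>a<d. z k a * z l a) = (if k = l then of_bool (s k \<noteq> 0) else 0 :: real)" and
    g: "\<And>a b. a < d \<Longrightarrow> b < d \<Longrightarrow> g (a, b) = (\<Sum>k<d. s k * z k a * r k b)" and
    cp: "char_poly (Matrix.mat d d (\<lambda>(b, c). \<Sum>a<d. g (a, b) * g (a, c))) = (\<Prod>k<d. [:- (s k)\<^sup>2, 1:])"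
    using singular_value_decomposition[where n = d and m = d and g = g] by blast
  have one: "(\<Sum>a<d. z k a * (\<Sum>b<d. T (a, b) * r k b)) \<le> c" if k: "k < d" for k
  proof -
    have "(\<Sum>a<d. z k a * (\<Sum>b<d. T (a, b) * r k b))
        \<le> sqrt (\<Sum>a<d. (z k a)\<^sup>2) * sqrt (\<Sum>a<d. (\<Sum>b<d. T (a, b) * r k b)\<^sup>2)"
      by (rule sum_mult_le_sqrt)
    also have "\<dots> \<le> 1 * c"
    proof (rule mult_mono)
      show "sqrt (\<Sum>a<d. (z k a)\<^sup>2) \<le> 1" using zz[OF k k] by (simp add: power2_eq_square)
      have "(\<Sum>a<d. (\<Sum>b<d. T (a, b) * r k b)\<^sup>2) \<le> c\<^sup>2"
        using T[unfolded op_bound_def, rule_format, of "r k"] orth[OF k k] by (simp add: power2_eq_square)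
      then show "sqrt (\<Sum>a<d. (\<Sum>b<d. T (a, b) * r k b)\<^sup>2) \<le> c"
        using c by (simp add: real_le_lsqrt sum_nonneg)
    qed (simp_all add: sum_nonneg)
    finally show ?thesis by simp
  qed
  have "(\<Sum>a<d. \<Sum>b<d. g (a, b) * T (a, b)) = (\<Sum>a<d. \<Sum>b<d. \<Sum>k<d. s k * (z k a * (T (a, b) * r k b)))"
    by (intro sum.cong refl) (simp add: g sum_distrib_left sum_distrib_right mult_ac)
  also have "\<dots> = (\<Sum>a<d. \<Sum>k<d. \<Sum>b<d. s k * (z k a * (T (a, b) * r k b)))"
    by (intro sum.cong refl sum.swap)
  also have "\<dots> = (\<Sum>k<d. s k * (\<Sum>a<d. z k a * (\<Sum>b<d. T (a, b) * r k b)))"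
    by (subst sum.swap) (simp add: sum_distrib_left)
  also have "\<dots> \<le> (\<Sum>k<d. s k * c)"
    by (intro sum_mono mult_left_mono one) (auto simp: s)
  also have "\<dots> = c * sv_sum d g"
    using sv_sum_svd[OF s cp] by (simp add: sum_distrib_left mult.commute)
  finally show ?thesis .
qed

text \<open>The maximiser is the partial isometry taking \<open>r k\<close> to \<open>z k\<close>.
  It is a contraction because the vanishing \<open>z k\<close> can only lose length.\<close>

lemma sv_sum_attained:
  obtains T where "op_bound d 1 T" "(\<Sum>a<d. \<Sum>b<d. g (a, b) * T (a, b)) = sv_sum d g"
proof -
  obtain r s z where
    orth: "\<And>k l. k < d \<Longrightarrow> l < d \<Longrightarrow> (\<Sum>i<d. r k i * r l i) = (if k = l then 1 else 0 :: real)" and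
    complete: "\<And>i j. i < d \<Longrightarrow> j < d \<Longrightarrow> (\<Sum>k<d. r k i * r k j) = (if i = j then 1 else 0)" and
    s: "\<And>k. k < d \<Longrightarrow> s k \<ge> (0::real)" and
    zz: "\<And>k l. k < d \<Longrightarrow> l < d \<Longrightarrow> (\<Sum>a<d. z k a * z l a) = (if k = l then of_bool (s k \<noteq> 0) else 0 :: real)" and
    g: "\<And>a b. a < d \<Longrightarrow> b < d \<Longrightarrow> g (a, b) = (\<Sum>k<d. s k * z k a * r k b)" and
    cp: "char_poly (Matrix.mat d d (\<lambda>(b, c). \<Sum>a<d. g (a, b) * g (a, c))) = (\<Prod>k<d. [:- (s k)\<^sup>2, 1:])"
    using singular_value_decomposition[where n = d and m = d and g = g] by blast
  define T where "T = (\<lambda>(a, b). \<Sum>k<d. z k a * r k b)"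
  show thesis
  proof (rule that[of T])
    show "op_bound d 1 T"
      unfolding op_bound_def
    proof
      fix x :: "nat \<Rightarrow> real"
      define w where "w k = (\<Sum>b<d. x b * r k b)" for k
      have Tx: "(\<Sum>b<d. T (a, b) * x b) = (\<Sum>k<d. w k * z k a)" for a
      proof -
        have "(\<Sum>b<d. T (a, b) * x b) = (\<Sum>b<d. \<Sum>k<d. z k a * (x b * r k b))"
          by (simp add: T_def sum_distrib_left sum_distrib_right mult_ac)
        also have "\<dots> = (\<Sum>k<d. w k * z k a)"
          by (subst sum.swap) (simp add: w_def sum_distrib_left sum_distrib_right mult_ac)
        finally show ?thesis .
      qed
      have "(\<Sum>a<d. (\<Sum>b<d. T (a, b) * x b)\<^sup>2) = (\<Sum>k<d. w k * w k * of_bool (s k \<noteq> 0))"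
        unfolding Tx power2_eq_square by (rule sum_square_orthogonal_combination) (simp add: zz)
      also have "\<dots> \<le> (\<Sum>k<d. w k * w k * 1)" by (intro sum_mono mult_left_mono) auto
      also have "\<dots> = (\<Sum>b<d. (\<Sum>k<d. w k * r k b) * (\<Sum>k<d. w k * r k b))"
        by (rule sum_square_orthogonal_combination[symmetric]) (simp add: orth)
      also have "\<dots> = (\<Sum>b<d. (x b)\<^sup>2)"
        unfolding w_def power2_eq_square
        by (rule sum.cong) (simp_all add: orthonormal_expansion[OF complete])
      finally show "(\<Sum>a<d. (\<Sum>b<d. T (a, b) * x b)\<^sup>2) \<le> 1\<^sup>2 * (\<Sum>b<d. (x b)\<^sup>2)" by simp
    qed
    have "(\<Sum>a<d. \<Sum>b<d. g (a, b) * T (a, b))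
        = (\<Sum>a<d. \<Sum>b<d. (\<Sum>k<d. (s k * z k a) * r k b) * (\<Sum>k<d. z k a * r k b))"
      by (intro sum.cong refl) (simp add: g T_def)
    also have "\<dots> = (\<Sum>a<d. \<Sum>k<d. (s k * z k a) * z k a * 1)"
      by (intro sum.cong refl sum_square_orthogonal_combination) (simp add: orth)
    also have "\<dots> = (\<Sum>k<d. s k * (\<Sum>a<d. z k a * z k a))"
      by (subst sum.swap) (simp add: sum_distrib_left mult_ac)
    also have "\<dots> = (\<Sum>k<d. s k)" by (rule sum.cong) (auto simp: zz)
    finally show "(\<Sum>a<d. \<Sum>b<d. g (a, b) * T (a, b)) = sv_sum d g"
      using sv_sum_svd[OF s cp] by simp
  qed
qed

lemma op_bound_entry:
  assumes T: "op_bound d c T" and c: "c \<ge> 0" and ab: "a < d" "b < d"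
  shows "\<bar>T (a, b)\<bar> \<le> c"
proof -
  define x where "x j = (if j = b then 1 else 0 :: real)" for j
  have Tx: "(\<Sum>j<d. T (i, j) * x j) = T (i, b)" for i
    using ab by (simp add: x_def if_distrib cong: if_cong)
  have xx: "(\<Sum>j<d. (x j)\<^sup>2) = 1"
    using ab by (simp add: x_def if_distrib[of "\<lambda>t. t\<^sup>2"] cong: if_cong)
  have "(T (a, b))\<^sup>2 \<le> (\<Sum>i<d. (T (i, b))\<^sup>2)"
    by (rule member_le_sum) (use ab in auto)
  also have "\<dots> \<le> c\<^sup>2" using T[unfolded op_bound_def, rule_format, of x] by (simp add: Tx xx)
  finally show ?thesis using c by (metis abs_le_square_iff abs_of_nonneg)
qed

lemma sv_sum_nonneg: "sv_sum d g \<ge> 0"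
proof -
  have "(\<Sum>a<d. \<Sum>b<d. g (a, b) * (\<lambda>_. 0) (a, b)) \<le> 1 * sv_sum d g"
    by (rule pairing_le_sv_sum) (simp_all add: op_bound_def sum_nonneg)
  then show ?thesis by simp
qed

text \<open>This is the majorant that makes nuclear norms integrable.\<close>

lemma sv_sum_le_entries: "sv_sum d g \<le> (\<Sum>a<d. \<Sum>b<d. \<bar>g (a, b)\<bar>)"
proof -
  obtain T where T: "op_bound d 1 T" "(\<Sum>a<d. \<Sum>b<d. g (a, b) * T (a, b)) = sv_sum d g"
    by (rule sv_sum_attained)
  have "g (a, b) * T (a, b) \<le> \<bar>g (a, b)\<bar>" if "a < d" "b < d" for a b
  proof -
    have "g (a, b) * T (a, b) \<le> \<bar>g (a, b)\<bar> * \<bar>T (a, b)\<bar>" by (metis abs_ge_self abs_mult)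
    also have "\<dots> \<le> \<bar>g (a, b)\<bar> * 1"
      using op_bound_entry[OF T(1)] that by (intro mult_left_mono) auto
    finally show ?thesis by simp
  qed
  then show ?thesis unfolding T(2)[symmetric] by (intro sum_mono) auto
qed

lemma orth_group_op_bound:
  assumes "Q \<in> orth_group d"
  shows "op_bound d 1 (\<lambda>(a, b). Q $$ (a, b))"
  unfolding op_bound_def
proof
  fix x :: "nat \<Rightarrow> real"
  have Q: "Q \<in> carrier_mat d d" and QQ: "Q * transpose_mat Q = 1\<^sub>m d"
    using assms by (auto simp: orth_group_def)
  have QQ': "transpose_mat Q * Q = 1\<^sub>m d"
    using mat_mult_left_right_inverse[OF Q _ QQ] Q by simp
  have orth: "(\<Sum>a<d. Q $$ (a, k) * Q $$ (a, l)) = (if k = l then 1 else 0)" if "k < d" "l < d" for k l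
  proof -
    have "(transpose_mat Q * Q) $$ (k, l) = (1\<^sub>m d :: real Matrix.mat) $$ (k, l)" using QQ' by simp
    then show ?thesis using that Q by (simp add: scalar_prod_def atLeast0LessThan)
  qed
  have "(\<Sum>a<d. (\<Sum>b<d. x b * Q $$ (a, b)) * (\<Sum>b<d. x b * Q $$ (a, b))) = (\<Sum>b<d. x b * x b * 1)"
    by (rule sum_square_orthogonal_combination) (simp add: orth)
  then show "(\<Sum>a<d. (\<Sum>b<d. (case (a, b) of (a, b) \<Rightarrow> Q $$ (a, b)) * x b)\<^sup>2) \<le> 1\<^sup>2 * (\<Sum>b<d. (x b)\<^sup>2)"
    by (simp add: power2_eq_square mult.commute)
qed

text \<open>The quartic lower bound is the tangent inequality \<open>2 x \<ge> 3 x^2 - x^4\<close>, applied to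
  \<open>x = s / t\<close> for every singular value \<open>s\<close> of \<open>v\<close>; it replaces the nuclear norm by polynomials in
  the entries. The \<open>d\<close> extra columns of \<open>X\<close> hold the projection to the kernel.\<close>

lemma polar_factor:
  fixes v :: "nat \<times> nat \<Rightarrow> real"
  assumes t: "t > 0"
  obtains X where
    "\<And>a b. a < d \<Longrightarrow> b < d \<Longrightarrow> (\<Sum>c<p + d. X (a, c) * X (b, c)) = (if a = b then 1 else 0 :: real)"
    "(\<Sum>a<d. \<Sum>l<p. v (a, l) * X (a, l)) \<ge> 3 / 2 * (\<Sum>a<d. \<Sum>l<p. (v (a, l))\<^sup>2) / t
        - 1 / 2 * (\<Sum>a<d. \<Sum>b<d. (\<Sum>l<p. v (a, l) * v (b, l))\<^sup>2) / t ^ 3"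
proof -
  obtain r s z where
    orth: "\<And>k l. k < d \<Longrightarrow> l < d \<Longrightarrow> (\<Sum>i<d. r k i * r l i) = (if k = l then 1 else 0 :: real)" and
    complete: "\<And>i j. i < d \<Longrightarrow> j < d \<Longrightarrow> (\<Sum>k<d. r k i * r k j) = (if i = j then 1 else 0)" and
    s: "\<And>k. k < d \<Longrightarrow> s k \<ge> (0::real)" and
    zz: "\<And>k l. k < d \<Longrightarrow> l < d \<Longrightarrow> (\<Sum>a<p. z k a * z l a) = (if k = l then of_bool (s k \<noteq> 0) else 0 :: real)" and
    g: "\<And>l a. l < p \<Longrightarrow> a < d \<Longrightarrow> (\<lambda>(l, a). v (a, l)) (l, a) = (\<Sum>k<d. s k * z k l * r k a)" and
    cp: "char_poly (Matrix.mat d d (\<lambda>(b, c). \<Sum>a<p. (\<lambda>(l, a). v (a, l)) (a, b) * (\<lambda>(l, a). v (a, l)) (a, c)))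
      = (\<Prod>k<d. [:- (s k)\<^sup>2, 1:])"
    using singular_value_decomposition[where n = d and m = p and g = "\<lambda>(l, a). v (a, l)"] by blast
  have v: "v (a, l) = (\<Sum>k<d. s k * z k l * r k a)" if "a < d" "l < p" for a l
    using g[OF that(2,1)] by simp
  define X where "X = (\<lambda>(a, c). if c < p then \<Sum>k<d. z k c * r k a
      else \<Sum>k<d. of_bool (s k = 0) * r k (c - p) * r k a)"
  have split: "(\<Sum>c<p + d. f c) = (\<Sum>c<p. f c) + (\<Sum>c<d. f (p + c))" for f :: "nat \<Rightarrow> real"
    by (induction d) simp_all
  have "(\<Sum>c<p + d. X (a, c) * X (b, c)) = (if a = b then 1 else 0)" if ab: "a < d" "b < d" for a b
  proof -
    have "(\<Sum>c<p. X (a, c) * X (b, c)) = (\<Sum>c<p. (\<Sum>k<d. r k a * z k c) * (\<Sum>k<d. r k b * z k c))"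
      by (simp add: X_def mult.commute)
    also have "\<dots> = (\<Sum>k<d. r k a * r k b * of_bool (s k \<noteq> 0))"
      by (rule sum_square_orthogonal_combination) (simp add: zz)
    finally have 1: "(\<Sum>c<p. X (a, c) * X (b, c)) = (\<Sum>k<d. r k a * r k b * of_bool (s k \<noteq> 0))" .
    have "(\<Sum>c<d. X (a, p + c) * X (b, p + c)) = (\<Sum>c<d. (\<Sum>k<d. (of_bool (s k = 0) * r k a) * r k c)
        * (\<Sum>k<d. (of_bool (s k = 0) * r k b) * r k c))"
      by (simp add: X_def mult_ac)
    also have "\<dots> = (\<Sum>k<d. (of_bool (s k = 0) * r k a) * (of_bool (s k = 0) * r k b) * 1)"
      by (rule sum_square_orthogonal_combination) (simp add: orth)
    also have "\<dots> = (\<Sum>k<d. r k a * r k b * of_bool (s k = 0))"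
      by (intro sum.cong) auto
    finally have "(\<Sum>c<p + d. X (a, c) * X (b, c))
        = (\<Sum>k<d. r k a * r k b * of_bool (s k \<noteq> 0) + r k a * r k b * of_bool (s k = 0))"
      unfolding split 1 by (simp add: sum.distrib)
    also have "\<dots> = (\<Sum>k<d. r k a * r k b)" by (intro sum.cong) auto
    finally show ?thesis by (simp add: complete ab)
  qed
  moreover have "(\<Sum>a<d. \<Sum>l<p. v (a, l) * X (a, l)) \<ge> 3 / 2 * (\<Sum>a<d. \<Sum>l<p. (v (a, l))\<^sup>2) / t
        - 1 / 2 * (\<Sum>a<d. \<Sum>b<d. (\<Sum>l<p. v (a, l) * v (b, l))\<^sup>2) / t ^ 3"
  proof -
    have "(\<Sum>a<d. \<Sum>l<p. v (a, l) * X (a, l))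
        = (\<Sum>a<d. \<Sum>l<p. (\<Sum>k<d. (s k * r k a) * z k l) * (\<Sum>k<d. r k a * z k l))"
      by (intro sum.cong refl) (simp add: v X_def mult_ac)
    also have "\<dots> = (\<Sum>a<d. \<Sum>k<d. (s k * r k a) * r k a * of_bool (s k \<noteq> 0))"
      by (intro sum.cong refl sum_square_orthogonal_combination) (simp add: zz)
    also have "\<dots> = (\<Sum>a<d. \<Sum>k<d. s k * (r k a * r k a))"
      by (intro sum.cong refl) auto
    also have "\<dots> = (\<Sum>k<d. s k * (\<Sum>a<d. r k a * r k a))"
      by (subst sum.swap) (simp add: sum_distrib_left)
    finally have vX: "(\<Sum>a<d. \<Sum>l<p. v (a, l) * X (a, l)) = (\<Sum>k<d. s k)"
      by (simp add: orth)
    have gram: "(\<Sum>l<p. v (a, l) * v (b, l)) = (\<Sum>k<d. (s k)\<^sup>2 * (r k a * r k b))" if "a < d" "b < d" for a b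
    proof -
      have "(\<Sum>l<p. v (a, l) * v (b, l)) = (\<Sum>l<p. (\<Sum>k<d. (s k * r k a) * z k l) * (\<Sum>k<d. (s k * r k b) * z k l))"
        using that by (intro sum.cong refl) (simp add: v mult_ac)
      also have "\<dots> = (\<Sum>k<d. (s k * r k a) * (s k * r k b) * of_bool (s k \<noteq> 0))"
        by (rule sum_square_orthogonal_combination) (simp add: zz)
      also have "\<dots> = (\<Sum>k<d. (s k)\<^sup>2 * (r k a * r k b))"
        by (intro sum.cong refl) (auto simp: power2_eq_square)
      finally show ?thesis .
    qed
    have "(\<Sum>a<d. \<Sum>l<p. (v (a, l))\<^sup>2) = (\<Sum>a<d. \<Sum>k<d. (s k)\<^sup>2 * (r k a * r k a))"
      unfolding power2_eq_square[of "v _"] by (rule sum.cong[OF refl], rule gram) auto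
    also have "\<dots> = (\<Sum>k<d. (s k)\<^sup>2 * (\<Sum>a<d. r k a * r k a))"
      by (subst sum.swap) (simp add: sum_distrib_left)
    finally have two: "(\<Sum>a<d. \<Sum>l<p. (v (a, l))\<^sup>2) = (\<Sum>k<d. (s k)\<^sup>2)" by (simp add: orth)
    have "(\<Sum>a<d. \<Sum>b<d. (\<Sum>l<p. v (a, l) * v (b, l))\<^sup>2)
        = (\<Sum>a<d. \<Sum>b<d. (\<Sum>k<d. ((s k)\<^sup>2 * r k a) * r k b) * (\<Sum>k<d. ((s k)\<^sup>2 * r k a) * r k b))"
      by (intro sum.cong refl) (simp add: gram power2_eq_square mult_ac)
    also have "\<dots> = (\<Sum>a<d. \<Sum>k<d. ((s k)\<^sup>2 * r k a) * ((s k)\<^sup>2 * r k a) * 1)"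
      by (intro sum.cong refl sum_square_orthogonal_combination) (simp add: orth)
    also have "\<dots> = (\<Sum>k<d. (s k) ^ 4 * (\<Sum>a<d. r k a * r k a))"
      by (subst sum.swap) (simp add: sum_distrib_left power2_eq_square power4_eq_xxxx mult_ac)
    finally have four: "(\<Sum>a<d. \<Sum>b<d. (\<Sum>l<p. v (a, l) * v (b, l))\<^sup>2) = (\<Sum>k<d. (s k) ^ 4)"
      by (simp add: orth)
    have tangent: "3 / 2 * x\<^sup>2 / t - 1 / 2 * x ^ 4 / t ^ 3 \<le> x" if "x \<ge> 0" for x
    proof -
      \<comment> \<open>The difference has a double root at \<open>t\<close>, which is what fixes
        the constants 3/2 and 1/2.\<close>
      have "x - (3 / 2 * x\<^sup>2 / t - 1 / 2 * x ^ 4 / t ^ 3) = x * (x - t)\<^sup>2 * (x + 2 * t) / (2 * t ^ 3)"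
        using t by (simp add: field_simps power2_eq_square power3_eq_cube power4_eq_xxxx)
      also have "\<dots> \<ge> 0" using t that by simp
      finally show ?thesis by simp
    qed
    have "3 / 2 * (\<Sum>k<d. (s k)\<^sup>2) / t - 1 / 2 * (\<Sum>k<d. (s k) ^ 4) / t ^ 3
        = (\<Sum>k<d. 3 / 2 * (s k)\<^sup>2 / t - 1 / 2 * (s k) ^ 4 / t ^ 3)"
      by (simp add: sum_subtractf sum_distrib_left sum_divide_distrib)
    also have "\<dots> \<le> (\<Sum>k<d. s k)" by (intro sum_mono tangent) (auto simp: s)
    finally show ?thesis unfolding vX two four .
  qed
  ultimately show thesis by (rule that)
qed


section \<open>Reflection invariance of Gaussian matrices\<close>

abbreviation gauss :: "real \<Rightarrow> real measure" where
  "gauss \<sigma> \<equiv> density lborel (normal_density 0 \<sigma>)"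

text \<open>Reflections are preferred to rotations because \<open>c = 0\<close>,
  \<open>s = 1\<close> is a coordinate swap and \<open>c = - 1\<close>, \<open>s = 0\<close> a
  single sign change; elimination, permutations and signs then all follow from this one
  invariance.\<close>

lemma nn_integral_gauss_reflection:
  fixes f :: "real \<times> real \<Rightarrow> ennreal"
  assumes f[measurable]: "f \<in> borel_measurable (borel \<Otimes>\<^sub>M borel)" and cs: "c\<^sup>2 + s\<^sup>2 = (1::real)"
  shows "(\<integral>\<^sup>+y. \<integral>\<^sup>+x. f (c * x + s * y, s * x - c * y) \<partial>gauss \<sigma> \<partial>gauss \<sigma>)
    = (\<integral>\<^sup>+y. \<integral>\<^sup>+x. f (x, y) \<partial>gauss \<sigma> \<partial>gauss \<sigma>)"
proof -
  define w where "w x y = ennreal (normal_density 0 \<sigma> x * normal_density 0 \<sigma> y)" for x y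
  have w[measurable]: "(\<lambda>z. w (g z) (h z)) \<in> borel_measurable M"
    if [measurable]: "g \<in> borel_measurable M" "h \<in> borel_measurable M" for g h and M :: "'z measure"
    unfolding w_def by measurable
  have w_eq: "w x y = w x' y'" if "x\<^sup>2 + y\<^sup>2 = x'\<^sup>2 + y'\<^sup>2" for x y x' y'
  proof -
    have "normal_density 0 \<sigma> x * normal_density 0 \<sigma> y
        = (1 / sqrt (2 * pi * \<sigma>\<^sup>2))\<^sup>2 * exp (- (x\<^sup>2 + y\<^sup>2) / (2 * \<sigma>\<^sup>2))" for x y
      by (simp add: normal_density_def power2_eq_square exp_add[symmetric] diff_divide_distrib mult_ac)
    then show ?thesis using that by (simp add: w_def)
  qed
  have expand: "(\<integral>\<^sup>+y. \<integral>\<^sup>+x. g x y \<partial>gauss \<sigma> \<partial>gauss \<sigma>) = (\<integral>\<^sup>+y. \<integral>\<^sup>+x. w x y * g x y \<partial>lborel \<partial>lborel)"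
    if [measurable]: "(\<lambda>(x, y). g x y) \<in> borel_measurable (borel \<Otimes>\<^sub>M borel)" for g :: "real \<Rightarrow> real \<Rightarrow> ennreal"
    by (simp add: nn_integral_density w_def nn_integral_cmult[symmetric] ennreal_mult mult_ac cong: nn_integral_cong)
  have swap: "(\<integral>\<^sup>+y. \<integral>\<^sup>+x. g x y \<partial>lborel \<partial>lborel) = (\<integral>\<^sup>+x. \<integral>\<^sup>+y. g x y \<partial>lborel \<partial>lborel)"
    if [measurable]: "(\<lambda>(x, y). g x y) \<in> borel_measurable (borel \<Otimes>\<^sub>M borel)" for g :: "real \<Rightarrow> real \<Rightarrow> ennreal"
    by (rule lborel_pair.Fubini') (use that in simp)
  have cs': "s * s = 1 - c * c" using cs by (simp add: power2_eq_square algebra_simps)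
  show ?thesis
  proof (cases "c = 0")
    \<comment> \<open>Two one-dimensional substitutions: \<open>x\<close> is replaced at fixed
      \<open>y\<close>, then \<open>y\<close> at fixed \<open>u\<close>. Their factors
      \<open>1 / \<bar>c\<bar>\<close> and \<open>\<bar>c\<bar>\<close> cancel, and the weight
      depends on the sum of squares alone.\<close>
    case False
    have "(\<integral>\<^sup>+y. \<integral>\<^sup>+x. f (c * x + s * y, s * x - c * y) \<partial>gauss \<sigma> \<partial>gauss \<sigma>)
        = (\<integral>\<^sup>+y. \<integral>\<^sup>+x. w x y * f (c * x + s * y, s * x - c * y) \<partial>lborel \<partial>lborel)"
      by (rule expand) measurable
    also have "\<dots> = (\<integral>\<^sup>+y. \<bar>1 / c\<bar> * (\<integral>\<^sup>+u. w ((u - s * y) / c) y * f (u, (s * u - y) / c) \<partial>lborel) \<partial>lborel)"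
    proof (intro nn_integral_cong)
      fix y :: real
      have "(\<integral>\<^sup>+x. w x y * f (c * x + s * y, s * x - c * y) \<partial>lborel)
        = \<bar>1 / c\<bar> * (\<integral>\<^sup>+u. w (- (s * y) / c + 1 / c * u) y
            * f (c * (- (s * y) / c + 1 / c * u) + s * y, s * (- (s * y) / c + 1 / c * u) - c * y) \<partial>lborel)"
        by (rule nn_integral_real_affine) (measurable, use False in simp)
      moreover have "c * (- (s * y) / c + 1 / c * u) + s * y = u" for u
        using False by (simp add: field_simps)
      moreover have "- (s * y) / c + 1 / c * u = (u - s * y) / c" for u
        using False by (simp add: field_simps)
      moreover have "s * ((u - s * y) / c) - c * y = (s * u - y) / c" for u
      proof -
        have "s * ((u - s * y) / c) - c * y = (s * u - (s * s + c * c) * y) / c"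
          using False by (simp add: field_simps)
        then show ?thesis by (simp add: cs')
      qed
      ultimately show "(\<integral>\<^sup>+x. w x y * f (c * x + s * y, s * x - c * y) \<partial>lborel)
        = \<bar>1 / c\<bar> * (\<integral>\<^sup>+u. w ((u - s * y) / c) y * f (u, (s * u - y) / c) \<partial>lborel)" by simp
    qed
    also have "\<dots> = \<bar>1 / c\<bar> * (\<integral>\<^sup>+y. \<integral>\<^sup>+u. w ((u - s * y) / c) y * f (u, (s * u - y) / c) \<partial>lborel \<partial>lborel)"
      by (rule nn_integral_cmult) measurable
    also have "\<dots> = \<bar>1 / c\<bar> * (\<integral>\<^sup>+u. \<integral>\<^sup>+y. w ((u - s * y) / c) y * f (u, (s * u - y) / c) \<partial>lborel \<partial>lborel)"
      by (rule arg_cong[where f = "\<lambda>x. ennreal \<bar>1 / c\<bar> * x"], rule swap) measurable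
    also have "\<dots> = \<bar>1 / c\<bar> * (\<integral>\<^sup>+u. \<bar>- c\<bar> * (\<integral>\<^sup>+v. w u v * f (u, v) \<partial>lborel) \<partial>lborel)"
    proof (intro arg_cong[where f = "\<lambda>x. ennreal \<bar>1 / c\<bar> * x"] nn_integral_cong)
      fix u :: real
      have "(\<integral>\<^sup>+y. w ((u - s * y) / c) y * f (u, (s * u - y) / c) \<partial>lborel)
          = \<bar>- c\<bar> * (\<integral>\<^sup>+v. w ((u - s * (s * u + - c * v)) / c) (s * u + - c * v)
              * f (u, (s * u - (s * u + - c * v)) / c) \<partial>lborel)"
        by (rule nn_integral_real_affine) (measurable, use False in simp)
      moreover have "(s * u - (s * u + - c * v)) / c = v" for v using False by simp
      moreover have "w ((u - s * (s * u + - c * v)) / c) (s * u + - c * v) = w u v" for v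
      proof (rule w_eq)
        have "(u - s * (s * u + - c * v)) / c = (u * (1 - s * s) + s * c * v) / c"
          by (simp add: algebra_simps)
        also have "\<dots> = c * u + s * v" using False by (simp add: cs' field_simps)
        finally have eq: "(u - s * (s * u + - c * v)) / c = c * u + s * v" .
        have "(c * u + s * v)\<^sup>2 + (s * u + - c * v)\<^sup>2 = (c\<^sup>2 + s\<^sup>2) * (u\<^sup>2 + v\<^sup>2)"
          by (simp add: power2_eq_square algebra_simps)
        then show "((u - s * (s * u + - c * v)) / c)\<^sup>2 + (s * u + - c * v)\<^sup>2 = u\<^sup>2 + v\<^sup>2"
          unfolding eq cs by simp
      qed
      ultimately show "(\<integral>\<^sup>+y. w ((u - s * y) / c) y * f (u, (s * u - y) / c) \<partial>lborel)
          = \<bar>- c\<bar> * (\<integral>\<^sup>+v. w u v * f (u, v) \<partial>lborel)" by simp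
    qed
    also have "\<dots> = (ennreal \<bar>1 / c\<bar> * ennreal \<bar>- c\<bar>) * (\<integral>\<^sup>+u. \<integral>\<^sup>+v. w u v * f (u, v) \<partial>lborel \<partial>lborel)"
      by (subst nn_integral_cmult) (measurable, simp add: mult.assoc)
    also have "ennreal \<bar>1 / c\<bar> * ennreal \<bar>- c\<bar> = 1"
      using False by (simp add: ennreal_mult[symmetric])
    also have "1 * (\<integral>\<^sup>+u. \<integral>\<^sup>+v. w u v * f (u, v) \<partial>lborel \<partial>lborel)
        = (\<integral>\<^sup>+v. \<integral>\<^sup>+u. w u v * f (u, v) \<partial>lborel \<partial>lborel)"
      unfolding mult_1 by (rule swap[symmetric]) measurable
    also have "\<dots> = (\<integral>\<^sup>+y. \<integral>\<^sup>+x. f (x, y) \<partial>gauss \<sigma> \<partial>gauss \<sigma>)"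
      by (rule expand[symmetric]) measurable
    finally show ?thesis .
  next
    \<comment> \<open>The map now swaps the coordinates and multiplies both by the sign
      \<open>s\<close>; Fubini and two sign changes suffice.\<close>
    case True
    then have s2: "s * s = 1" using cs' by simp
    then have abs_s: "\<bar>s\<bar> = 1" by (metis abs_mult_self_eq abs_one abs_square_eq_1 power2_eq_square)
    have flip: "(\<integral>\<^sup>+x. g x \<partial>lborel) = (\<integral>\<^sup>+x. g (s * x) \<partial>lborel)"
      if [measurable]: "g \<in> borel_measurable borel" for g :: "real \<Rightarrow> ennreal"
      using nn_integral_real_affine[OF that, of s 0] abs_s by auto
    have "(\<integral>\<^sup>+y. \<integral>\<^sup>+x. f (c * x + s * y, s * x - c * y) \<partial>gauss \<sigma> \<partial>gauss \<sigma>)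
        = (\<integral>\<^sup>+y. \<integral>\<^sup>+x. f (s * y, s * x) \<partial>gauss \<sigma> \<partial>gauss \<sigma>)"
      by (simp add: True)
    also have "\<dots> = (\<integral>\<^sup>+y. \<integral>\<^sup>+x. w x y * f (s * y, s * x) \<partial>lborel \<partial>lborel)"
      by (rule expand) measurable
    also have "\<dots> = (\<integral>\<^sup>+y. \<integral>\<^sup>+x. w (s * x) y * f (s * y, s * (s * x)) \<partial>lborel \<partial>lborel)"
      by (intro nn_integral_cong flip) measurable
    also have "\<dots> = (\<integral>\<^sup>+y. \<integral>\<^sup>+x. w (s * x) (s * y) * f (s * (s * y), s * (s * x)) \<partial>lborel \<partial>lborel)"
      by (rule flip) measurable
    also have "\<dots> = (\<integral>\<^sup>+y. \<integral>\<^sup>+x. w y x * f (y, x) \<partial>lborel \<partial>lborel)"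
    proof (intro nn_integral_cong)
      fix x y
      have "w (s * x) (s * y) = w y x" by (rule w_eq) (simp add: power_mult_distrib power2_eq_square[of s] s2)
      then show "w (s * x) (s * y) * f (s * (s * y), s * (s * x)) = w y x * f (y, x)"
        by (simp add: mult.assoc[symmetric] s2)
    qed
    also have "\<dots> = (\<integral>\<^sup>+y. \<integral>\<^sup>+x. w x y * f (x, y) \<partial>lborel \<partial>lborel)"
      by (rule swap[symmetric]) measurable
    also have "\<dots> = (\<integral>\<^sup>+y. \<integral>\<^sup>+x. f (x, y) \<partial>gauss \<sigma> \<partial>gauss \<sigma>)"
      by (rule expand[symmetric]) measurable
    finally show ?thesis .
  qed
qed

abbreviation gaussPi :: "real \<Rightarrow> 'i set \<Rightarrow> ('i \<Rightarrow> real) measure" where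
  "gaussPi \<sigma> I \<equiv> PiM I (\<lambda>_. gauss \<sigma>)"

lemma product_prob_space_gauss: "\<sigma> > 0 \<Longrightarrow> product_prob_space (\<lambda>_. gauss \<sigma>)"
  by (intro product_prob_spaceI prob_space_normal_density)

definition plane_reflection :: "'i set \<Rightarrow> 'i \<Rightarrow> 'i \<Rightarrow> real \<Rightarrow> real \<Rightarrow> ('i \<Rightarrow> real) \<Rightarrow> 'i \<Rightarrow> real" where
  "plane_reflection I i j c s x = (\<lambda>k\<in>I. if k = i then c * x i + s * x j
     else if k = j then s * x i - c * x j else x k)"

lemma measurable_plane_reflection:
  assumes "i \<in> I" "j \<in> I"
  shows "plane_reflection I i j c s \<in> gaussPi \<sigma> I \<rightarrow>\<^sub>M gaussPi \<sigma> I"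
  unfolding plane_reflection_def
proof (rule measurable_restrict)
  fix k assume "k \<in> I"
  have [measurable]: "(\<lambda>x. x l) \<in> borel_measurable (gaussPi \<sigma> I)" if "l \<in> I" for l
    using measurable_component_singleton[OF that, of "\<lambda>_. gauss \<sigma>"] by simp
  show "(\<lambda>x. if k = i then c * x i + s * x j else if k = j then s * x i - c * x j else x k)
      \<in> gaussPi \<sigma> I \<rightarrow>\<^sub>M gauss \<sigma>"
    using assms \<open>k \<in> I\<close> by simp
qed

text \<open>Fubini places the coordinates \<open>i\<close> and \<open>j\<close> innermost, so that
  the planar invariance applies with all other coordinates frozen.\<close>

lemma distr_plane_reflection:
  assumes fin: "finite I" and ij: "i \<in> I" "j \<in> I" "i \<noteq> j" and cs: "c\<^sup>2 + s\<^sup>2 = 1" and \<sigma>: "\<sigma> > 0"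
  shows "distr (gaussPi \<sigma> I) (gaussPi \<sigma> I) (plane_reflection I i j c s) = gaussPi \<sigma> I"
proof -
  interpret product_prob_space "\<lambda>_. gauss \<sigma>" by (rule product_prob_space_gauss[OF \<sigma>])
  define K where "K = I - {i, j}"
  have I: "I = insert i (insert j K)" and K: "finite K" "j \<notin> K" "i \<notin> insert j K"
    using fin ij by (auto simp: K_def)
  note R[measurable] = measurable_plane_reflection[OF ij(1,2), of c s \<sigma>]
  have split: "(\<integral>\<^sup>+x. g x \<partial>gaussPi \<sigma> I)
      = (\<integral>\<^sup>+x. \<integral>\<^sup>+y. \<integral>\<^sup>+z. g (x(j := y, i := z)) \<partial>gauss \<sigma> \<partial>gauss \<sigma> \<partial>gaussPi \<sigma> K)"
    if [measurable]: "g \<in> borel_measurable (gaussPi \<sigma> I)" for g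
  proof -
    have "(\<integral>\<^sup>+x. g x \<partial>gaussPi \<sigma> I) = (\<integral>\<^sup>+x. \<integral>\<^sup>+z. g (x(i := z)) \<partial>gauss \<sigma> \<partial>gaussPi \<sigma> (insert j K))"
      unfolding I by (rule product_nn_integral_insert) (use K that I in auto)
    also have "\<dots> = (\<integral>\<^sup>+x. \<integral>\<^sup>+y. \<integral>\<^sup>+z. g (x(j := y, i := z)) \<partial>gauss \<sigma> \<partial>gauss \<sigma> \<partial>gaussPi \<sigma> K)"
    proof (rule product_nn_integral_insert)
      have "(\<lambda>(x, z). g (x(i := z))) \<in> borel_measurable (gaussPi \<sigma> (insert j K) \<Otimes>\<^sub>M gauss \<sigma>)"
        using measurable_compose[OF measurable_add_dim that[unfolded I]] by (simp add: case_prod_beta')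
      then show "(\<lambda>x. \<integral>\<^sup>+z. g (x(i := z)) \<partial>gauss \<sigma>) \<in> borel_measurable (gaussPi \<sigma> (insert j K))"
        by (rule M.borel_measurable_nn_integral)
    qed (use K in auto)
    finally show ?thesis .
  qed
  show ?thesis
  proof (rule measure_eqI)
    fix A assume "A \<in> sets (distr (gaussPi \<sigma> I) (gaussPi \<sigma> I) (plane_reflection I i j c s))"
    then have A[measurable]: "A \<in> sets (gaussPi \<sigma> I)" by simp
    define g :: "('a \<Rightarrow> real) \<Rightarrow> ennreal" where "g = indicator A"
    have g[measurable]: "g \<in> borel_measurable (gaussPi \<sigma> I)" unfolding g_def by measurable
    have "emeasure (distr (gaussPi \<sigma> I) (gaussPi \<sigma> I) (plane_reflection I i j c s)) A
        = (\<integral>\<^sup>+x. g x \<partial>distr (gaussPi \<sigma> I) (gaussPi \<sigma> I) (plane_reflection I i j c s))"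
      by (simp add: g_def nn_integral_indicator)
    also have "\<dots> = (\<integral>\<^sup>+x. g (plane_reflection I i j c s x) \<partial>gaussPi \<sigma> I)"
      by (rule nn_integral_distr) measurable
    also have "\<dots> = (\<integral>\<^sup>+x. \<integral>\<^sup>+y. \<integral>\<^sup>+z. g (plane_reflection I i j c s (x(j := y, i := z))) \<partial>gauss \<sigma> \<partial>gauss \<sigma> \<partial>gaussPi \<sigma> K)"
      by (rule split) measurable
    also have "\<dots> = (\<integral>\<^sup>+x. \<integral>\<^sup>+y. \<integral>\<^sup>+z. g (x(j := y, i := z)) \<partial>gauss \<sigma> \<partial>gauss \<sigma> \<partial>gaussPi \<sigma> K)"
    proof (rule nn_integral_cong)
      fix x assume x: "x \<in> space (gaussPi \<sigma> K)"
      define h where "h = (\<lambda>(z, y). g (x(j := y, i := z)))"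
      have "(\<lambda>(z, y). x(j := y, i := z)) \<in> borel \<Otimes>\<^sub>M borel \<rightarrow>\<^sub>M gaussPi \<sigma> I"
      proof (rule measurable_PiM_single')
        show "(\<lambda>w. (case w of (z, y) \<Rightarrow> x(j := y, i := z)) k) \<in> borel \<Otimes>\<^sub>M borel \<rightarrow>\<^sub>M gauss \<sigma>" if "k \<in> I" for k
          by (simp add: case_prod_beta' fun_upd_def)
        show "(\<lambda>(z, y). x(j := y, i := z)) \<in> space (borel \<Otimes>\<^sub>M borel) \<rightarrow> I \<rightarrow>\<^sub>E space (gauss \<sigma>)"
          using x I by (auto simp: space_PiM PiE_def extensional_def)
      qed
      then have h[measurable]: "h \<in> borel_measurable (borel \<Otimes>\<^sub>M borel)"
        unfolding h_def using measurable_compose[OF _ g] by (simp add: case_prod_beta')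
      have "plane_reflection I i j c s (x(j := y, i := z)) = x(j := s * z - c * y, i := c * z + s * y)" for y z
        using x I ij by (auto simp: plane_reflection_def space_PiM PiE_def extensional_def fun_eq_iff)
      then have "(\<integral>\<^sup>+y. \<integral>\<^sup>+z. g (plane_reflection I i j c s (x(j := y, i := z))) \<partial>gauss \<sigma> \<partial>gauss \<sigma>)
          = (\<integral>\<^sup>+y. \<integral>\<^sup>+z. h (c * z + s * y, s * z - c * y) \<partial>gauss \<sigma> \<partial>gauss \<sigma>)"
        by (simp add: h_def)
      also have "\<dots> = (\<integral>\<^sup>+y. \<integral>\<^sup>+z. h (z, y) \<partial>gauss \<sigma> \<partial>gauss \<sigma>)"
        by (rule nn_integral_gauss_reflection[OF h cs])
      finally show "(\<integral>\<^sup>+y. \<integral>\<^sup>+z. g (plane_reflection I i j c s (x(j := y, i := z))) \<partial>gauss \<sigma> \<partial>gauss \<sigma>)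
          = (\<integral>\<^sup>+y. \<integral>\<^sup>+z. g (x(j := y, i := z)) \<partial>gauss \<sigma> \<partial>gauss \<sigma>)"
        by (simp add: h_def)
    qed
    also have "\<dots> = (\<integral>\<^sup>+x. g x \<partial>gaussPi \<sigma> I)" by (rule split[symmetric]) measurable
    also have "\<dots> = emeasure (gaussPi \<sigma> I) A" by (simp add: g_def nn_integral_indicator)
    finally show "emeasure (distr (gaussPi \<sigma> I) (gaussPi \<sigma> I) (plane_reflection I i j c s)) A
        = emeasure (gaussPi \<sigma> I) A" .
  qed simp
qed

text \<open>The set \<open>S\<close> records which rows of the matrix have been treated, so that
  induction can add one row at a time. For \<open>S = {..<d}\<close> this is multiplication from the
  right by a reflection matrix.\<close>

definition column_reflection ::
    "nat \<Rightarrow> nat \<Rightarrow> nat \<Rightarrow> nat \<Rightarrow> real \<Rightarrow> real \<Rightarrow> nat set \<Rightarrow> (nat \<times> nat \<Rightarrow> real) \<Rightarrow> nat \<times> nat \<Rightarrow> real" where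
  "column_reflection d p i j c s S x = (\<lambda>(a, l)\<in>{..<d} \<times> {..<p}. if a \<in> S then
     (if l = i then c * x (a, i) + s * x (a, j) else if l = j then s * x (a, i) - c * x (a, j) else x (a, l))
     else x (a, l))"

text \<open>Different rows involve disjoint pairs of coordinates, so the map is a composition of
  plane reflections, one for each row in \<open>S\<close>.\<close>

lemma distr_column_reflection:
  fixes d p i j :: nat
  assumes ij: "i < p" "j < p" "i \<noteq> j" and cs: "c\<^sup>2 + s\<^sup>2 = 1" and \<sigma>: "\<sigma> > 0"
  defines "I \<equiv> {..<d} \<times> {..<p}"
  assumes S: "S \<subseteq> {..<d}"
  shows "column_reflection d p i j c s S \<in> gaussPi \<sigma> I \<rightarrow>\<^sub>M gaussPi \<sigma> I \<and>
    distr (gaussPi \<sigma> I) (gaussPi \<sigma> I) (column_reflection d p i j c s S) = gaussPi \<sigma> I"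
proof -
  have "finite S" using S finite_subset by blast
  then show ?thesis using S
  proof (induction S rule: finite_induct)
    case empty
    have eq: "column_reflection d p i j c s {} x = x" if "x \<in> space (gaussPi \<sigma> I)" for x
      using that by (auto simp: column_reflection_def I_def space_PiM PiE_def extensional_def fun_eq_iff)
    have m: "column_reflection d p i j c s {} \<in> gaussPi \<sigma> I \<rightarrow>\<^sub>M gaussPi \<sigma> I"
      by (subst measurable_cong[OF eq]) simp_all
    have "distr (gaussPi \<sigma> I) (gaussPi \<sigma> I) (column_reflection d p i j c s {})
        = distr (gaussPi \<sigma> I) (gaussPi \<sigma> I) (\<lambda>x. x)"
      by (rule distr_cong) (simp_all add: eq)
    then show ?case using m by (simp add: distr_id)
  next
    case (insert a S)
    then have a: "a < d" and IH: "column_reflection d p i j c s S \<in> gaussPi \<sigma> I \<rightarrow>\<^sub>M gaussPi \<sigma> I"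
      "distr (gaussPi \<sigma> I) (gaussPi \<sigma> I) (column_reflection d p i j c s S) = gaussPi \<sigma> I" by auto
    have mem: "(a, i) \<in> I" "(a, j) \<in> I" using a ij by (auto simp: I_def)
    have R: "plane_reflection I (a, i) (a, j) c s \<in> gaussPi \<sigma> I \<rightarrow>\<^sub>M gaussPi \<sigma> I"
      by (rule measurable_plane_reflection) (use mem in auto)
    have eq: "column_reflection d p i j c s (insert a S)
        = plane_reflection I (a, i) (a, j) c s \<circ> column_reflection d p i j c s S"
      using insert.hyps mem by (auto simp: column_reflection_def plane_reflection_def I_def fun_eq_iff)
    have "distr (gaussPi \<sigma> I) (gaussPi \<sigma> I) (column_reflection d p i j c s (insert a S))
        = distr (distr (gaussPi \<sigma> I) (gaussPi \<sigma> I) (column_reflection d p i j c s S)) (gaussPi \<sigma> I)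
            (plane_reflection I (a, i) (a, j) c s)"
      unfolding eq by (rule distr_distr[symmetric]) (use R IH in auto)
    also have "\<dots> = gaussPi \<sigma> I"
      unfolding IH(2) by (rule distr_plane_reflection) (use mem ij cs \<sigma> in \<open>auto simp: I_def\<close>)
    finally show ?case using measurable_comp[OF IH(1) R] unfolding eq by blast
  qed
qed


section \<open>Finite nets, measurability and Gaussian moments\<close>

text \<open>Rounding to multiples of \<open>1 / m\<close> leaves finitely many classes. The
  representative of each class is taken from \<open>P\<close> itself, so the net inherits the
  constraints that define \<open>P\<close>.\<close>

lemma finite_net:
  fixes P :: "('i \<Rightarrow> real) set"
  assumes I: "finite I" and bnd: "\<And>X k. X \<in> P \<Longrightarrow> k \<in> I \<Longrightarrow> \<bar>X k\<bar> \<le> 1" and m: "m > (0::nat)"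
  shows "\<exists>F. finite F \<and> F \<subseteq> P \<and> (\<forall>X\<in>P. \<exists>Y\<in>F. \<forall>k\<in>I. \<bar>X k - Y k\<bar> \<le> 1 / real m)"
proof -
  define \<phi> where "\<phi> X = (\<lambda>k\<in>I. \<lfloor>real m * X k\<rfloor>)" for X :: "'i \<Rightarrow> real"
  have "\<phi> ` P \<subseteq> I \<rightarrow>\<^sub>E {- int m..int m}"
  proof
    fix y assume "y \<in> \<phi> ` P"
    then obtain X where X: "X \<in> P" "y = \<phi> X" by auto
    have "\<lfloor>real m * X k\<rfloor> \<in> {- int m..int m}" if "k \<in> I" for k
    proof -
      have "\<bar>real m * X k\<bar> \<le> real m * 1"
        unfolding abs_mult using bnd[OF X(1) that] by (intro mult_mono) auto
      then have "- real m \<le> real m * X k" "real m * X k \<le> real m" by auto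
      then show ?thesis by (auto simp: le_floor_iff floor_le_iff)
    qed
    then show "y \<in> I \<rightarrow>\<^sub>E {- int m..int m}" using X by (auto simp: \<phi>_def)
  qed
  then have fin: "finite (\<phi> ` P)" by (rule finite_subset) (simp add: finite_PiE I)
  define F where "F = inv_into P \<phi> ` \<phi> ` P"
  show ?thesis
  proof (intro exI[of _ F] conjI ballI)
    show "finite F" using fin by (simp add: F_def)
    show "F \<subseteq> P" by (auto simp: F_def intro: inv_into_into)
    fix X assume X: "X \<in> P"
    define Y where "Y = inv_into P \<phi> (\<phi> X)"
    have Y: "Y \<in> F" "\<phi> Y = \<phi> X" using X by (auto simp: F_def Y_def f_inv_into_f)
    have "\<bar>X k - Y k\<bar> \<le> 1 / real m" if "k \<in> I" for k
    proof -
      have "\<lfloor>real m * Y k\<rfloor> = \<lfloor>real m * X k\<rfloor>"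
        using fun_cong[OF Y(2), of k] that by (simp add: \<phi>_def)
      then have "\<bar>real m * X k - real m * Y k\<bar> \<le> 1" by linarith
      then have "real m * \<bar>X k - Y k\<bar> \<le> 1"
        by (simp add: right_diff_distrib[symmetric] abs_mult)
      then show ?thesis using m by (simp add: field_simps)
    qed
    then show "\<exists>Y\<in>F. \<forall>k\<in>I. \<bar>X k - Y k\<bar> \<le> 1 / real m" using Y by blast
  qed
qed

lemma pairing_net_error:
  fixes v X Y :: "nat \<times> nat \<Rightarrow> real"
  assumes "\<And>a b. a < d \<Longrightarrow> b < p \<Longrightarrow> \<bar>X (a, b) - Y (a, b)\<bar> \<le> e"
  shows "(\<Sum>a<d. \<Sum>b<p. v (a, b) * X (a, b))
    \<le> (\<Sum>a<d. \<Sum>b<p. v (a, b) * Y (a, b)) + e * (\<Sum>a<d. \<Sum>b<p. \<bar>v (a, b)\<bar>)"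
proof -
  have "v (a, b) * X (a, b) \<le> v (a, b) * Y (a, b) + e * \<bar>v (a, b)\<bar>" if "a < d" "b < p" for a b
  proof -
    have "v (a, b) * (X (a, b) - Y (a, b)) \<le> \<bar>v (a, b)\<bar> * \<bar>X (a, b) - Y (a, b)\<bar>"
      by (metis abs_ge_self abs_mult)
    also have "\<dots> \<le> \<bar>v (a, b)\<bar> * e" by (intro mult_left_mono assms that) auto
    finally show ?thesis by (simp add: algebra_simps)
  qed
  then have "(\<Sum>a<d. \<Sum>b<p. v (a, b) * X (a, b)) \<le> (\<Sum>a<d. \<Sum>b<p. v (a, b) * Y (a, b) + e * \<bar>v (a, b)\<bar>)"
    by (intro sum_mono) auto
  then show ?thesis by (simp add: sum.distrib sum_distrib_left)
qed

text \<open>By duality the nuclear norm is a supremum of linear functionals over contractions; over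
  finite nets it is a measurable maximum, and refining the nets gives pointwise convergence.\<close>

lemma borel_measurable_sv_sum:
  assumes f: "\<And>a b. a < d \<Longrightarrow> b < d \<Longrightarrow> (\<lambda>\<omega>. f \<omega> (a, b)) \<in> borel_measurable N"
  shows "(\<lambda>\<omega>. sv_sum d (f \<omega>)) \<in> borel_measurable N"
proof -
  define P where "P = {T. op_bound d 1 T}"
  have bnd: "\<bar>X k\<bar> \<le> 1" if "X \<in> P" "k \<in> {..<d} \<times> {..<d}" for X k
    using that op_bound_entry[of d 1 X "fst k" "snd k"] by (auto simp: P_def)
  have "\<exists>F. finite F \<and> F \<subseteq> P \<and> (\<forall>X\<in>P. \<exists>Y\<in>F. \<forall>k\<in>{..<d} \<times> {..<d}. \<bar>X k - Y k\<bar> \<le> 1 / real (Suc m))" for m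
    by (rule finite_net) (use bnd in auto)
  then obtain F where F: "\<And>m. finite (F m)" "\<And>m. F m \<subseteq> P"
    "\<And>m X. X \<in> P \<Longrightarrow> \<exists>Y\<in>F m. \<forall>k\<in>{..<d} \<times> {..<d}. \<bar>X k - Y k\<bar> \<le> 1 / real (Suc m)"
    by metis
  define h where "h T \<omega> = (\<Sum>a<d. \<Sum>b<d. f \<omega> (a, b) * T (a, b))" for T \<omega>
  define g where "g m \<omega> = Max ((\<lambda>T. h T \<omega>) ` F m)" for m \<omega>
  have "(\<lambda>_. 0) \<in> P" by (simp add: P_def op_bound_def sum_nonneg)
  then have ne: "F m \<noteq> {}" for m using F(3)[of "\<lambda>_. 0" m] by auto
  have h: "h T \<in> borel_measurable N" for T
    unfolding h_def by (intro borel_measurable_sum borel_measurable_times f) auto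
  have g: "g m \<in> borel_measurable N" for m
    unfolding g_def by (intro borel_measurable_Max F h)
  have upper: "g m \<omega> \<le> sv_sum d (f \<omega>)" for m \<omega>
    unfolding g_def
  proof (rule Max.boundedI)
    fix y assume "y \<in> (\<lambda>T. h T \<omega>) ` F m"
    then obtain T where "T \<in> P" "y = h T \<omega>" using F(2) by auto
    then show "y \<le> sv_sum d (f \<omega>)"
      using pairing_le_sv_sum[of d 1 T "f \<omega>"] by (simp add: P_def h_def)
  qed (use F ne in auto)
  have lower: "sv_sum d (f \<omega>) - 1 / real (Suc m) * (\<Sum>a<d. \<Sum>b<d. \<bar>f \<omega> (a, b)\<bar>) \<le> g m \<omega>" for m \<omega>
  proof -
    obtain T where T: "op_bound d 1 T" "(\<Sum>a<d. \<Sum>b<d. f \<omega> (a, b) * T (a, b)) = sv_sum d (f \<omega>)"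
      by (rule sv_sum_attained)
    then obtain Y where Y: "Y \<in> F m" "\<forall>k\<in>{..<d} \<times> {..<d}. \<bar>T k - Y k\<bar> \<le> 1 / real (Suc m)"
      using F(3)[of T m] by (auto simp: P_def)
    have "sv_sum d (f \<omega>) \<le> h Y \<omega> + 1 / real (Suc m) * (\<Sum>a<d. \<Sum>b<d. \<bar>f \<omega> (a, b)\<bar>)"
      unfolding T(2)[symmetric] h_def by (rule pairing_net_error) (use Y in auto)
    moreover have "h Y \<omega> \<le> g m \<omega>" unfolding g_def by (intro Max_ge) (use Y F in auto)
    ultimately show ?thesis by simp
  qed
  show ?thesis
  proof (rule borel_measurable_LIMSEQ_real[OF _ g])
    fix \<omega>
    show "(\<lambda>m. g m \<omega>) \<longlonglongrightarrow> sv_sum d (f \<omega>)"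
    proof (rule tendsto_sandwich[where h = "\<lambda>_. sv_sum d (f \<omega>)"])
      show "\<forall>\<^sub>F m in sequentially. sv_sum d (f \<omega>) - 1 / real (Suc m) * (\<Sum>a<d. \<Sum>b<d. \<bar>f \<omega> (a, b)\<bar>) \<le> g m \<omega>"
        by (rule always_eventually) (use lower in blast)
      show "\<forall>\<^sub>F m in sequentially. g m \<omega> \<le> sv_sum d (f \<omega>)"
        by (rule always_eventually) (use upper in blast)
      have "(\<lambda>m. sv_sum d (f \<omega>) - 1 / real (Suc m) * (\<Sum>a<d. \<Sum>b<d. \<bar>f \<omega> (a, b)\<bar>))
          \<longlonglongrightarrow> sv_sum d (f \<omega>) - 0 * (\<Sum>a<d. \<Sum>b<d. \<bar>f \<omega> (a, b)\<bar>)"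
        by (intro tendsto_intros LIMSEQ_Suc[OF lim_1_over_n])
      then show "(\<lambda>m. sv_sum d (f \<omega>) - 1 / real (Suc m) * (\<Sum>a<d. \<Sum>b<d. \<bar>f \<omega> (a, b)\<bar>)) \<longlonglongrightarrow> sv_sum d (f \<omega>)"
        by simp
    qed simp
  qed
qed

lemma gauss_power:
  assumes "\<sigma> > 0"
  shows "integrable (gauss \<sigma>) (\<lambda>x. x ^ k)"
    and "(\<integral>x. x ^ 0 \<partial>gauss \<sigma>) = 1" "(\<integral>x. x ^ 1 \<partial>gauss \<sigma>) = 0"
    "(\<integral>x. x ^ 2 \<partial>gauss \<sigma>) = \<sigma>\<^sup>2" "(\<integral>x. x ^ 4 \<partial>gauss \<sigma>) = 3 * \<sigma> ^ 4"
proof -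
  have eq: "(\<integral>x. x ^ k \<partial>gauss \<sigma>) = (\<integral>x. normal_density 0 \<sigma> x * (x - 0) ^ k \<partial>lborel)" for k
    by (subst integral_density) auto
  show "integrable (gauss \<sigma>) (\<lambda>x. x ^ k)"
    using integrable_normal_moment[OF assms, of 0 k] by (subst integrable_density) auto
  show "(\<integral>x. x ^ 0 \<partial>gauss \<sigma>) = 1"
    unfolding eq using has_bochner_integral_integral_eq[OF normal_moment_even[OF assms, of 0 0]] by simp
  show "(\<integral>x. x ^ 1 \<partial>gauss \<sigma>) = 0"
    unfolding eq using has_bochner_integral_integral_eq[OF normal_moment_odd[OF assms, of 0 0]] by simp
  show "(\<integral>x. x ^ 2 \<partial>gauss \<sigma>) = \<sigma>\<^sup>2"
    unfolding eq using has_bochner_integral_integral_eq[OF normal_moment_even[OF assms, of 0 1]]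
    by (simp add: fact_numeral)
  show "(\<integral>x. x ^ 4 \<partial>gauss \<sigma>) = 3 * \<sigma> ^ 4"
    unfolding eq using has_bochner_integral_integral_eq[OF normal_moment_even[OF assms, of 0 2]]
    by (simp add: fact_numeral power2_eq_square power4_eq_xxxx)
qed

lemma gaussPi_monomial:
  assumes "finite I" and \<sigma>: "\<sigma> > 0"
  shows "integrable (gaussPi \<sigma> I) (\<lambda>x. \<Prod>k\<in>I. x k ^ e k)"
    and "(\<integral>x. (\<Prod>k\<in>I. x k ^ e k) \<partial>gaussPi \<sigma> I) = (\<Prod>k\<in>I. \<integral>x. x ^ e k \<partial>gauss \<sigma>)"
proof -
  interpret product_prob_space "\<lambda>_. gauss \<sigma>" by (rule product_prob_space_gauss[OF \<sigma>])
  show "integrable (gaussPi \<sigma> I) (\<lambda>x. \<Prod>k\<in>I. x k ^ e k)"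
    by (rule product_integrable_prod) (use assms gauss_power in auto)
  show "(\<integral>x. (\<Prod>k\<in>I. x k ^ e k) \<partial>gaussPi \<sigma> I) = (\<Prod>k\<in>I. \<integral>x. x ^ e k \<partial>gauss \<sigma>)"
    by (rule product_integral_prod) (use assms gauss_power in auto)
qed

lemma gaussPi_power:
  assumes "finite I" "\<sigma> > 0" "i \<in> I"
  shows "integrable (gaussPi \<sigma> I) (\<lambda>x. x i ^ m)"
    and "(\<integral>x. x i ^ m \<partial>gaussPi \<sigma> I) = (\<integral>x. x ^ m \<partial>gauss \<sigma>)"
proof -
  define e where "e k = (if k = i then m else 0)" for k
  have eq: "(\<Prod>k\<in>I. f k ^ e k) = f i ^ m" for f :: "'a \<Rightarrow> real"
    using assms by (simp add: e_def if_distrib[of "\<lambda>n. _ ^ n"] cong: if_cong)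
  have eq': "(\<Prod>k\<in>I. \<integral>x. x ^ e k \<partial>gauss \<sigma>) = (\<integral>x. x ^ m \<partial>gauss \<sigma>)"
  proof -
    have "(\<Prod>k\<in>I. \<integral>x. x ^ e k \<partial>gauss \<sigma>) = (\<Prod>k\<in>I. if k = i then \<integral>x. x ^ m \<partial>gauss \<sigma> else 1)"
      using gauss_power(2)[OF assms(2)] by (intro prod.cong) (auto simp: e_def)
    then show ?thesis using assms by simp
  qed
  show "integrable (gaussPi \<sigma> I) (\<lambda>x. x i ^ m)"
    using gaussPi_monomial(1)[OF assms(1,2), of e] unfolding eq .
  show "(\<integral>x. x i ^ m \<partial>gaussPi \<sigma> I) = (\<integral>x. x ^ m \<partial>gauss \<sigma>)"
    using gaussPi_monomial(2)[OF assms(1,2), of e] unfolding eq eq' .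
qed

lemma gaussPi_component_measurable:
  "i \<in> I \<Longrightarrow> (\<lambda>x. x i) \<in> borel_measurable (gaussPi \<sigma> I)"
  using measurable_component_singleton[of i I "\<lambda>_. gauss \<sigma>"] by simp

lemma gaussPi_component_integrable:
  assumes "finite I" "\<sigma> > 0" "i \<in> I"
  shows "integrable (gaussPi \<sigma> I) (\<lambda>x. x i)"
  using gaussPi_power(1)[OF assms, of 1] by simp


section \<open>The mean nuclear norm of a Gaussian matrix times a fixed matrix\<close>

lemma sv_sum_cong:
  assumes "\<And>a b. a < d \<Longrightarrow> b < d \<Longrightarrow> g (a, b) = h (a, b)"
  shows "sv_sum d g = sv_sum d h"
  by (rule arg_cong[of _ _ sum_singular_values], rule eq_matI) (use assms in auto)

definition right_mult :: "nat \<Rightarrow> (nat \<times> nat \<Rightarrow> real) \<Rightarrow> (nat \<Rightarrow> nat \<Rightarrow> real) \<Rightarrow> nat \<times> nat \<Rightarrow> real" where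
  "right_mult p V M = (\<lambda>(a, b). \<Sum>l<p. V (a, l) * M l b)"

definition row_reflection :: "nat \<Rightarrow> nat \<Rightarrow> real \<Rightarrow> real \<Rightarrow> (nat \<Rightarrow> nat \<Rightarrow> real) \<Rightarrow> nat \<Rightarrow> nat \<Rightarrow> real" where
  "row_reflection i j c s M = (\<lambda>l b. if l = i then c * M i b + s * M j b
     else if l = j then s * M i b - c * M j b else M l b)"

definition frob :: "nat \<Rightarrow> nat \<Rightarrow> (nat \<Rightarrow> nat \<Rightarrow> real) \<Rightarrow> real" where
  "frob d p M = (\<Sum>l<p. \<Sum>b<d. (M l b)\<^sup>2)"

lemma sum_split_two:
  fixes f :: "nat \<Rightarrow> real"
  assumes "i < p" "j < p" "i \<noteq> j"
  shows "(\<Sum>l<p. f l) = f i + f j + (\<Sum>l\<in>{..<p} - {i, j}. f l)"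
proof -
  have "(\<Sum>l<p. f l) = f i + (\<Sum>l\<in>{..<p} - {i}. f l)"
    by (rule sum.remove) (use assms in auto)
  also have "(\<Sum>l\<in>{..<p} - {i}. f l) = f j + (\<Sum>l\<in>{..<p} - {i} - {j}. f l)"
    by (rule sum.remove) (use assms in auto)
  also have "{..<p} - {i} - {j} = {..<p} - {i, j}" by auto
  finally show ?thesis by simp
qed

text \<open>The reflection matrix is symmetric, so in the product it acts equally well on the
  columns of \<open>V\<close> or, with no transposition, on the rows of \<open>M\<close>.\<close>

lemma right_mult_column_reflection:
  assumes ij: "i < p" "j < p" "i \<noteq> j" and ab: "a < d"
  shows "right_mult p (column_reflection d p i j c s {..<d} V) M (a, b)
    = right_mult p V (row_reflection i j c s M) (a, b)"
proof -
  have "(\<Sum>l\<in>{..<p} - {i, j}. column_reflection d p i j c s {..<d} V (a, l) * M l b)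
      = (\<Sum>l\<in>{..<p} - {i, j}. V (a, l) * row_reflection i j c s M l b)"
    by (rule sum.cong) (use ab in \<open>auto simp: column_reflection_def row_reflection_def\<close>)
  then show ?thesis
    unfolding right_mult_def prod.case sum_split_two[OF ij]
    using ij ab by (simp add: column_reflection_def row_reflection_def algebra_simps)
qed

lemma frob_row_reflection:
  assumes ij: "i < p" "j < p" "i \<noteq> j" and cs: "c\<^sup>2 + s\<^sup>2 = 1"
  shows "frob d p (row_reflection i j c s M) = frob d p M"
proof -
  have sq: "(c * x + s * y)\<^sup>2 + (s * x - c * y)\<^sup>2 = x\<^sup>2 + y\<^sup>2" for x y
  proof -
    have "(c * x + s * y)\<^sup>2 + (s * x - c * y)\<^sup>2 = (c\<^sup>2 + s\<^sup>2) * (x\<^sup>2 + y\<^sup>2)"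
      by (simp add: power2_eq_square algebra_simps)
    then show ?thesis by (simp add: cs)
  qed
  have "(\<Sum>b<d. (row_reflection i j c s M i b)\<^sup>2) + (\<Sum>b<d. (row_reflection i j c s M j b)\<^sup>2)
      = (\<Sum>b<d. (M i b)\<^sup>2) + (\<Sum>b<d. (M j b)\<^sup>2)"
    unfolding sum.distrib[symmetric] using ij by (intro sum.cong refl) (simp add: row_reflection_def sq)
  moreover have "(\<Sum>l\<in>{..<p} - {i, j}. \<Sum>b<d. (row_reflection i j c s M l b)\<^sup>2)
      = (\<Sum>l\<in>{..<p} - {i, j}. \<Sum>b<d. (M l b)\<^sup>2)"
    by (rule sum.cong) (auto simp: row_reflection_def)
  ultimately show ?thesis
    unfolding frob_def sum_split_two[OF ij] by simp
qed

text \<open>For \<open>l\<close> and \<open>k\<close> different, toggling the membership of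
  \<open>l\<close> is an involution of the subsets that negates every term.\<close>

lemma sum_sign_products:
  fixes d :: nat
  defines "sg \<equiv> \<lambda>S l. if l \<in> S then - 1 else 1 :: real"
  assumes lk: "l < d" "k < d"
  shows "(\<Sum>S\<in>Pow {..<d}. sg S l * sg S k) = (if l = k then 2 ^ d else 0)"
proof (cases "l = k")
  case True
  have "sg S k * sg S k = 1" for S by (simp add: sg_def)
  then show ?thesis using True by (simp add: card_Pow)
next
  case False
  have "(\<Sum>S\<in>Pow {..<d}. sg S l * sg S k) = (\<Sum>S\<in>Pow {..<d}. - (sg S l * sg S k))"
    by (rule sum.reindex_bij_witness[where i = "\<lambda>S. if l \<in> S then S - {l} else insert l S"
          and j = "\<lambda>S. if l \<in> S then S - {l} else insert l S"])
      (use False lk in \<open>auto simp: sg_def\<close>)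
  then show ?thesis using False by (simp add: sum_negf)
qed

lemma sum_signs_square:
  fixes d :: nat and y :: "nat \<Rightarrow> real"
  shows "(\<Sum>S\<in>Pow {..<d}. (\<Sum>l<d. (if l \<in> S then - 1 else 1) * y l)\<^sup>2) = 2 ^ d * (\<Sum>l<d. (y l)\<^sup>2)"
proof -
  let ?sg = "\<lambda>S l. if l \<in> S then - 1 else 1 :: real"
  have "(\<Sum>S\<in>Pow {..<d}. (\<Sum>l<d. ?sg S l * y l)\<^sup>2)
      = (\<Sum>S\<in>Pow {..<d}. \<Sum>l<d. \<Sum>k<d. y l * y k * (?sg S l * ?sg S k))"
    unfolding power2_eq_square sum_product by (intro sum.cong refl) (simp only: mult_ac)
  also have "\<dots> = (\<Sum>l<d. \<Sum>k<d. \<Sum>S\<in>Pow {..<d}. y l * y k * (?sg S l * ?sg S k))"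
    by (subst sum.swap, rule sum.cong[OF refl], subst sum.swap) simp
  also have "\<dots> = (\<Sum>l<d. \<Sum>k<d. y l * y k * (\<Sum>S\<in>Pow {..<d}. ?sg S l * ?sg S k))"
    by (simp only: sum_distrib_left)
  also have "\<dots> = (\<Sum>l<d. \<Sum>k<d. if k = l then y l * y k * 2 ^ d else 0)"
    by (intro sum.cong refl) (subst sum_sign_products, auto)
  also have "\<dots> = 2 ^ d * (\<Sum>l<d. (y l)\<^sup>2)"
    by (simp add: sum_distrib_left power2_eq_square mult_ac)
  finally show ?thesis .
qed

lemma bij_betw_cyclic_shift: "bij_betw (\<lambda>l. (l + u) mod d) {..<d} {..<d :: nat}"
proof -
  have "inj_on (\<lambda>l. (l + u) mod d) {..<d}"
  proof (rule inj_onI)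
    fix x y assume xy: "x \<in> {..<d}" "y \<in> {..<d}" "(x + u) mod d = (y + u) mod d"
    \<comment> \<open>Adding \<open>d - 1\<close> further copies of \<open>u\<close> completes a
      multiple of \<open>d\<close>, which undoes the shift without subtraction.\<close>
    then have "((x + u) + (d - 1) * u) mod d = ((y + u) + (d - 1) * u) mod d" by (metis mod_add_left_eq)
    moreover have "z + u + (d - 1) * u = z + u * d" for z using xy by (cases d) (auto simp: algebra_simps)
    ultimately have "(x + u * d) mod d = (y + u * d) mod d" by metis
    then have "x mod d = y mod d" by simp
    then show "x = y" using xy by simp
  qed
  moreover have "(\<lambda>l. (l + u) mod d) ` {..<d} \<subseteq> {..<d}" by auto
  ultimately show ?thesis by (simp add: bij_betw_def endo_inj_surj)
qed

text \<open>The optimal contractions for the individual matrices \<open>V M\<^sub>\<theta>\<close> combine to a test matrix for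
  \<open>V\<close>, whose operator norm is controlled by the Cauchy-Schwarz inequality.\<close>

lemma sum_sv_sum_le:
  fixes M :: "'t \<Rightarrow> nat \<Rightarrow> nat \<Rightarrow> real"
  assumes c: "c \<ge> 0"
    and M: "\<And>x. (\<Sum>\<theta>\<in>\<Theta>. \<Sum>b<d. (\<Sum>l<d. M \<theta> l b * x l)\<^sup>2) \<le> real (card \<Theta>) * c\<^sup>2 * (\<Sum>l<d. (x l)\<^sup>2)"
  shows "(\<Sum>\<theta>\<in>\<Theta>. sv_sum d (right_mult d V (M \<theta>))) \<le> real (card \<Theta>) * c * sv_sum d V"
proof -
  define opt where "opt \<theta> T \<longleftrightarrow> op_bound d 1 T \<and>
    (\<Sum>a<d. \<Sum>b<d. right_mult d V (M \<theta>) (a, b) * T (a, b)) = sv_sum d (right_mult d V (M \<theta>))" for \<theta> T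
  have "\<exists>T. opt \<theta> T" for \<theta>
    unfolding opt_def using sv_sum_attained[of d "right_mult d V (M \<theta>)"] by blast
  then obtain T where "\<And>\<theta>. opt \<theta> (T \<theta>)" by metis
  then have T: "op_bound d 1 (T \<theta>)"
    "(\<Sum>a<d. \<Sum>b<d. right_mult d V (M \<theta>) (a, b) * T \<theta> (a, b)) = sv_sum d (right_mult d V (M \<theta>))" for \<theta>
    by (auto simp: opt_def)
  \<comment> \<open>\<open>W\<close> adds up the products of \<open>T \<theta>\<close> with the
    transpose of \<open>M \<theta>\<close>, so its pairing with \<open>V\<close> is the sum of all
    the nuclear norms.\<close>
  define W where "W = (\<lambda>(a, l). \<Sum>\<theta>\<in>\<Theta>. \<Sum>b<d. M \<theta> l b * T \<theta> (a, b))"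
  have "op_bound d (real (card \<Theta>) * c) W"
    unfolding op_bound_def
  proof
    fix x :: "nat \<Rightarrow> real"
    define y where "y \<theta> b = (\<Sum>l<d. M \<theta> l b * x l)" for \<theta> b
    have Wx: "(\<Sum>l<d. W (a, l) * x l) = (\<Sum>\<theta>\<in>\<Theta>. 1 * (\<Sum>b<d. T \<theta> (a, b) * y \<theta> b))" for a
    proof -
      have "(\<Sum>l<d. W (a, l) * x l) = (\<Sum>l<d. \<Sum>\<theta>\<in>\<Theta>. \<Sum>b<d. T \<theta> (a, b) * (M \<theta> l b * x l))"
        by (simp add: W_def sum_distrib_left sum_distrib_right mult_ac)
      also have "\<dots> = (\<Sum>\<theta>\<in>\<Theta>. \<Sum>b<d. \<Sum>l<d. T \<theta> (a, b) * (M \<theta> l b * x l))"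
        by (subst sum.swap, rule sum.cong[OF refl], rule sum.swap)
      finally show ?thesis by (simp add: y_def sum_distrib_left)
    qed
    have "(\<Sum>a<d. (\<Sum>l<d. W (a, l) * x l)\<^sup>2) \<le> (\<Sum>a<d. real (card \<Theta>) * (\<Sum>\<theta>\<in>\<Theta>. (\<Sum>b<d. T \<theta> (a, b) * y \<theta> b)\<^sup>2))"
    proof (rule sum_mono)
      fix a
      have "(\<Sum>\<theta>\<in>\<Theta>. 1 * (\<Sum>b<d. T \<theta> (a, b) * y \<theta> b))\<^sup>2
          \<le> (\<Sum>\<theta>\<in>\<Theta>. 1\<^sup>2) * (\<Sum>\<theta>\<in>\<Theta>. (\<Sum>b<d. T \<theta> (a, b) * y \<theta> b)\<^sup>2)"
        by (rule Cauchy_Schwarz_ineq_sum)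
      then show "(\<Sum>l<d. W (a, l) * x l)\<^sup>2 \<le> real (card \<Theta>) * (\<Sum>\<theta>\<in>\<Theta>. (\<Sum>b<d. T \<theta> (a, b) * y \<theta> b)\<^sup>2)"
        unfolding Wx by simp
    qed
    also have "\<dots> = real (card \<Theta>) * (\<Sum>\<theta>\<in>\<Theta>. \<Sum>a<d. (\<Sum>b<d. T \<theta> (a, b) * y \<theta> b)\<^sup>2)"
      unfolding sum_distrib_left[symmetric] by (subst sum.swap) simp
    also have "\<dots> \<le> real (card \<Theta>) * (\<Sum>\<theta>\<in>\<Theta>. \<Sum>b<d. (y \<theta> b)\<^sup>2)"
    proof (rule mult_left_mono[OF sum_mono])
      show "(\<Sum>a<d. (\<Sum>b<d. T \<theta> (a, b) * y \<theta> b)\<^sup>2) \<le> (\<Sum>b<d. (y \<theta> b)\<^sup>2)" for \<theta>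
        using T(1)[of \<theta>, unfolded op_bound_def, rule_format, of "y \<theta>"] by simp
    qed simp
    also have "\<dots> \<le> real (card \<Theta>) * (real (card \<Theta>) * c\<^sup>2 * (\<Sum>l<d. (x l)\<^sup>2))"
      unfolding y_def by (rule mult_left_mono[OF M[of x]]) simp
    finally show "(\<Sum>a<d. (\<Sum>l<d. W (a, l) * x l)\<^sup>2) \<le> (real (card \<Theta>) * c)\<^sup>2 * (\<Sum>l<d. (x l)\<^sup>2)"
      by (simp add: power_mult_distrib power2_eq_square[of "real (card \<Theta>)"] mult.assoc)
  qed
  then have "(\<Sum>a<d. \<Sum>l<d. V (a, l) * W (a, l)) \<le> real (card \<Theta>) * c * sv_sum d V"
    using c by (intro pairing_le_sv_sum) auto
  moreover have "(\<Sum>\<theta>\<in>\<Theta>. sv_sum d (right_mult d V (M \<theta>))) = (\<Sum>a<d. \<Sum>l<d. V (a, l) * W (a, l))"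
  proof -
    have "(\<Sum>\<theta>\<in>\<Theta>. sv_sum d (right_mult d V (M \<theta>)))
        = (\<Sum>\<theta>\<in>\<Theta>. \<Sum>a<d. \<Sum>b<d. \<Sum>l<d. V (a, l) * (M \<theta> l b * T \<theta> (a, b)))"
      by (rule sum.cong[OF refl], subst T(2)[symmetric]) (simp add: right_mult_def sum_distrib_right mult.assoc)
    also have "\<dots> = (\<Sum>a<d. \<Sum>\<theta>\<in>\<Theta>. \<Sum>l<d. \<Sum>b<d. V (a, l) * (M \<theta> l b * T \<theta> (a, b)))"
      by (subst sum.swap, rule sum.cong[OF refl], rule sum.cong[OF refl], rule sum.swap)
    also have "\<dots> = (\<Sum>a<d. \<Sum>l<d. \<Sum>\<theta>\<in>\<Theta>. \<Sum>b<d. V (a, l) * (M \<theta> l b * T \<theta> (a, b)))"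
      by (rule sum.cong[OF refl], rule sum.swap)
    finally show ?thesis by (simp add: W_def sum_distrib_left)
  qed
  ultimately show ?thesis by simp
qed

lemma sv_sum_integrable:
  assumes "\<And>a b. a < d \<Longrightarrow> b < d \<Longrightarrow> integrable N (\<lambda>V. f V (a, b))"
  shows "integrable N (\<lambda>V. sv_sum d (f V))"
proof (rule Bochner_Integration.integrable_bound)
  show "integrable N (\<lambda>V. \<Sum>a<d. \<Sum>b<d. \<bar>f V (a, b)\<bar>)"
    by (intro Bochner_Integration.integrable_sum integrable_abs assms) auto
  show "(\<lambda>V. sv_sum d (f V)) \<in> borel_measurable N"
    by (rule borel_measurable_sv_sum) (use assms in auto)
  show "AE V in N. norm (sv_sum d (f V)) \<le> norm (\<Sum>a<d. \<Sum>b<d. \<bar>f V (a, b)\<bar>)"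
    using sv_sum_le_entries sv_sum_nonneg by (auto intro!: AE_I2 simp: sum_nonneg)
qed

text \<open>The strict inequality \<open>d < p\<close> provides a row with index \<open>d\<close>
  outside the first \<open>d\<close>, the partner in \<open>mean_nuc_flip\<close>.\<close>

locale gaussian_matrix =
  fixes d p :: nat and \<sigma> :: real
  assumes d_pos: "1 \<le> d" and d_less_p: "d < p" and \<sigma>_pos: "0 < \<sigma>"
begin

abbreviation "\<mu> \<equiv> gaussPi \<sigma> ({..<d} \<times> {..<p})"

definition mean_nuc :: "(nat \<Rightarrow> nat \<Rightarrow> real) \<Rightarrow> real" where
  "mean_nuc M = (\<integral>V. sv_sum d (right_mult p V M) \<partial>\<mu>)"

lemma entry_integrable: "a < d \<Longrightarrow> l < p \<Longrightarrow> integrable \<mu> (\<lambda>V. V (a, l))"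
  by (rule gaussPi_component_integrable) (auto simp: \<sigma>_pos)

lemma right_mult_integrable: "a < d \<Longrightarrow> integrable \<mu> (\<lambda>V. right_mult p V M (a, b))"
  unfolding right_mult_def prod.case
  by (intro Bochner_Integration.integrable_sum integrable_mult_left entry_integrable) auto

text \<open>The reflection is moved from \<open>M\<close> to \<open>V\<close>, whose law it
  preserves.\<close>

lemma mean_nuc_row_reflection:
  assumes ij: "i < p" "j < p" "i \<noteq> j" and cs: "c\<^sup>2 + s\<^sup>2 = 1"
  shows "mean_nuc (row_reflection i j c s M) = mean_nuc M"
proof -
  let ?R = "column_reflection d p i j c s {..<d}"
  have R: "?R \<in> \<mu> \<rightarrow>\<^sub>M \<mu>" "distr \<mu> \<mu> ?R = \<mu>"
    using distr_column_reflection[OF ij cs \<sigma>_pos order_refl] by auto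
  have "mean_nuc (row_reflection i j c s M) = (\<integral>V. sv_sum d (right_mult p (?R V) M) \<partial>\<mu>)"
    unfolding mean_nuc_def
    by (intro Bochner_Integration.integral_cong refl sv_sum_cong) (simp add: right_mult_column_reflection ij)
  also have "\<dots> = (\<integral>V. sv_sum d (right_mult p V M) \<partial>distr \<mu> \<mu> ?R)"
    by (rule integral_distr[symmetric, OF R(1)])
      (intro borel_measurable_integrable sv_sum_integrable right_mult_integrable)
  finally show ?thesis by (simp add: R mean_nuc_def)
qed

text \<open>A planar reflection with \<open>c = - 1\<close>, \<open>s = 0\<close> negates row
  \<open>i\<close> and fixes its partner; the spare row \<open>d\<close> serves as partner for every
  \<open>i\<close> in \<open>S\<close>.\<close>

lemma mean_nuc_flip:
  assumes "finite S" "S \<subseteq> {..<d}"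
  shows "mean_nuc (\<lambda>l b. (if l \<in> S then - 1 else 1) * M l b) = mean_nuc M"
  using assms
proof (induction S rule: finite_induct)
  case empty
  then show ?case by simp
next
  case (insert i S)
  then have i: "i < p" "d \<noteq> i" using d_less_p by auto
  have "(\<lambda>l b. (if l \<in> insert i S then - 1 else 1) * M l b)
      = row_reflection i d (- 1) 0 (\<lambda>l b. (if l \<in> S then - 1 else 1) * M l b)"
    using insert i by (auto simp: fun_eq_iff row_reflection_def)
  then show ?case
    using mean_nuc_row_reflection[of i d "- 1" 0] i d_less_p insert by simp
qed

lemma mean_nuc_permute:
  assumes "\<pi> permutes {..<d}"
  shows "mean_nuc (\<lambda>l. M (\<pi> l)) = mean_nuc M"
  using assms finite_lessThan
proof (induction arbitrary: M rule: permutes_induct)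
  case id
  then show ?case by simp
next
  case (swap a b q)
  have "(\<lambda>l. M (Transposition.transpose a b l)) = row_reflection a b 0 1 M"
    using swap by (auto simp: fun_eq_iff row_reflection_def Transposition.transpose_def)
  moreover have "a < p" "b < p" "a \<noteq> b" using swap d_less_p by auto
  ultimately have "mean_nuc (\<lambda>l. M (Transposition.transpose a b l)) = mean_nuc M"
    using mean_nuc_row_reflection[of a b 0 1 M] by simp
  then show ?case using swap.IH[of "\<lambda>l. M (Transposition.transpose a b l)"] by (simp add: comp_def)
qed

text \<open>For \<open>\<sigma> = sqrt (1 / real d)\<close> this is \<open>d\<close> times
  \<open>alpha_R d\<close>.\<close>

definition square_mean :: real where
  "square_mean = (\<integral>g. sv_sum d g \<partial>gaussPi \<sigma> ({..<d} \<times> {..<d}))"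

text \<open>\<open>sv_sum d\<close> reads only the first \<open>d\<close> columns, and their
  marginal law is that of the square Gaussian matrix.\<close>

lemma integral_sv_sum_square: "(\<integral>V. sv_sum d V \<partial>\<mu>) = square_mean"
proof -
  interpret product_prob_space "\<lambda>_. gauss \<sigma>" "{..<d} \<times> {..<p}"
    by (rule product_prob_space_gauss[OF \<sigma>_pos])
  let ?J = "{..<d} \<times> {..<d}"
  have sub: "?J \<subseteq> {..<d} \<times> {..<p}" using d_less_p by auto
  have "square_mean = (\<integral>g. sv_sum d g \<partial>distr \<mu> (gaussPi \<sigma> ?J) (\<lambda>x. restrict x ?J))"
    unfolding square_mean_def by (subst distr_PiM_restrict_finite) (use sub in auto)
  also have "\<dots> = (\<integral>V. sv_sum d (restrict V ?J) \<partial>\<mu>)"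
  proof (rule integral_distr)
    show "(\<lambda>x. restrict x ?J) \<in> \<mu> \<rightarrow>\<^sub>M gaussPi \<sigma> ?J"
      by (rule measurable_restrict_subset[OF sub])
    show "(\<lambda>g. sv_sum d g) \<in> borel_measurable (gaussPi \<sigma> ?J)"
      by (rule borel_measurable_sv_sum) (rule gaussPi_component_measurable, auto)
  qed
  also have "\<dots> = (\<integral>V. sv_sum d V \<partial>\<mu>)"
    by (intro Bochner_Integration.integral_cong refl sv_sum_cong) auto
  finally show ?thesis by simp
qed

text \<open>Averages over the sign changes and cyclic shifts of the first \<open>d\<close> rows of \<open>M\<close>; they turn
  \<open>M M\<^sup>T\<close> into a multiple of the identity.\<close>

lemma mean_nuc_le_square:
  assumes zero: "\<And>l b. d \<le> l \<Longrightarrow> l < p \<Longrightarrow> b < d \<Longrightarrow> M l b = 0"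
  shows "mean_nuc M \<le> sqrt (frob d p M / real d) * square_mean"
proof -
  \<comment> \<open>Rows from \<open>d\<close> on stay in place, so the zero rows of
    \<open>M\<close> remain zero and \<open>p\<close> can be replaced by \<open>d\<close> in the
    product with \<open>V\<close>.\<close>
  define sh where "sh u l = (if l < d then (l + u) mod d else l)" for u l
  have sh: "sh u permutes {..<d}" for u
  proof (rule bij_imp_permutes)
    show "bij_betw (sh u) {..<d} {..<d}"
      using bij_betw_cyclic_shift[of u d] by (rule bij_betw_cong[THEN iffD1, rotated]) (auto simp: sh_def)
  qed (auto simp: sh_def)
  define sg where "sg S l = (if l \<in> S then - 1 else 1 :: real)" for S :: "nat set" and l
  define N where "N = (\<lambda>(S, u) l b. sg S l * M (sh u l) b)"
  define \<Theta> where "\<Theta> = Pow {..<d} \<times> {..<d}"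
  have card: "real (card \<Theta>) = 2 ^ d * real d" by (simp add: \<Theta>_def card_cartesian_product card_Pow)
  have mean: "mean_nuc (N \<theta>) = mean_nuc M" if th: "\<theta> \<in> \<Theta>" for \<theta>
  proof -
    obtain S u where \<theta>: "\<theta> = (S, u)" by (cases \<theta>)
    have S: "finite S" "S \<subseteq> {..<d}" using th \<theta> finite_subset by (auto simp: \<Theta>_def)
    have "mean_nuc (N \<theta>) = mean_nuc (\<lambda>l b. (if l \<in> S then - 1 else 1) * M (sh u l) b)"
      by (simp add: N_def \<theta> sg_def)
    also have "\<dots> = mean_nuc (\<lambda>l. M (sh u l))" by (rule mean_nuc_flip[OF S])
    also have "\<dots> = mean_nuc M" by (rule mean_nuc_permute[OF sh])
    finally show ?thesis .
  qed
  have trunc: "right_mult p V (N \<theta>) (a, b) = right_mult d V (N \<theta>) (a, b)" if "b < d" for \<theta> V a b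
  proof -
    have "(\<Sum>l<d. V (a, l) * N \<theta> l b) = (\<Sum>l<p. V (a, l) * N \<theta> l b)"
      by (rule sum.mono_neutral_left)
        (use d_less_p zero that in \<open>auto simp: N_def sh_def split: prod.splits\<close>)
    then show ?thesis by (simp add: right_mult_def)
  qed
  have frob: "frob d p M = (\<Sum>l<d. \<Sum>b<d. (M l b)\<^sup>2)"
    unfolding frob_def
    by (rule sum.mono_neutral_right) (use d_less_p zero in auto)
  define c where "c = sqrt (frob d p M / real d)"
  have c: "c \<ge> 0" and c2: "c\<^sup>2 = frob d p M / real d" by (simp_all add: c_def frob_def sum_nonneg)
  \<comment> \<open>The signs cancel the cross terms and the shifts bring every row of
    \<open>M\<close> to every position exactly once, so all coordinates of \<open>x\<close> get the
    same weight \<open>frob d p M\<close>.\<close>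
  have key: "(\<Sum>\<theta>\<in>\<Theta>. \<Sum>b<d. (\<Sum>l<d. N \<theta> l b * x l)\<^sup>2) = real (card \<Theta>) * c\<^sup>2 * (\<Sum>l<d. (x l)\<^sup>2)" for x
  proof -
    have "(\<Sum>\<theta>\<in>\<Theta>. \<Sum>b<d. (\<Sum>l<d. N \<theta> l b * x l)\<^sup>2)
        = (\<Sum>S\<in>Pow {..<d}. \<Sum>u<d. \<Sum>b<d. (\<Sum>l<d. (if l \<in> S then - 1 else 1) * (M (sh u l) b * x l))\<^sup>2)"
      unfolding \<Theta>_def sum.cartesian_product' by (simp add: N_def sg_def mult.assoc)
    also have "\<dots> = (\<Sum>u<d. \<Sum>b<d. \<Sum>S\<in>Pow {..<d}. (\<Sum>l<d. (if l \<in> S then - 1 else 1) * (M (sh u l) b * x l))\<^sup>2)"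
      by (subst sum.swap, rule sum.cong[OF refl], rule sum.swap)
    also have "\<dots> = (\<Sum>u<d. \<Sum>b<d. 2 ^ d * (\<Sum>l<d. (M (sh u l) b * x l)\<^sup>2))"
      by (simp only: sum_signs_square)
    also have "\<dots> = 2 ^ d * (\<Sum>u<d. \<Sum>l<d. \<Sum>b<d. (M (sh u l) b)\<^sup>2 * (x l)\<^sup>2)"
      unfolding sum_distrib_left[symmetric] power_mult_distrib
      by (rule arg_cong[where f = "\<lambda>t. 2 ^ d * t"], rule sum.cong[OF refl], rule sum.swap)
    also have "\<dots> = 2 ^ d * (\<Sum>l<d. \<Sum>u<d. \<Sum>b<d. (M (sh u l) b)\<^sup>2 * (x l)\<^sup>2)"
      by (subst sum.swap) simp
    also have "\<dots> = 2 ^ d * (\<Sum>l<d. (\<Sum>u<d. \<Sum>b<d. (M (sh u l) b)\<^sup>2) * (x l)\<^sup>2)"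
      by (simp add: sum_distrib_right)
    also have "\<dots> = 2 ^ d * (\<Sum>l<d. frob d p M * (x l)\<^sup>2)"
    proof (intro arg_cong[where f = "\<lambda>t. 2 ^ d * t"] sum.cong refl)
      fix l assume l: "l \<in> {..<d}"
      have "(\<Sum>u<d. \<Sum>b<d. (M (sh u l) b)\<^sup>2) = (\<Sum>u<d. \<Sum>b<d. (M ((u + l) mod d) b)\<^sup>2)"
        using l by (simp add: sh_def add.commute)
      also have "\<dots> = (\<Sum>k<d. \<Sum>b<d. (M k b)\<^sup>2)"
        by (rule sum.reindex_bij_betw[OF bij_betw_cyclic_shift])
      finally show "(\<Sum>u<d. \<Sum>b<d. (M (sh u l) b)\<^sup>2) * (x l)\<^sup>2 = frob d p M * (x l)\<^sup>2"
        by (simp add: frob)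
    qed
    also have "\<dots> = real (card \<Theta>) * c\<^sup>2 * (\<Sum>l<d. (x l)\<^sup>2)"
      using d_pos by (simp add: card c2 sum_distrib_left[symmetric])
    finally show ?thesis .
  qed
  have "real (card \<Theta>) * mean_nuc M = (\<Sum>\<theta>\<in>\<Theta>. mean_nuc (N \<theta>))" by (simp add: mean)
  also have "\<dots> = (\<integral>V. (\<Sum>\<theta>\<in>\<Theta>. sv_sum d (right_mult p V (N \<theta>))) \<partial>\<mu>)"
    unfolding mean_nuc_def
    by (rule Bochner_Integration.integral_sum[symmetric]) (intro sv_sum_integrable right_mult_integrable)
  also have "\<dots> \<le> (\<integral>V. real (card \<Theta>) * c * sv_sum d V \<partial>\<mu>)"
  proof (rule integral_mono)
    show "integrable \<mu> (\<lambda>V. \<Sum>\<theta>\<in>\<Theta>. sv_sum d (right_mult p V (N \<theta>)))"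
      by (intro Bochner_Integration.integrable_sum sv_sum_integrable right_mult_integrable)
    show "integrable \<mu> (\<lambda>V. real (card \<Theta>) * c * sv_sum d V)"
      by (intro integrable_mult_right sv_sum_integrable entry_integrable) (use d_less_p in auto)
    fix V :: "nat \<times> nat \<Rightarrow> real"
    have "(\<Sum>\<theta>\<in>\<Theta>. sv_sum d (right_mult p V (N \<theta>))) = (\<Sum>\<theta>\<in>\<Theta>. sv_sum d (right_mult d V (N \<theta>)))"
      by (intro sum.cong refl sv_sum_cong trunc)
    also have "\<dots> \<le> real (card \<Theta>) * c * sv_sum d V"
      by (rule sum_sv_sum_le[OF c]) (simp only: key order_refl)
    finally show "(\<Sum>\<theta>\<in>\<Theta>. sv_sum d (right_mult p V (N \<theta>))) \<le> real (card \<Theta>) * c * sv_sum d V" .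
  qed
  also have "\<dots> = real (card \<Theta>) * (c * square_mean)" by (simp add: integral_sv_sum_square)
  finally have "real (card \<Theta>) * mean_nuc M \<le> real (card \<Theta>) * (c * square_mean)" .
  moreover have "real (card \<Theta>) > 0" using d_pos by (simp add: card)
  ultimately show ?thesis by (simp add: c_def)
qed

text \<open>Planar reflections triangularise \<open>M\<close> as in a QR decomposition.\<close>

lemma mean_nuc_le_triangular:
  assumes "k \<le> d" and "\<And>a i. a < k \<Longrightarrow> a < i \<Longrightarrow> i < p \<Longrightarrow> M i a = 0"
  shows "mean_nuc M \<le> sqrt (frob d p M / real d) * square_mean"
  using assms
proof (induction k arbitrary: M rule: inc_induct)
  case base
  then show ?case by (intro mean_nuc_le_square) auto
next
  case (step k)
  \<comment> \<open>Column \<open>k\<close> is cleared from the top: rows strictly between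
    \<open>k\<close> and \<open>t\<close> are already zero there. At \<open>t = p\<close> the column
    is done and the outer hypothesis for \<open>Suc k\<close> applies.\<close>
  have "mean_nuc M \<le> sqrt (frob d p M / real d) * square_mean"
    if "Suc k \<le> t" "t \<le> p" "\<And>a i. a < k \<Longrightarrow> a < i \<Longrightarrow> i < p \<Longrightarrow> M i a = 0" "\<And>i. k < i \<Longrightarrow> i < t \<Longrightarrow> M i k = 0" for t M
    using that(2,1,3,4)
  proof (induction t arbitrary: M rule: inc_induct)
    case base
    then show ?case by (intro step.IH) (auto simp: less_Suc_eq)
  next
    case (step t)
    show ?case
    proof (cases "M t k = 0")
      case True
      show ?thesis
        by (rule step.IH) (use step.prems True in \<open>auto simp: less_Suc_eq\<close>)
    next
      case False
      define r where "r = sqrt ((M k k)\<^sup>2 + (M t k)\<^sup>2)"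
      have "(M k k)\<^sup>2 + (M t k)\<^sup>2 > 0" using False by (simp add: add_nonneg_pos)
      then have r: "r > 0" "r\<^sup>2 = (M k k)\<^sup>2 + (M t k)\<^sup>2" by (simp_all add: r_def)
      \<comment> \<open>The coefficients put \<open>r\<close> in position \<open>(k, k)\<close> and
        0 in position \<open>(t, k)\<close>. Earlier columns survive because rows \<open>k\<close>
        and \<open>t\<close> both vanish in them.\<close>
      define M' where "M' = row_reflection k t (M k k / r) (M t k / r) M"
      have idx: "k < p" "t < p" "k \<noteq> t" using step.hyps step.prems by auto
      have cs: "(M k k / r)\<^sup>2 + (M t k / r)\<^sup>2 = 1"
      proof -
        have "(M k k / r)\<^sup>2 + (M t k / r)\<^sup>2 = r\<^sup>2 / r\<^sup>2"
          unfolding power_divide add_divide_distrib[symmetric] r(2)[symmetric] ..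
        then show ?thesis using r(1) by simp
      qed
      have "mean_nuc M' \<le> sqrt (frob d p M' / real d) * square_mean"
      proof (rule step.IH)
        show "M' i a = 0" if "a < k" "a < i" "i < p" for a i
          using that step.prems idx by (auto simp: M'_def row_reflection_def)
        show "M' i k = 0" if "k < i" "i < Suc t" for i
          using that step.prems by (auto simp: M'_def row_reflection_def less_Suc_eq)
      qed (use step.prems in auto)
      then show ?thesis
        unfolding M'_def mean_nuc_row_reflection[OF idx cs] frob_row_reflection[OF idx cs] .
    qed
  qed
  from this[of "Suc k" M] step show ?case using d_less_p by auto
qed

lemma mean_nuc_le: "mean_nuc M \<le> sqrt (frob d p M / real d) * square_mean"
  by (rule mean_nuc_le_triangular[of 0]) auto

end


section \<open>Second and fourth moments of the Gaussian matrix\<close>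

lemma gaussPi_monomial_subset:
  assumes I: "finite I" and \<sigma>: "\<sigma> > 0" and K: "K \<subseteq> I"
  shows "integrable (gaussPi \<sigma> I) (\<lambda>x. \<Prod>k\<in>K. x k ^ e k)"
    and "(\<integral>x. (\<Prod>k\<in>K. x k ^ e k) \<partial>gaussPi \<sigma> I) = (\<Prod>k\<in>K. \<integral>x. x ^ e k \<partial>gauss \<sigma>)"
proof -
  define e' where "e' k = (if k \<in> K then e k else 0)" for k
  have 1: "(\<Prod>k\<in>I. x k ^ e' k) = (\<Prod>k\<in>K. x k ^ e k)" for x :: "'a \<Rightarrow> real"
    by (rule prod.mono_neutral_cong_right) (use I K in \<open>auto simp: e'_def\<close>)
  have 2: "(\<Prod>k\<in>I. \<integral>x. x ^ e' k \<partial>gauss \<sigma>) = (\<Prod>k\<in>K. \<integral>x. x ^ e k \<partial>gauss \<sigma>)"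
    by (rule prod.mono_neutral_cong_right) (use I K gauss_power(2)[OF \<sigma>] in \<open>auto simp: e'_def\<close>)
  show "integrable (gaussPi \<sigma> I) (\<lambda>x. \<Prod>k\<in>K. x k ^ e k)"
    using gaussPi_monomial(1)[OF I \<sigma>, of e'] by (simp only: 1)
  show "(\<integral>x. (\<Prod>k\<in>K. x k ^ e k) \<partial>gaussPi \<sigma> I) = (\<Prod>k\<in>K. \<integral>x. x ^ e k \<partial>gauss \<sigma>)"
    using gaussPi_monomial(2)[OF I \<sigma>, of e'] by (simp only: 1 2)
qed

context gaussian_matrix
begin

lemma entry_square:
  assumes "a < d" "l < p"
  shows "integrable \<mu> (\<lambda>V. (V (a, l))\<^sup>2)" "(\<integral>V. (V (a, l))\<^sup>2 \<partial>\<mu>) = \<sigma>\<^sup>2"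
  using gaussPi_power[of "{..<d} \<times> {..<p}" \<sigma> "(a, l)" 2] gauss_power(4)[OF \<sigma>_pos] assms \<sigma>_pos by auto

text \<open>Wick's formula: the three summands are the three ways to pair the four factors.\<close>

lemma entry_product_four:
  assumes ab: "a < d" "b < d" and ij: "i < p" "j < p"
  shows "integrable \<mu> (\<lambda>V. V (a, i) * V (b, i) * (V (a, j) * V (b, j)))"
    and "(\<integral>V. V (a, i) * V (b, i) * (V (a, j) * V (b, j)) \<partial>\<mu>)
      = \<sigma> ^ 4 * (of_bool (a = b) + of_bool (i = j) + of_bool (a = b) * of_bool (i = j))"
proof -
  let ?I = "{..<d} \<times> {..<p}"
  have goal: "integrable \<mu> (\<lambda>V. V (a, i) * V (b, i) * (V (a, j) * V (b, j))) \<and>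
    (\<integral>V. V (a, i) * V (b, i) * (V (a, j) * V (b, j)) \<partial>\<mu>)
      = \<sigma> ^ 4 * (of_bool (a = b) + of_bool (i = j) + of_bool (a = b) * of_bool (i = j))"
  proof -
    consider "a = b" "i = j" | "a = b" "i \<noteq> j" | "a \<noteq> b" "i = j" | "a \<noteq> b" "i \<noteq> j" by blast
    then show ?thesis
    proof cases
      case 1
      have "V (a, i) * V (b, i) * (V (a, j) * V (b, j)) = V (a, i) ^ 4" for V :: "nat \<times> nat \<Rightarrow> real"
        using 1 by (simp add: power4_eq_xxxx)
      then show ?thesis
        using 1 gaussPi_power[of ?I \<sigma> "(a, i)" 4] gauss_power(5)[OF \<sigma>_pos] ab ij \<sigma>_pos by simp
    next
      case 2
      let ?K = "{(a, i), (a, j)}"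
      have "V (a, i) * V (b, i) * (V (a, j) * V (b, j)) = (\<Prod>k\<in>?K. V k ^ 2)" for V :: "nat \<times> nat \<Rightarrow> real"
        using 2 by (simp add: power2_eq_square)
      moreover have "(\<Prod>k\<in>?K. \<integral>x. x ^ 2 \<partial>gauss \<sigma>) = \<sigma> ^ 4"
        using 2 gauss_power(4)[OF \<sigma>_pos] by (simp add: power4_eq_xxxx power2_eq_square)
      ultimately show ?thesis
        using 2 gaussPi_monomial_subset[of ?I \<sigma> ?K "\<lambda>_. 2"] ab ij \<sigma>_pos by simp
    next
      case 3
      let ?K = "{(a, i), (b, i)}"
      have "V (a, i) * V (b, i) * (V (a, j) * V (b, j)) = (\<Prod>k\<in>?K. V k ^ 2)" for V :: "nat \<times> nat \<Rightarrow> real"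
        using 3 by (simp add: power2_eq_square)
      moreover have "(\<Prod>k\<in>?K. \<integral>x. x ^ 2 \<partial>gauss \<sigma>) = \<sigma> ^ 4"
        using 3 gauss_power(4)[OF \<sigma>_pos] by (simp add: power4_eq_xxxx power2_eq_square)
      ultimately show ?thesis
        using 3 gaussPi_monomial_subset[of ?I \<sigma> ?K "\<lambda>_. 2"] ab ij \<sigma>_pos by simp
    next
      case 4
      let ?K = "{(a, i), (b, i), (a, j), (b, j)}"
      have "V (a, i) * V (b, i) * (V (a, j) * V (b, j)) = (\<Prod>k\<in>?K. V k ^ 1)" for V :: "nat \<times> nat \<Rightarrow> real"
        using 4 by simp
      moreover have "(\<Prod>k\<in>?K. \<integral>x. x ^ 1 \<partial>gauss \<sigma>) = 0"
        using gauss_power(3)[OF \<sigma>_pos] by (simp add: card_gt_0_iff)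
      ultimately show ?thesis
        using 4 gaussPi_monomial_subset[of ?I \<sigma> ?K "\<lambda>_. 1"] ab ij \<sigma>_pos by (simp add: mult.assoc)
    qed
  qed
  show "integrable \<mu> (\<lambda>V. V (a, i) * V (b, i) * (V (a, j) * V (b, j)))"
    and "(\<integral>V. V (a, i) * V (b, i) * (V (a, j) * V (b, j)) \<partial>\<mu>)
      = \<sigma> ^ 4 * (of_bool (a = b) + of_bool (i = j) + of_bool (a = b) * of_bool (i = j))"
    using goal by blast+
qed

lemma frob_moment:
  "integrable \<mu> (\<lambda>V. \<Sum>a<d. \<Sum>l<p. (V (a, l))\<^sup>2)"
  "(\<integral>V. (\<Sum>a<d. \<Sum>l<p. (V (a, l))\<^sup>2) \<partial>\<mu>) = real d * real p * \<sigma>\<^sup>2"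
proof -
  show "integrable \<mu> (\<lambda>V. \<Sum>a<d. \<Sum>l<p. (V (a, l))\<^sup>2)"
    by (intro Bochner_Integration.integrable_sum entry_square) auto
  have "(\<integral>V. (\<Sum>a<d. \<Sum>l<p. (V (a, l))\<^sup>2) \<partial>\<mu>) = (\<Sum>a<d. \<Sum>l<p. \<integral>V. (V (a, l))\<^sup>2 \<partial>\<mu>)"
    by (subst Bochner_Integration.integral_sum; (intro Bochner_Integration.integrable_sum entry_square)?)
      (auto intro!: sum.cong Bochner_Integration.integral_sum entry_square)
  also have "\<dots> = (\<Sum>a<d. \<Sum>l<p. \<sigma>\<^sup>2)" by (intro sum.cong refl entry_square) auto
  finally show "(\<integral>V. (\<Sum>a<d. \<Sum>l<p. (V (a, l))\<^sup>2) \<partial>\<mu>) = real d * real p * \<sigma>\<^sup>2" by simp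
qed

text \<open>This is the mean trace of the square of \<open>V V\<^sup>T\<close>. The leading term is
  the value for \<open>V V\<^sup>T\<close> equal to \<open>p \<sigma>\<^sup>2\<close> times the
  identity; the rest is of lower order in \<open>p\<close>.\<close>

lemma gram_moment:
  "integrable \<mu> (\<lambda>V. \<Sum>a<d. \<Sum>b<d. (\<Sum>l<p. V (a, l) * V (b, l))\<^sup>2)"
  "(\<integral>V. (\<Sum>a<d. \<Sum>b<d. (\<Sum>l<p. V (a, l) * V (b, l))\<^sup>2) \<partial>\<mu>)
    = \<sigma> ^ 4 * (real d * (real p)\<^sup>2 + real d * (real d + 1) * real p)"
proof -
  have expand: "(\<Sum>a<d. \<Sum>b<d. (\<Sum>l<p. V (a, l) * V (b, l))\<^sup>2)
      = (\<Sum>(a, b, i, j)\<in>{..<d} \<times> {..<d} \<times> {..<p} \<times> {..<p}. V (a, i) * V (b, i) * (V (a, j) * V (b, j)))"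
    for V :: "nat \<times> nat \<Rightarrow> real"
    by (simp add: power2_eq_square sum_product sum.cartesian_product[symmetric])
  show "integrable \<mu> (\<lambda>V. \<Sum>a<d. \<Sum>b<d. (\<Sum>l<p. V (a, l) * V (b, l))\<^sup>2)"
    unfolding expand by (rule Bochner_Integration.integrable_sum) (auto intro: entry_product_four)
  have "(\<integral>V. (\<Sum>a<d. \<Sum>b<d. (\<Sum>l<p. V (a, l) * V (b, l))\<^sup>2) \<partial>\<mu>)
      = (\<Sum>(a, b, i, j)\<in>{..<d} \<times> {..<d} \<times> {..<p} \<times> {..<p}.
          \<sigma> ^ 4 * (of_bool (a = b) + of_bool (i = j) + of_bool (a = b) * of_bool (i = j)))"
    unfolding expand
    by (subst Bochner_Integration.integral_sum)
      (auto intro!: sum.cong simp: entry_product_four)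
  also have "\<dots> = (\<Sum>a<d. \<Sum>b<d. \<Sum>i<p. \<Sum>j<p.
      \<sigma> ^ 4 * (of_bool (a = b) + of_bool (i = j) + of_bool (a = b) * of_bool (i = j)))"
    by (simp add: sum.cartesian_product[symmetric])
  also have "\<dots> = \<sigma> ^ 4 * (real d * (real p)\<^sup>2 + real d * (real d + 1) * real p)"
  proof -
    have diag: "(\<Sum>i<n. \<Sum>j<n. of_bool (i = j)) = real n" for n :: nat
      by (simp add: of_bool_def)
    have inner: "(\<Sum>i<p. \<Sum>j<p. x + of_bool (i = j) + x * of_bool (i = j)) = x * (real p)\<^sup>2 + (1 + x) * real p" for x :: real
    proof -
      have "(\<Sum>i<p. \<Sum>j<p. x + of_bool (i = j) + x * of_bool (i = j))
          = (\<Sum>i<p. \<Sum>j<p. x + (1 + x) * of_bool (i = j))"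
        by (simp add: algebra_simps)
      also have "\<dots> = x * (real p)\<^sup>2 + (1 + x) * (\<Sum>i<p. \<Sum>j<p. of_bool (i = j))"
        unfolding sum.distrib sum_distrib_left[symmetric] by (simp add: power2_eq_square)
      finally show ?thesis by (simp only: diag)
    qed
    have "(\<Sum>a<d. \<Sum>b<d. of_bool (a = b) * (real p)\<^sup>2 + (1 + of_bool (a = b)) * real p)
        = (\<Sum>a<d. \<Sum>b<d. real p + ((real p)\<^sup>2 + real p) * of_bool (a = b))"
      by (simp add: algebra_simps)
    also have "\<dots> = (real d)\<^sup>2 * real p + ((real p)\<^sup>2 + real p) * (\<Sum>a<d. \<Sum>b<d. of_bool (a = b))"
      unfolding sum.distrib sum_distrib_left[symmetric] by (simp add: power2_eq_square)
    finally have "(\<Sum>a<d. \<Sum>b<d. of_bool (a = b) * (real p)\<^sup>2 + (1 + of_bool (a = b)) * real p)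
        = real d * (real p)\<^sup>2 + real d * (real d + 1) * real p"
      unfolding diag by (simp add: power2_eq_square algebra_simps)
    then show ?thesis unfolding sum_distrib_left[symmetric] inner by simp
  qed
  finally show "(\<integral>V. (\<Sum>a<d. \<Sum>b<d. (\<Sum>l<p. V (a, l) * V (b, l))\<^sup>2) \<partial>\<mu>)
    = \<sigma> ^ 4 * (real d * (real p)\<^sup>2 + real d * (real d + 1) * real p)" .
qed

text \<open>The minorant of \<open>polar_factor\<close> is taken at
  \<open>t = \<sigma> * sqrt p\<close>, the typical singular value, where the leading terms combine
  as 3/2 - 1/2 = 1. The term with \<open>e\<close> pays for a net of mesh \<open>e\<close>; squares
  replace absolute values there so that no further moment is required.\<close>

lemma pairing_lower_moment:
  fixes e :: real
  defines "\<psi> \<equiv> \<lambda>V. 3 / 2 * (\<Sum>a<d. \<Sum>l<p. (V (a, l))\<^sup>2) / (\<sigma> * sqrt p)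
      - 1 / 2 * (\<Sum>a<d. \<Sum>b<d. (\<Sum>l<p. V (a, l) * V (b, l))\<^sup>2) / (\<sigma> * sqrt p) ^ 3
      - e * (real d * real p + (\<Sum>a<d. \<Sum>l<p. (V (a, l))\<^sup>2))"
  shows "integrable \<mu> \<psi>"
    and "(\<integral>V. \<psi> V \<partial>\<mu>) = \<sigma> * sqrt p * real d * (1 - (real d + 1) / (2 * real p))
      - e * (real d * real p * (1 + \<sigma>\<^sup>2))"
proof -
  interpret product_prob_space "\<lambda>_. gauss \<sigma>" "{..<d} \<times> {..<p}"
    by (rule product_prob_space_gauss[OF \<sigma>_pos])
  have p: "real p > 0" using d_less_p by simp
  note int = frob_moment(1) gram_moment(1)
  show "integrable \<mu> \<psi>"
    unfolding \<psi>_def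
    by (intro Bochner_Integration.integrable_diff Bochner_Integration.integrable_add
        integrable_divide integrable_mult_right integrable_const int)
  define s where "s = sqrt p"
  have s: "s > 0" "s * s = real p" using p by (auto simp: s_def)
  have "(\<integral>V. \<psi> V \<partial>\<mu>) = 3 / 2 * (real d * real p * \<sigma>\<^sup>2) / (\<sigma> * s)
      - 1 / 2 * (\<sigma> ^ 4 * (real d * (real p)\<^sup>2 + real d * (real d + 1) * real p)) / (\<sigma> * s) ^ 3
      - e * (real d * real p + real d * real p * \<sigma>\<^sup>2)"
    unfolding \<psi>_def s_def
    by (simp add: Bochner_Integration.integral_diff Bochner_Integration.integral_add int
        frob_moment(2) gram_moment(2) P.prob_space)
  also have "\<dots> = \<sigma> * s * real d * (1 - (real d + 1) / (2 * real p)) - e * (real d * real p * (1 + \<sigma>\<^sup>2))"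
    using s \<sigma>_pos p unfolding s(2)[symmetric]
    by (simp add: field_simps power2_eq_square power3_eq_cube power4_eq_xxxx)
  finally show "(\<integral>V. \<psi> V \<partial>\<mu>) = \<sigma> * sqrt p * real d * (1 - (real d + 1) / (2 * real p))
      - e * (real d * real p * (1 + \<sigma>\<^sup>2))" by (simp add: s_def)
qed

end


section \<open>The cost matrix and its two values\<close>

definition gram_cost :: "nat \<Rightarrow> nat \<Rightarrow> nat \<Rightarrow> (nat \<Rightarrow> nat \<times> nat \<Rightarrow> real) \<Rightarrow> real Matrix.mat" where
  "gram_cost d n p A = Matrix.mat (d * n) (d * n)
     (\<lambda>(r, s). \<Sum>l<p. A (r div d) (r mod d, l) * A (s div d) (s mod d, l))"

lemma gram_cost_carrier: "gram_cost d n p A \<in> carrier_mat (d * n) (d * n)"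
  by (simp add: gram_cost_def)

lemma gram_cost_symmetric: "transpose_mat (gram_cost d n p A) = gram_cost d n p A"
  by (intro eq_matI) (auto simp: gram_cost_def mult.commute)

lemma gram_cost_psd:
  assumes "v \<in> carrier_vec (d * n)"
  shows "scalar_prod v (gram_cost d n p A *\<^sub>v v) \<ge> 0"
proof -
  define f where "f r l = A (r div d) (r mod d, l)" for r l
  have "scalar_prod v (gram_cost d n p A *\<^sub>v v)
      = (\<Sum>r<d * n. vec_index v r * (\<Sum>s<d * n. (\<Sum>l<p. f r l * f s l) * vec_index v s))"
    using assms by (simp add: gram_cost_def f_def scalar_prod_def atLeast0LessThan)
  also have "\<dots> = (\<Sum>r<d * n. \<Sum>s<d * n. \<Sum>l<p. (vec_index v r * f r l) * (vec_index v s * f s l))"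
    by (simp add: sum_distrib_left sum_distrib_right mult_ac)
  also have "\<dots> = (\<Sum>r<d * n. \<Sum>l<p. \<Sum>s<d * n. (vec_index v r * f r l) * (vec_index v s * f s l))"
    by (rule sum.cong[OF refl], rule sum.swap)
  also have "\<dots> = (\<Sum>l<p. \<Sum>r<d * n. \<Sum>s<d * n. (vec_index v r * f r l) * (vec_index v s * f s l))"
    by (rule sum.swap)
  also have "\<dots> = (\<Sum>l<p. (\<Sum>r<d * n. vec_index v r * f r l)\<^sup>2)"
    by (simp add: power2_eq_square sum_product)
  also have "\<dots> \<ge> 0" by (simp add: sum_nonneg)
  finally show ?thesis .
qed

lemma gram_cost_block:
  assumes "i < n" "j < n" "a < d" "b < d"
  shows "gram_cost d n p A $$ (i * d + a, j * d + b) = (\<Sum>l<p. A i (a, l) * A j (b, l))"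
proof -
  have bound: "i * d + a < d * n" if "i < n" "a < d" for i a
  proof -
    have "i * d + a < Suc i * d" using that by simp
    also have "\<dots> \<le> n * d" using that by (intro mult_le_mono1) simp
    finally show ?thesis by (simp add: mult.commute)
  qed
  show ?thesis using assms bound by (simp add: gram_cost_def)
qed

text \<open>The number \<open>q\<close> of columns is left open: it is \<open>d\<close> for
  orthogonal matrices and \<open>d * n\<close> for the relaxation.\<close>

lemma objective_gram_cost:
  assumes X: "\<And>i. i < n \<Longrightarrow> X i \<in> carrier_mat d q"
  shows "objective (gram_cost d n p A) d n X
    = (\<Sum>l<p. \<Sum>c<q. (\<Sum>i<n. \<Sum>a<d. A i (a, l) * X i $$ (a, c))\<^sup>2)"
proof -
  define S where "S i l c = (\<Sum>a<d. A i (a, l) * X i $$ (a, c))" for i l c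
  have tr: "mtrace (transpose_mat (blk (gram_cost d n p A) d i j) * (X i * transpose_mat (X j)))
      = (\<Sum>l<p. \<Sum>c<q. S i l c * S j l c)" if ij: "i < n" "j < n" for i j
  proof -
    have "mtrace (transpose_mat (blk (gram_cost d n p A) d i j) * (X i * transpose_mat (X j)))
        = (\<Sum>b<d. \<Sum>a<d. (\<Sum>l<p. A i (a, l) * A j (b, l)) * (\<Sum>c<q. X i $$ (a, c) * X j $$ (b, c)))"
      using X[OF ij(1)] X[OF ij(2)] ij
      by (simp add: mtrace_def blk_def scalar_prod_def atLeast0LessThan gram_cost_block)
    also have "\<dots> = (\<Sum>b<d. \<Sum>a<d. \<Sum>l<p. \<Sum>c<q. (A i (a, l) * X i $$ (a, c)) * (A j (b, l) * X j $$ (b, c)))"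
      by (simp add: sum_product mult_ac)
    also have "\<dots> = (\<Sum>b<d. \<Sum>l<p. \<Sum>c<q. \<Sum>a<d. (A i (a, l) * X i $$ (a, c)) * (A j (b, l) * X j $$ (b, c)))"
      by (rule sum.cong[OF refl], subst sum.swap, rule sum.cong[OF refl], rule sum.swap)
    also have "\<dots> = (\<Sum>l<p. \<Sum>c<q. \<Sum>b<d. \<Sum>a<d. (A i (a, l) * X i $$ (a, c)) * (A j (b, l) * X j $$ (b, c)))"
      by (subst sum.swap, rule sum.cong[OF refl], rule sum.swap)
    also have "\<dots> = (\<Sum>l<p. \<Sum>c<q. S i l c * S j l c)"
      unfolding S_def sum_product by (rule sum.cong[OF refl], rule sum.cong[OF refl], rule sum.swap)
    finally show ?thesis .
  qed
  have "objective (gram_cost d n p A) d n X = (\<Sum>i<n. \<Sum>j<n. \<Sum>l<p. \<Sum>c<q. S i l c * S j l c)"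
    unfolding objective_def by (intro sum.cong refl tr) auto
  also have "\<dots> = (\<Sum>i<n. \<Sum>l<p. \<Sum>c<q. \<Sum>j<n. S i l c * S j l c)"
    by (rule sum.cong[OF refl], subst sum.swap, rule sum.cong[OF refl], rule sum.swap)
  also have "\<dots> = (\<Sum>l<p. \<Sum>c<q. \<Sum>i<n. \<Sum>j<n. S i l c * S j l c)"
    by (subst sum.swap, rule sum.cong[OF refl], rule sum.swap)
  also have "\<dots> = (\<Sum>l<p. \<Sum>c<q. (\<Sum>i<n. S i l c)\<^sup>2)"
    by (simp add: power2_eq_square sum_product)
  finally show ?thesis by (simp add: S_def)
qed

text \<open>A real supremum dominates its members only when it is bounded above. Orthonormal rows
  have entries of modulus at most 1, which gives the bound.\<close>

lemma relax_val_gram_cost_ge: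
  assumes X: "\<And>i. i < n \<Longrightarrow> X i \<in> carrier_mat d (d * n)" "\<And>i. i < n \<Longrightarrow> X i * transpose_mat (X i) = 1\<^sub>m d"
  shows "objective (gram_cost d n p A) d n X \<le> relax_val (gram_cost d n p A) d n"
  unfolding relax_val_def
proof (rule cSUP_upper)
  show "X \<in> {X. \<forall>i<n. X i \<in> carrier_mat d (d * n) \<and> X i * transpose_mat (X i) = 1\<^sub>m d}"
    using X by auto
  show "bdd_above (objective (gram_cost d n p A) d n `
      {X. \<forall>i<n. X i \<in> carrier_mat d (d * n) \<and> X i * transpose_mat (X i) = 1\<^sub>m d})"
  proof (rule bdd_aboveI2)
    fix Z :: "nat \<Rightarrow> real Matrix.mat"
    assume "Z \<in> {X. \<forall>i<n. X i \<in> carrier_mat d (d * n) \<and> X i * transpose_mat (X i) = 1\<^sub>m d}"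
    then have Z: "\<And>i. i < n \<Longrightarrow> Z i \<in> carrier_mat d (d * n)"
      and ZZ: "\<And>i. i < n \<Longrightarrow> Z i * transpose_mat (Z i) = 1\<^sub>m d" by auto
    have entry: "\<bar>Z i $$ (a, c)\<bar> \<le> 1" if "i < n" "a < d" "c < d * n" for i a c
    proof -
      have "(Z i * transpose_mat (Z i)) $$ (a, a) = 1" using ZZ that by simp
      then have "(\<Sum>c<d * n. (Z i $$ (a, c))\<^sup>2) = 1"
        using Z[OF that(1)] that by (simp add: scalar_prod_def atLeast0LessThan power2_eq_square)
      moreover have "(Z i $$ (a, c))\<^sup>2 \<le> (\<Sum>c<d * n. (Z i $$ (a, c))\<^sup>2)"
        by (rule member_le_sum) (use that in auto)
      ultimately show ?thesis by (simp add: abs_square_le_1)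
    qed
    have bound: "(\<Sum>i<n. \<Sum>a<d. A i (a, l) * Z i $$ (a, c))\<^sup>2 \<le> (\<Sum>i<n. \<Sum>a<d. \<bar>A i (a, l)\<bar>)\<^sup>2" if "c < d * n" for l c
    proof (rule abs_le_square_iff[THEN iffD1])
      have "\<bar>\<Sum>i<n. \<Sum>a<d. A i (a, l) * Z i $$ (a, c)\<bar> \<le> (\<Sum>i<n. \<Sum>a<d. \<bar>A i (a, l) * Z i $$ (a, c)\<bar>)"
        by (rule order_trans[OF sum_abs], rule sum_mono, rule sum_abs)
      also have "\<dots> \<le> (\<Sum>i<n. \<Sum>a<d. \<bar>A i (a, l)\<bar>)"
      proof (intro sum_mono)
        fix i a assume "i \<in> {..<n}" "a \<in> {..<d}"
        then have "\<bar>A i (a, l)\<bar> * \<bar>Z i $$ (a, c)\<bar> \<le> \<bar>A i (a, l)\<bar> * 1"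
          using that by (intro mult_left_mono entry) auto
        then show "\<bar>A i (a, l) * Z i $$ (a, c)\<bar> \<le> \<bar>A i (a, l)\<bar>" by (simp add: abs_mult)
      qed
      also have "\<dots> \<le> \<bar>\<Sum>i<n. \<Sum>a<d. \<bar>A i (a, l)\<bar>\<bar>" by (rule abs_ge_self)
      finally show "\<bar>\<Sum>i<n. \<Sum>a<d. A i (a, l) * Z i $$ (a, c)\<bar> \<le> \<bar>\<Sum>i<n. \<Sum>a<d. \<bar>A i (a, l)\<bar>\<bar>" .
    qed
    have "objective (gram_cost d n p A) d n Z
        = (\<Sum>l<p. \<Sum>c<d * n. (\<Sum>i<n. \<Sum>a<d. A i (a, l) * Z i $$ (a, c))\<^sup>2)"
      by (rule objective_gram_cost) (rule Z)
    also have "\<dots> \<le> (\<Sum>l<p. \<Sum>c<d * n. (\<Sum>i<n. \<Sum>a<d. \<bar>A i (a, l)\<bar>)\<^sup>2)"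
      by (rule sum_mono, rule sum_mono, rule bound) simp
    finally show "objective (gram_cost d n p A) d n Z \<le> (\<Sum>l<p. \<Sum>c<d * n. (\<Sum>i<n. \<Sum>a<d. \<bar>A i (a, l)\<bar>)\<^sup>2)" .
  qed
qed

section \<open>The cells and the bounds on both values\<close>

text \<open>Ties go to the smallest index, so exactly one \<open>k < n\<close> receives 1 when
  \<open>n > 0\<close>. The values are real so that they can multiply integrands.\<close>

definition first_argmax :: "nat \<Rightarrow> (nat \<Rightarrow> real) \<Rightarrow> nat \<Rightarrow> real" where
  "first_argmax n f k = (if \<forall>j<n. f j \<le> f k \<and> (j < k \<longrightarrow> f j < f k) then 1 else 0)"

lemma first_argmax_indicator:
  assumes "n > 0"
  shows "\<exists>m<n. (\<forall>j<n. f j \<le> f m) \<and> (\<forall>k<n. first_argmax n f k = of_bool (k = m))"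
proof -
  define Q where "Q k \<longleftrightarrow> k < n \<and> (\<forall>j<n. f j \<le> f k)" for k
  have "\<exists>k. Q k"
  proof -
    have "Max (f ` {..<n}) \<in> f ` {..<n}" by (rule Max_in) (use assms in auto)
    then obtain k where "k < n" "f k = Max (f ` {..<n})" by auto
    then show ?thesis by (intro exI[of _ k]) (auto simp: Q_def)
  qed
  define m where "m = (LEAST k. Q k)"
  have m: "Q m" unfolding m_def by (rule LeastI_ex) fact
  have least: "\<not> Q k" if "k < m" for k using that unfolding m_def by (rule not_less_Least)
  have strict: "f j < f m" if "j < m" for j
  proof (rule ccontr)
    assume "\<not> f j < f m"
    then have "Q j" using m that unfolding Q_def by force
    then show False using least[OF that] by simp
  qed
  show ?thesis
  proof (intro exI[of _ m] conjI allI impI)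
    show "m < n" using m by (simp add: Q_def)
    show "f j \<le> f m" if "j < n" for j using m that by (simp add: Q_def)
    show "first_argmax n f k = of_bool (k = m)" if k: "k < n" for k
    proof (cases "k = m")
      case True
      then show ?thesis using m strict by (auto simp: first_argmax_def Q_def)
    next
      case False
      have "\<not> (\<forall>j<n. f j \<le> f k \<and> (j < k \<longrightarrow> f j < f k))"
      proof
        assume H: "\<forall>j<n. f j \<le> f k \<and> (j < k \<longrightarrow> f j < f k)"
        then have "f m \<le> f k" "m < k \<longrightarrow> f m < f k" using m by (auto simp: Q_def)
        moreover have "f k \<le> f m" using m k by (auto simp: Q_def)
        ultimately have "k < m" using False by force
        then show False using strict \<open>f m \<le> f k\<close> by force
      qed
      then show ?thesis using False by (simp add: first_argmax_def)
    qed
  qed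
qed

lemma sum_of_bool_mult:
  fixes h :: "nat \<Rightarrow> real"
  assumes "m < n" "\<And>k. k < n \<Longrightarrow> w k = of_bool (k = m)"
  shows "(\<Sum>k<n. w k * h k) = h m"
proof -
  have "(\<Sum>k<n. w k * h k) = (\<Sum>k<n. if k = m then h k else 0)"
    by (rule sum.cong) (auto simp: assms(2))
  then show ?thesis using assms(1) by simp
qed

text \<open>\<open>Y\<close> is arbitrary here, which suffices for the upper bound; orthonormality
  of its rows enters in \<open>relax_val_ge\<close>.\<close>

locale gaussian_cells = gaussian_matrix +
  fixes n :: nat and Y :: "nat \<Rightarrow> nat \<times> nat \<Rightarrow> real"
  assumes n_pos: "n > 0"
begin

definition score :: "(nat \<times> nat \<Rightarrow> real) \<Rightarrow> nat \<Rightarrow> real" where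
  "score V k = (\<Sum>a<d. \<Sum>l<p. V (a, l) * Y k (a, l))"

definition cell :: "nat \<Rightarrow> (nat \<times> nat \<Rightarrow> real) \<Rightarrow> real" where
  "cell k V = first_argmax n (score V) k"

definition A :: "nat \<Rightarrow> nat \<times> nat \<Rightarrow> real" where
  "A k al = (\<integral>V. cell k V * V al \<partial>\<mu>)"

abbreviation "C \<equiv> gram_cost d n p A"

lemma score_integrable: "integrable \<mu> (\<lambda>V. score V k)"
  unfolding score_def
  by (intro Bochner_Integration.integrable_sum integrable_mult_left entry_integrable) auto

lemma cell_measurable: "cell k \<in> borel_measurable \<mu>"
proof -
  have m: "(\<lambda>V. score V k) \<in> borel_measurable \<mu>" for k using score_integrable by auto
  have "Measurable.pred \<mu> (\<lambda>V. score V j \<le> score V k \<and> (j < k \<longrightarrow> score V j < score V k))" for j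
  proof -
    have "Measurable.pred \<mu> (\<lambda>V. score V j \<le> score V k)" "Measurable.pred \<mu> (\<lambda>V. score V j < score V k)"
      unfolding pred_def by (rule borel_measurable_le borel_measurable_less; rule m)+
    then show ?thesis by (cases "j < k") (auto intro: pred_intros_logic)
  qed
  then have "Measurable.pred \<mu> (\<lambda>V. \<forall>j\<in>{..<n}. score V j \<le> score V k \<and> (j < k \<longrightarrow> score V j < score V k))"
    by (intro pred_intros_finite(3)) auto
  then have "(\<lambda>V. if \<forall>j\<in>{..<n}. score V j \<le> score V k \<and> (j < k \<longrightarrow> score V j < score V k) then 1 else 0 :: real)
      \<in> borel_measurable \<mu>"
    unfolding pred_def by - (rule measurable_If, simp_all)
  moreover have "cell k = (\<lambda>V. if \<forall>j\<in>{..<n}. score V j \<le> score V k \<and> (j < k \<longrightarrow> score V j < score V k) then 1 else 0)"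
    unfolding cell_def first_argmax_def Ball_def lessThan_iff ..
  ultimately show ?thesis by (simp only:)
qed

lemma cell_indicator:
  "\<exists>m<n. (\<forall>j<n. score V j \<le> score V m) \<and> (\<forall>k<n. cell k V = of_bool (k = m))"
  unfolding cell_def by (rule first_argmax_indicator[OF n_pos])

lemma cell_mult_integrable:
  assumes "integrable \<mu> f"
  shows "integrable \<mu> (\<lambda>V. cell k V * f V)"
proof (rule Bochner_Integration.integrable_bound[OF assms])
  show "(\<lambda>V. cell k V * f V) \<in> borel_measurable \<mu>"
    using cell_measurable assms by (intro borel_measurable_times) auto
  show "AE V in \<mu>. norm (cell k V * f V) \<le> norm (f V)"
    by (auto simp: cell_def first_argmax_def)
qed

text \<open>Every linear functional of the family \<open>A\<close> is the mean of a functional of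
  \<open>V\<close> whose coefficients depend on the cell of \<open>V\<close>. Both bounds start from
  this.\<close>

lemma A_linear:
  "(\<Sum>i<n. \<Sum>a<d. \<Sum>l<p. A i (a, l) * h i a l)
    = (\<integral>V. (\<Sum>i<n. cell i V * (\<Sum>a<d. \<Sum>l<p. V (a, l) * h i a l)) \<partial>\<mu>)"
proof -
  have int: "integrable \<mu> (\<lambda>V. cell i V * V (a, l) * h i a l)" if "a < d" "l < p" for i a l
    by (intro integrable_mult_left cell_mult_integrable entry_integrable that)
  have "(\<integral>V. (\<Sum>i<n. cell i V * (\<Sum>a<d. \<Sum>l<p. V (a, l) * h i a l)) \<partial>\<mu>)
      = (\<integral>V. (\<Sum>(i, a, l)\<in>{..<n} \<times> {..<d} \<times> {..<p}. cell i V * V (a, l) * h i a l) \<partial>\<mu>)"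
    by (simp add: sum.cartesian_product[symmetric] sum_distrib_left mult.assoc)
  also have "\<dots> = (\<Sum>(i, a, l)\<in>{..<n} \<times> {..<d} \<times> {..<p}. \<integral>V. cell i V * V (a, l) * h i a l \<partial>\<mu>)"
    by (subst Bochner_Integration.integral_sum) (auto intro: int intro!: sum.cong)
  also have "\<dots> = (\<Sum>(i, a, l)\<in>{..<n} \<times> {..<d} \<times> {..<p}. A i (a, l) * h i a l)"
    by (rule sum.cong) (auto simp: A_def)
  finally show ?thesis by (simp add: sum.cartesian_product[symmetric])
qed

lemma orth_objective_le:
  assumes Q: "\<And>i. i < n \<Longrightarrow> Q i \<in> orth_group d"
  shows "objective C d n Q \<le> square_mean\<^sup>2 / real d"
proof -
  define M where "M l c = (\<Sum>i<n. \<Sum>a<d. A i (a, l) * Q i $$ (a, c))" for l c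
  have obj: "objective C d n Q = frob d p M"
    unfolding frob_def M_def by (rule objective_gram_cost) (use Q in \<open>auto simp: orth_group_def\<close>)
  \<comment> \<open>One copy of \<open>M\<close> is expanded and the other kept as a coefficient;
    the square becomes linear in \<open>A\<close>.\<close>
  have "frob d p M = (\<Sum>l<p. \<Sum>c<d. M l c * (\<Sum>i<n. \<Sum>a<d. A i (a, l) * Q i $$ (a, c)))"
    by (simp add: frob_def power2_eq_square M_def)
  also have "\<dots> = (\<Sum>l<p. \<Sum>c<d. \<Sum>i<n. \<Sum>a<d. A i (a, l) * (M l c * Q i $$ (a, c)))"
    by (simp add: sum_distrib_left mult_ac)
  also have "\<dots> = (\<Sum>l<p. \<Sum>i<n. \<Sum>a<d. \<Sum>c<d. A i (a, l) * (M l c * Q i $$ (a, c)))"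
    by (rule sum.cong[OF refl], subst sum.swap, rule sum.cong[OF refl], rule sum.swap)
  also have "\<dots> = (\<Sum>i<n. \<Sum>a<d. \<Sum>l<p. \<Sum>c<d. A i (a, l) * (M l c * Q i $$ (a, c)))"
    by (subst sum.swap, rule sum.cong[OF refl], rule sum.swap)
  also have "\<dots> = (\<Sum>i<n. \<Sum>a<d. \<Sum>l<p. A i (a, l) * (\<Sum>c<d. M l c * Q i $$ (a, c)))"
    by (simp only: sum_distrib_left)
  also have "\<dots> = (\<integral>V. (\<Sum>i<n. cell i V * (\<Sum>a<d. \<Sum>l<p. V (a, l) * (\<Sum>c<d. M l c * Q i $$ (a, c)))) \<partial>\<mu>)"
    by (rule A_linear)
  also have "\<dots> \<le> mean_nuc M"
    unfolding mean_nuc_def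
  proof (rule integral_mono)
    show "integrable \<mu> (\<lambda>V. \<Sum>i<n. cell i V * (\<Sum>a<d. \<Sum>l<p. V (a, l) * (\<Sum>c<d. M l c * Q i $$ (a, c))))"
      by (intro Bochner_Integration.integrable_sum cell_mult_integrable integrable_mult_left entry_integrable) auto
    show "integrable \<mu> (\<lambda>V. sv_sum d (right_mult p V M))"
      by (intro sv_sum_integrable right_mult_integrable)
    fix V :: "nat \<times> nat \<Rightarrow> real"
    obtain m where m: "m < n" "\<forall>k<n. cell k V = of_bool (k = m)"
      using cell_indicator by blast
    have "(\<Sum>i<n. cell i V * (\<Sum>a<d. \<Sum>l<p. V (a, l) * (\<Sum>c<d. M l c * Q i $$ (a, c))))
        = (\<Sum>a<d. \<Sum>l<p. V (a, l) * (\<Sum>c<d. M l c * Q m $$ (a, c)))"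
      by (rule sum_of_bool_mult) (use m in auto)
    also have "\<dots> = (\<Sum>a<d. \<Sum>l<p. \<Sum>c<d. V (a, l) * M l c * Q m $$ (a, c))"
      by (simp add: sum_distrib_left mult.assoc)
    also have "\<dots> = (\<Sum>a<d. \<Sum>c<d. \<Sum>l<p. V (a, l) * M l c * Q m $$ (a, c))"
      by (rule sum.cong[OF refl], rule sum.swap)
    also have "\<dots> = (\<Sum>a<d. \<Sum>c<d. right_mult p V M (a, c) * (\<lambda>(a, b). Q m $$ (a, b)) (a, c))"
      by (simp add: right_mult_def sum_distrib_right)
    also have "\<dots> \<le> 1 * sv_sum d (right_mult p V M)"
      by (rule pairing_le_sv_sum[OF orth_group_op_bound[OF Q[OF m(1)]]]) simp
    finally show "(\<Sum>i<n. cell i V * (\<Sum>a<d. \<Sum>l<p. V (a, l) * (\<Sum>c<d. M l c * Q i $$ (a, c))))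
        \<le> sv_sum d (right_mult p V M)" by simp
  qed
  also have "\<dots> \<le> sqrt (frob d p M / real d) * square_mean" by (rule mean_nuc_le)
  finally have main: "frob d p M \<le> sqrt (frob d p M / real d) * square_mean" .
  have sm: "square_mean \<ge> 0" by (simp add: square_mean_def sv_sum_nonneg)
  \<comment> \<open>The inequality \<open>main\<close> bounds a square by a multiple of its root, so
    one factor \<open>x\<close> is cancelled; the case \<open>x = 0\<close> is separate.\<close>
  define x where "x = sqrt (frob d p M)"
  have x: "x \<ge> 0" "frob d p M = x\<^sup>2" by (auto simp: x_def frob_def sum_nonneg)
  have dpos: "real d > 0" using d_pos by simp
  have "x * x \<le> x * (square_mean / sqrt d)"
    using main x by (simp add: real_sqrt_divide power2_eq_square)
  then have "x \<le> square_mean / sqrt d"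
    using x(1) sm mult_left_le_imp_le[of x x "square_mean / sqrt d"] by (cases "x = 0") auto
  then have "x\<^sup>2 \<le> (square_mean / sqrt d)\<^sup>2" using x by (intro power_mono) auto
  then show ?thesis using dpos by (simp add: obj x(2) power_divide)
qed

lemma orth_val_le: "orth_val C d n \<le> square_mean\<^sup>2 / real d"
  unfolding orth_val_def
proof (rule cSUP_least)
  have "(\<lambda>_. 1\<^sub>m d) \<in> {Q. \<forall>i<n. Q i \<in> orth_group d}" by (auto simp: orth_group_def)
  then show "{Q. \<forall>i<n. Q i \<in> orth_group d} \<noteq> {}" by (rule ex_in_conv[THEN iffD1, OF exI])
  show "objective C d n Q \<le> square_mean\<^sup>2 / real d" if "Q \<in> {Q. \<forall>i<n. Q i \<in> orth_group d}" for Q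
    by (rule orth_objective_le) (use that in simp)
qed

text \<open>The objective at \<open>X = Y\<close> is bounded below through the trace of the matrix \<open>B\<close> whose squared
  Frobenius norm it is.\<close>

lemma relax_val_ge:
  assumes dim: "p + d \<le> d * n"
    and orth: "\<And>i a b. i < n \<Longrightarrow> a < d \<Longrightarrow> b < d \<Longrightarrow> (\<Sum>c<p + d. Y i (a, c) * Y i (b, c)) = (if a = b then 1 else 0)"
    and \<psi>: "integrable \<mu> \<psi>" and best: "\<And>V. \<exists>k<n. \<psi> V \<le> score V k" and nonneg: "0 \<le> (\<integral>V. \<psi> V \<partial>\<mu>)"
  shows "(\<integral>V. \<psi> V \<partial>\<mu>)\<^sup>2 / real p \<le> relax_val C d n"
proof -
  \<comment> \<open>Zero columns fill the width \<open>d * n\<close> prescribed by the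
    relaxation.\<close>
  define X where "X i = Matrix.mat d (d * n) (\<lambda>(a, c). if c < p + d then Y i (a, c) else 0)" for i
  have X: "X i \<in> carrier_mat d (d * n)" for i by (simp add: X_def)
  have XX: "X i * transpose_mat (X i) = 1\<^sub>m d" if i: "i < n" for i
  proof (rule eq_matI)
    fix a b assume "a < dim_row (1\<^sub>m d :: real Matrix.mat)" "b < dim_col (1\<^sub>m d :: real Matrix.mat)"
    then have ab: "a < d" "b < d" by auto
    have "(X i * transpose_mat (X i)) $$ (a, b)
        = (\<Sum>c<d * n. (if c < p + d then Y i (a, c) else 0) * (if c < p + d then Y i (b, c) else 0))"
      using ab by (simp add: X_def scalar_prod_def atLeast0LessThan)
    also have "\<dots> = (\<Sum>c<p + d. Y i (a, c) * Y i (b, c))"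
      by (rule sum.mono_neutral_cong_right) (use dim in auto)
    finally show "(X i * transpose_mat (X i)) $$ (a, b) = (1\<^sub>m d :: real Matrix.mat) $$ (a, b)"
      using ab orth[OF i] by simp
  qed (simp_all add: X_def)
  define B where "B l c = (\<Sum>i<n. \<Sum>a<d. A i (a, l) * X i $$ (a, c))" for l c
  have pdn: "p \<le> d * n" using dim by simp
  \<comment> \<open>The diagonal meets only the first \<open>p\<close> columns, exactly those seen
    by \<open>score\<close>; the other \<open>d\<close> columns of \<open>Y\<close> serve
    orthonormality only.\<close>
  have "(\<Sum>l<p. B l l) = (\<Sum>l<p. \<Sum>i<n. \<Sum>a<d. A i (a, l) * Y i (a, l))"
    unfolding B_def
  proof (intro sum.cong refl)
    fix l i a assume "l \<in> {..<p}" "i \<in> {..<n}" "a \<in> {..<d}"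
    then show "A i (a, l) * X i $$ (a, l) = A i (a, l) * Y i (a, l)" using pdn by (simp add: X_def)
  qed
  also have "\<dots> = (\<Sum>i<n. \<Sum>a<d. \<Sum>l<p. A i (a, l) * Y i (a, l))"
    by (subst sum.swap, rule sum.cong[OF refl], rule sum.swap)
  also have "\<dots> = (\<integral>V. (\<Sum>i<n. cell i V * score V i) \<partial>\<mu>)"
    unfolding score_def by (rule A_linear)
  also have "\<dots> \<ge> (\<integral>V. \<psi> V \<partial>\<mu>)"
  proof (rule integral_mono[OF \<psi>])
    show "integrable \<mu> (\<lambda>V. \<Sum>i<n. cell i V * score V i)"
      by (intro Bochner_Integration.integrable_sum cell_mult_integrable score_integrable)
    fix V
    obtain k where k: "k < n" "\<psi> V \<le> score V k" using best by blast
    obtain m where m: "m < n" "\<forall>j<n. score V j \<le> score V m"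
      "\<forall>k<n. cell k V = of_bool (k = m)"
      using cell_indicator by blast
    have "(\<Sum>i<n. cell i V * score V i) = score V m" by (rule sum_of_bool_mult) (use m in auto)
    then show "\<psi> V \<le> (\<Sum>i<n. cell i V * score V i)" using k m(2) by force
  qed
  finally have trace: "(\<integral>V. \<psi> V \<partial>\<mu>) \<le> (\<Sum>l<p. B l l)" .
  \<comment> \<open>The factors 1 prepare the Cauchy-Schwarz inequality, from which the division by
    \<open>p\<close> comes.\<close>
  have "(\<integral>V. \<psi> V \<partial>\<mu>)\<^sup>2 \<le> (\<Sum>l<p. 1 * B l l)\<^sup>2" using trace nonneg by (intro power_mono) auto
  also have "\<dots> \<le> (\<Sum>l<p. 1\<^sup>2) * (\<Sum>l<p. (B l l)\<^sup>2)" by (rule Cauchy_Schwarz_ineq_sum)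
  also have "\<dots> = real p * (\<Sum>l<p. (B l l)\<^sup>2)" by simp
  also have "(\<Sum>l<p. (B l l)\<^sup>2) \<le> (\<Sum>l<p. \<Sum>c<d * n. (B l c)\<^sup>2)"
  proof (rule sum_mono)
    fix l assume "l \<in> {..<p}"
    then show "(B l l)\<^sup>2 \<le> (\<Sum>c<d * n. (B l c)\<^sup>2)" using pdn by (intro member_le_sum) auto
  qed
  also have "(\<Sum>l<p. \<Sum>c<d * n. (B l c)\<^sup>2) = objective C d n X"
    unfolding B_def by (rule objective_gram_cost[symmetric]) (rule X)
  also have "objective C d n X \<le> relax_val C d n"
    by (rule relax_val_gram_cost_ge) (use X XX in auto)
  finally have "(\<integral>V. \<psi> V \<partial>\<mu>)\<^sup>2 \<le> real p * relax_val C d n" by (simp add: mult_left_mono)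
  then show ?thesis using d_less_p by (simp add: field_simps)
qed

end

section \<open>The net of orthonormal frames and the choice of parameters\<close>

context gaussian_matrix
begin

text \<open>Closeness is asked only in the first \<open>p\<close> columns, the ones that enter the
  score, while orthonormality holds for all \<open>p + d\<close> columns.\<close>

lemma stiefel_net:
  assumes m: "m > (0::nat)"
  obtains n Y where "n > 0" "p + d \<le> d * n"
    "\<And>i a b. i < n \<Longrightarrow> a < d \<Longrightarrow> b < d \<Longrightarrow> (\<Sum>c<p + d. Y i (a, c) * Y i (b, c)) = (if a = b then 1 else 0 :: real)"
    "\<And>X. (\<And>a b. a < d \<Longrightarrow> b < d \<Longrightarrow> (\<Sum>c<p + d. X (a, c) * X (b, c)) = (if a = b then 1 else 0 :: real)) \<Longrightarrow>
      \<exists>k<n. \<forall>a<d. \<forall>l<p. \<bar>X (a, l) - Y k (a, l)\<bar> \<le> 1 / real m"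
proof -
  define P :: "(nat \<times> nat \<Rightarrow> real) set"
    where "P = {X. \<forall>a<d. \<forall>b<d. (\<Sum>c<p + d. X (a, c) * X (b, c)) = (if a = b then 1 else 0)}"
  have bnd: "\<bar>X k\<bar> \<le> 1" if X: "X \<in> P" and k: "k \<in> {..<d} \<times> {..<p}" for X k
  proof -
    obtain a l where al: "k = (a, l)" "a < d" "l < p" using k by auto
    have "(X (a, l))\<^sup>2 \<le> (\<Sum>c<p + d. (X (a, c))\<^sup>2)"
      by (rule member_le_sum) (use al in auto)
    also have "\<dots> = 1" using X al by (simp add: P_def power2_eq_square)
    finally show ?thesis using al by (simp add: abs_square_le_1)
  qed
  have "\<exists>F. finite F \<and> F \<subseteq> P \<and> (\<forall>X\<in>P. \<exists>Y\<in>F. \<forall>k\<in>{..<d} \<times> {..<p}. \<bar>X k - Y k\<bar> \<le> 1 / real m)"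
    by (rule finite_net) (use bnd m in auto)
  then obtain F where F: "finite F" "F \<subseteq> P"
    "\<And>X. X \<in> P \<Longrightarrow> \<exists>Y\<in>F. \<forall>k\<in>{..<d} \<times> {..<p}. \<bar>X k - Y k\<bar> \<le> 1 / real m" by blast
  \<comment> \<open>Any polar factor shows that \<open>P\<close>, and hence the net, is
    nonempty.\<close>
  obtain X0 where "X0 \<in> P"
  proof -
    have one: "(1 :: real) > 0" by simp
    obtain X where "\<And>a b. a < d \<Longrightarrow> b < d \<Longrightarrow> (\<Sum>c<p + d. X (a, c) * X (b, c)) = (if a = b then 1 else 0 :: real)"
      using polar_factor[OF one, where d = d and p = p] by blast
    then show thesis using that[of X] by (auto simp: P_def)
  qed
  then obtain Y0 where Y0: "Y0 \<in> F" using F(3) by blast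
  obtain ys where ys: "set ys = F" using finite_list[OF F(1)] by blast
  \<comment> \<open>The list is prolonged by copies of \<open>Y0\<close> until \<open>d * n\<close>
    columns have room for \<open>p + d\<close>.\<close>
  define n where "n = length ys + p + d"
  define Y where "Y i = (if i < length ys then ys ! i else Y0)" for i
  have YF: "Y i \<in> P" for i using ys Y0 F(2) by (auto simp: Y_def)
  show thesis
  proof (rule that[of n Y])
    show "n > 0" using d_pos by (simp add: n_def)
    have "p + d \<le> n" by (simp add: n_def)
    also have "n \<le> d * n" using d_pos by simp
    finally show "p + d \<le> d * n" .
    show "(\<Sum>c<p + d. Y i (a, c) * Y i (b, c)) = (if a = b then 1 else 0)" if "a < d" "b < d" for i a b
      using YF[of i] that by (simp add: P_def)
    fix X :: "nat \<times> nat \<Rightarrow> real"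
    assume "\<And>a b. a < d \<Longrightarrow> b < d \<Longrightarrow> (\<Sum>c<p + d. X (a, c) * X (b, c)) = (if a = b then 1 else 0)"
    then have "X \<in> P" by (simp add: P_def)
    then obtain Z where Z: "Z \<in> F" "\<forall>k\<in>{..<d} \<times> {..<p}. \<bar>X k - Z k\<bar> \<le> 1 / real m" using F(3) by blast
    then obtain k where "k < length ys" "ys ! k = Z" using ys by (metis in_set_conv_nth)
    then show "\<exists>k<n. \<forall>a<d. \<forall>l<p. \<bar>X (a, l) - Y k (a, l)\<bar> \<le> 1 / real m"
      using Z by (intro exI[of _ k]) (auto simp: n_def Y_def)
  qed
qed

text \<open>Both bounds for given \<open>p\<close> and mesh \<open>1 / m\<close>; \<open>L\<close>
  is the mean computed in \<open>pairing_lower_moment\<close>, and only the choice of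
  \<open>p\<close> and \<open>m\<close> is left open.\<close>

lemma integrality_gap:
  fixes m :: nat
  defines "L \<equiv> \<sigma> * sqrt p * real d * (1 - (real d + 1) / (2 * real p)) - 1 / real m * (real d * real p * (1 + \<sigma>\<^sup>2))"
  assumes m: "m > 0" and L: "L \<ge> 0"
  shows "\<exists>n C. C \<in> carrier_mat (d * n) (d * n) \<and> transpose_mat C = C \<and>
    (\<forall>v \<in> carrier_vec (d * n). scalar_prod v (C *\<^sub>v v) \<ge> 0) \<and>
    L\<^sup>2 / real p \<le> relax_val C d n \<and> orth_val C d n \<le> square_mean\<^sup>2 / real d"
proof -
  obtain n Y where n: "n > 0" "p + d \<le> d * n"
    and Y: "\<And>i a b. i < n \<Longrightarrow> a < d \<Longrightarrow> b < d \<Longrightarrow> (\<Sum>c<p + d. Y i (a, c) * Y i (b, c)) = (if a = b then 1 else 0 :: real)"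
    and net: "\<And>X. (\<And>a b. a < d \<Longrightarrow> b < d \<Longrightarrow> (\<Sum>c<p + d. X (a, c) * X (b, c)) = (if a = b then 1 else 0 :: real)) \<Longrightarrow>
      \<exists>k<n. \<forall>a<d. \<forall>l<p. \<bar>X (a, l) - Y k (a, l)\<bar> \<le> 1 / real m"
    using stiefel_net[OF m] by blast
  interpret gaussian_cells d p \<sigma> n Y by unfold_locales (rule n(1))
  define t where "t = \<sigma> * sqrt p"
  have t: "t > 0" using \<sigma>_pos d_less_p by (simp add: t_def)
  define \<psi> where "\<psi> = (\<lambda>V. 3 / 2 * (\<Sum>a<d. \<Sum>l<p. (V (a, l))\<^sup>2) / t
      - 1 / 2 * (\<Sum>a<d. \<Sum>b<d. (\<Sum>l<p. V (a, l) * V (b, l))\<^sup>2) / t ^ 3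
      - 1 / real m * (real d * real p + (\<Sum>a<d. \<Sum>l<p. (V (a, l :: nat))\<^sup>2)))"
  have \<psi>: "integrable \<mu> \<psi>" "(\<integral>V. \<psi> V \<partial>\<mu>) = L"
    unfolding \<psi>_def t_def L_def by (rule pairing_lower_moment)+
  have best: "\<exists>k<n. \<psi> V \<le> score V k" for V
  proof -
    obtain X where X: "\<And>a b. a < d \<Longrightarrow> b < d \<Longrightarrow> (\<Sum>c<p + d. X (a, c) * X (b, c)) = (if a = b then 1 else 0 :: real)"
      and VX: "(\<Sum>a<d. \<Sum>l<p. V (a, l) * X (a, l)) \<ge> 3 / 2 * (\<Sum>a<d. \<Sum>l<p. (V (a, l))\<^sup>2) / t
        - 1 / 2 * (\<Sum>a<d. \<Sum>b<d. (\<Sum>l<p. V (a, l) * V (b, l))\<^sup>2) / t ^ 3"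
      using polar_factor[where v = V and d = d and p = p, OF t] by blast
    obtain k where k: "k < n" "\<forall>a<d. \<forall>l<p. \<bar>X (a, l) - Y k (a, l)\<bar> \<le> 1 / real m"
      using net[of X] X by blast
    have "(\<Sum>a<d. \<Sum>l<p. V (a, l) * X (a, l)) \<le> score V k + 1 / real m * (\<Sum>a<d. \<Sum>l<p. \<bar>V (a, l)\<bar>)"
      unfolding score_def by (rule pairing_net_error) (use k in auto)
    moreover have "1 / real m * (\<Sum>a<d. \<Sum>l<p. \<bar>V (a, l)\<bar>)
        \<le> 1 / real m * (real d * real p + (\<Sum>a<d. \<Sum>l<p. (V (a, l))\<^sup>2))"
    proof (rule mult_left_mono)
      \<comment> \<open>This trades the absolute entries in the net error for the squares whose mean
        is known.\<close>
      have abs: "\<bar>x\<bar> \<le> 1 + x\<^sup>2" for x :: real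
      proof -
        have "0 \<le> (\<bar>x\<bar> - 1)\<^sup>2" by simp
        then have "2 * \<bar>x\<bar> \<le> 1 + x\<^sup>2" by (simp add: power2_diff)
        then show ?thesis using abs_ge_zero[of x] by linarith
      qed
      have "(\<Sum>a<d. \<Sum>l<p. \<bar>V (a, l)\<bar>) \<le> (\<Sum>a<d. \<Sum>l<p. 1 + (V (a, l))\<^sup>2)"
        by (intro sum_mono abs)
      then show "(\<Sum>a<d. \<Sum>l<p. \<bar>V (a, l)\<bar>) \<le> real d * real p + (\<Sum>a<d. \<Sum>l<p. (V (a, l))\<^sup>2)"
        by (simp add: sum.distrib)
    qed simp
    ultimately have "\<psi> V \<le> score V k" using VX unfolding \<psi>_def by linarith
    then show ?thesis using k(1) by blast
  qed
  have "L\<^sup>2 / real p \<le> relax_val C d n"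
    using relax_val_ge[OF n(2) Y \<psi>(1) best] \<psi>(2) L by simp
  then show ?thesis
    using gram_cost_carrier gram_cost_symmetric gram_cost_psd orth_val_le by blast
qed

end

text \<open>The clause \<open>relax_val C d n > 0\<close> makes the quotient genuine, since division
  by zero yields 0.\<close>

theorem theorem5:
  fixes d :: nat and \<epsilon> :: real
  assumes "d \<ge> 1" and "\<epsilon> > 0"
  shows "\<exists>(n::nat) (C::real Matrix.mat).
           C \<in> carrier_mat (d * n) (d * n) \<and>
           transpose_mat C = C \<and>
           (\<forall>v \<in> carrier_vec (d * n). scalar_prod v (C *\<^sub>v v) \<ge> 0) \<and>
           relax_val C d n > 0 \<and>
           orth_val C d n / relax_val C d n \<le> (alpha_R d)\<^sup>2 + \<epsilon>"
proof -
  define \<sigma> where "\<sigma> = sqrt (1 / real d)"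
  define \<alpha> where "\<alpha> = alpha_R d"
  \<comment> \<open>Chosen so that \<open>\<alpha>\<^sup>2\<close> equals
    \<open>1 - 2 * \<delta>\<close> times \<open>\<alpha>\<^sup>2 + \<epsilon>\<close>, while
    \<open>(1 - \<delta>)\<^sup>2\<close> is at least \<open>1 - 2 * \<delta>\<close>.\<close>
  define \<delta> where "\<delta> = \<epsilon> / (2 * (\<alpha>\<^sup>2 + \<epsilon>))"
  have d: "real d > 0" using assms by simp
  have \<sigma>: "\<sigma> > 0" "\<sigma>\<^sup>2 = 1 / real d" using d by (auto simp: \<sigma>_def)
  have den: "\<alpha>\<^sup>2 + \<epsilon> > 0" using assms by (simp add: add_nonneg_pos)
  have \<delta>: "\<delta> > 0" "\<delta> \<le> 1 / 2" using assms den by (auto simp: \<delta>_def field_simps)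
  \<comment> \<open>This size of \<open>p\<close> keeps the relative loss from the fourth moment
    below \<open>\<delta> / 2\<close>.\<close>
  obtain p :: nat where "real p > max (real d) ((real d + 1) / \<delta>)" using reals_Archimedean2 by blast
  then have p: "d < p" "(real d + 1) / \<delta> < real p" by auto
  have p1: "(real d + 1) / (2 * real p) \<le> \<delta> / 2"
    using p \<delta> by (simp add: field_simps)
  \<comment> \<open>Once \<open>p\<close> is fixed, this mesh makes the net error at most the other
    \<open>\<delta> / 2\<close>.\<close>
  obtain m :: nat where m': "real m > max 0 (2 * sqrt p * (1 + \<sigma>\<^sup>2) / (\<sigma> * \<delta>))"
    using reals_Archimedean2 by blast
  then have m: "m > 0" by simp
  interpret gaussian_matrix d p \<sigma> by unfold_locales (use assms p \<sigma> in auto)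
  define L where "L = \<sigma> * sqrt p * real d * (1 - (real d + 1) / (2 * real p)) - 1 / real m * (real d * real p * (1 + \<sigma>\<^sup>2))"
  have sp: "sqrt p > 0" using p by simp
  have err: "1 / real m * (real d * real p * (1 + \<sigma>\<^sup>2)) \<le> \<sigma> * sqrt p * real d * (\<delta> / 2)"
  proof -
    have "2 * sqrt p * (1 + \<sigma>\<^sup>2) \<le> real m * (\<sigma> * \<delta>)"
      using m' \<sigma>(1) \<delta>(1) by (simp add: field_simps)
    then have "(2 * sqrt p * (1 + \<sigma>\<^sup>2)) * (sqrt p * real d) \<le> (real m * (\<sigma> * \<delta>)) * (sqrt p * real d)"
      using sp d by (intro mult_right_mono) auto
    moreover have "sqrt p * sqrt p = real p" by simp
    ultimately have "2 * (real d * real p * (1 + \<sigma>\<^sup>2)) \<le> real m * (\<sigma> * sqrt p * real d * \<delta>)"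
      by (metis (no_types, opaque_lifting) mult.assoc mult.commute)
    then show ?thesis using m by (simp add: field_simps)
  qed
  have "\<sigma> * sqrt p * real d * (1 - \<delta> / 2) \<le> \<sigma> * sqrt p * real d * (1 - (real d + 1) / (2 * real p))"
    using p1 \<sigma>(1) sp d by (intro mult_left_mono) auto
  moreover have "\<sigma> * sqrt p * real d * (1 - \<delta>) = \<sigma> * sqrt p * real d * (1 - \<delta> / 2) - \<sigma> * sqrt p * real d * (\<delta> / 2)"
    by (simp add: algebra_simps)
  ultimately have L: "\<sigma> * sqrt p * real d * (1 - \<delta>) \<le> L"
    using err unfolding L_def by linarith
  have base: "\<sigma> * sqrt p * real d * (1 - \<delta>) > 0" using \<sigma>(1) sp d \<delta> by simp
  then have "L \<ge> 0" using L by linarith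
  then obtain n C where C: "C \<in> carrier_mat (d * n) (d * n)" "transpose_mat C = C"
    "\<forall>v \<in> carrier_vec (d * n). scalar_prod v (C *\<^sub>v v) \<ge> 0"
    and relax: "L\<^sup>2 / real p \<le> relax_val C d n" and orth: "orth_val C d n \<le> square_mean\<^sup>2 / real d"
    using integrality_gap[OF m] unfolding L_def by blast
  have sm: "square_mean = real d * \<alpha>"
    unfolding square_mean_def \<alpha>_def alpha_R_def \<sigma>_def[symmetric] using d by simp
  have "square_mean\<^sup>2 / real d = real d * \<alpha>\<^sup>2"
    using d by (simp add: sm power2_eq_square)
  with orth have orth': "orth_val C d n \<le> real d * \<alpha>\<^sup>2" by simp
  \<comment> \<open>With \<open>\<sigma>\<^sup>2 = 1 / real d\<close> the powers of \<open>p\<close>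
    cancel and the relaxed value is nearly \<open>d\<close>, against \<open>d\<close> times
    \<open>\<alpha>\<^sup>2\<close> on the orthogonal side.\<close>
  have "real d * (1 - \<delta>)\<^sup>2 = (\<sigma> * sqrt p * real d * (1 - \<delta>))\<^sup>2 / real p"
    using d p by (simp add: power_mult_distrib \<sigma>(2) power2_eq_square[of "real d"])
  also have "\<dots> \<le> L\<^sup>2 / real p"
    using L base by (intro divide_right_mono power_mono) auto
  finally have relax': "real d * (1 - \<delta>)\<^sup>2 \<le> relax_val C d n" using relax by simp
  have pos: "relax_val C d n > 0"
  proof -
    have "real d * (1 - \<delta>)\<^sup>2 > 0" using d \<delta> by simp
    then show ?thesis using relax' by linarith
  qed
  have "\<alpha>\<^sup>2 = (\<alpha>\<^sup>2 + \<epsilon>) * (1 - 2 * \<delta>)" using den by (simp add: \<delta>_def field_simps)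
  also have "\<dots> \<le> (\<alpha>\<^sup>2 + \<epsilon>) * (1 - \<delta>)\<^sup>2"
    using den by (intro mult_left_mono) (simp_all add: power2_diff)
  finally have "real d * \<alpha>\<^sup>2 \<le> (\<alpha>\<^sup>2 + \<epsilon>) * (real d * (1 - \<delta>)\<^sup>2)"
    using d by (simp add: mult.left_commute)
  also have "\<dots> \<le> (\<alpha>\<^sup>2 + \<epsilon>) * relax_val C d n"
    using relax' den by (intro mult_left_mono) auto
  finally have "orth_val C d n / relax_val C d n \<le> \<alpha>\<^sup>2 + \<epsilon>"
    using orth' pos by (simp add: pos_divide_le_eq)
  then show ?thesis using C pos unfolding \<alpha>_def by blast
qed

end
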